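(* Let $\widetilde S$ be an elephant random walk on $\mathbb Z$ with memory parameter $p\in[0,1)$, let $\mathcal R_n:=\{\widetilde S_0,\ldots,\widetilde S_n\}$, and let $(B_t)_{t\ge0}$ be a standard Brownian motion. (i) If $p<3/4$, then $$\left(\frac{|\mathcal R_{\lfloor nt\rfloor}|}{\sqrt n}\right)_{t\ge0}\Longrightarrow\bigl(\operatorname{Osc}_t(\widehat B)\bigr)_{t\ge0}.$$ (ii) If $p=3/4$, then $$\left(\frac{|\mathcal R_{\lfloor nt\rfloor}|}{\sqrt{n\log n}}\right)_{t\ge0}\Longrightarrow\bigl(\sqrt t\,|B_1|\bigr)_{t\ge0}.$$ Both convergences hold as $n\to\infty$ in $D([0,\infty))$ with the Skorokhod topology.
   Context: Elephant random walk (ERW) on $\mathbb Z$ with memory parameter $p\in[0,1)$: the increments $X_1,X_2,\ldots\in\{+1,-1\}$ are defined as follows. $X_1$ is uniform on $\{+1,-1\}$. At each time $n\ge2$, a time $u_n$ is chosen uniformly from $\{1,\ldots,n-1\}$ (independently of the past); with probability $p$ one sets $X_n=X_{u_n}$, and with probability $1-p$ one sets $X_n=-X_{u_n}$. The walk is $\widetilde S_0=0$, $\widetilde S_n=\sum_{j=1}^nX_j$. For $p<3/4$, the noise-reinforced Brownian motion $\widehat B$ is a process with the same law as $\left(\frac{t^{2p-1}}{\sqrt{3-4p}}B_{t^{3-4p}}\right)_{t\ge0}$, with value $0$ at $t=0$ by continuous extension. For $f\in D([0,\infty))$, $\operatorname{Osc}_t(f):=\sup_{0\le s\le t}f(s)-\inf_{0\le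 s\le t}f(s)$. The symbol $\Longrightarrow$ denotes convergence in distribution. *)

theory Defs
  imports "HOL-Probability.Probability"
begin

section \<open>The Skorokhod space on the half-line\<close>

text \<open>
  Paths are total functions on the reals, made \<^const>\<open>undefined\<close> on the negative half-line so
  that two paths are equal iff they agree on \<open>[0, \<infinity>)\<close>.
\<close>

definition cadlag_paths :: "(real \<Rightarrow> real) set" where
  "cadlag_paths = {f \<in> extensional {0..}.
     \<forall>t\<ge>0. (f \<longlongrightarrow> f t) (at_right t) \<and> (t > 0 \<longrightarrow> (\<exists>l. (f \<longlongrightarrow> l) (at_left t)))}"

text \<open>Being increasing bijections of \<open>[0, \<infinity>)\<close>, time changes are automatically homeomorphisms.\<close>

definition time_changes :: "(real \<Rightarrow> real) set" where
  "time_changes = {c. bij_betw c {0..} {0..} \<and> strict_mono_on {0..} c}"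

definition skorokhod_nhd :: "(real \<Rightarrow> real) \<Rightarrow> real \<Rightarrow> real \<Rightarrow> (real \<Rightarrow> real) set" where
  "skorokhod_nhd x T e = {y \<in> cadlag_paths. \<exists>c\<in>time_changes.
     (\<forall>t\<ge>0. \<bar>c t - t\<bar> < e) \<and> (\<forall>t\<in>{0..T}. \<bar>y (c t) - x t\<bar> < e)}"

text \<open>
  The J1 topology. A sequence \<open>y n\<close> is eventually in every \<open>skorokhod_nhd x T e\<close> iff there are
  time changes \<open>c n\<close> such that \<open>c n t - t\<close> tends to 0 uniformly in \<open>t \<ge> 0\<close> and
  \<open>y n (c n t) - x t\<close> tends to 0 uniformly on every bounded time interval. This is the
  convergence by which the J1 topology on \<open>D([0, \<infinity>))\<close> is described (Jacod and Shiryaev, Limit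
  Theorems for Stochastic Processes, VI.1.14; Billingsley, Convergence of Probability Measures,
  Theorem 16.1). Since these sets and the balls of a J1 metric around \<open>x\<close> both generate countably
  based filters, the two filters are equal, and so are the topologies.
\<close>

definition skorokhod_topology :: "(real \<Rightarrow> real) topology" where
  "skorokhod_topology = topology (\<lambda>U. U \<subseteq> cadlag_paths \<and>
     (\<forall>x\<in>U. \<exists>T e. e > 0 \<and> skorokhod_nhd x T e \<subseteq> U))"

lemma skorokhod_nhd_mono:
  assumes "T' \<le> T" "e \<le> e'"
  shows "skorokhod_nhd x T e \<subseteq> skorokhod_nhd x T' e'"
proof
  fix y assume "y \<in> skorokhod_nhd x T e"
  then obtain c where "y \<in> cadlag_paths" and c: "c \<in> time_changes"
    "\<forall>t\<ge>0. \<bar>c t - t\<bar> < e" "\<forall>t\<in>{0..T}. \<bar>y (c t) - x t\<bar> < e"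
    unfolding skorokhod_nhd_def by blast
  moreover have "\<forall>t\<ge>0. \<bar>c t - t\<bar> < e'" "\<forall>t\<in>{0..T'}. \<bar>y (c t) - x t\<bar> < e'"
    using c(2,3) assms by (auto intro: less_le_trans)
  ultimately show "y \<in> skorokhod_nhd x T' e'"
    unfolding skorokhod_nhd_def by blast
qed

lemma openin_skorokhod_topology:
  "openin skorokhod_topology U \<longleftrightarrow>
     U \<subseteq> cadlag_paths \<and> (\<forall>x\<in>U. \<exists>T e. e > 0 \<and> skorokhod_nhd x T e \<subseteq> U)"
proof -
  let ?P = "\<lambda>U. U \<subseteq> cadlag_paths \<and> (\<forall>x\<in>U. \<exists>T e. e > 0 \<and> skorokhod_nhd x T e \<subseteq> U)"
  have "istopology ?P"
    unfolding istopology_def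
  proof (intro conjI allI impI)
    fix S S' assume S: "?P S" and S': "?P S'"
    show "S \<inter> S' \<subseteq> cadlag_paths" using S by blast
    show "\<forall>x\<in>S \<inter> S'. \<exists>T e. e > 0 \<and> skorokhod_nhd x T e \<subseteq> S \<inter> S'"
    proof
      fix x assume "x \<in> S \<inter> S'"
      then obtain T e T' e' where "e > 0" "skorokhod_nhd x T e \<subseteq> S"
        and "e' > 0" "skorokhod_nhd x T' e' \<subseteq> S'"
        using S S' by blast
      moreover have "skorokhod_nhd x (max T T') (min e e') \<subseteq> skorokhod_nhd x T e"
        "skorokhod_nhd x (max T T') (min e e') \<subseteq> skorokhod_nhd x T' e'"
        by (simp_all add: skorokhod_nhd_mono)
      ultimately have "min e e' > 0 \<and> skorokhod_nhd x (max T T') (min e e') \<subseteq> S \<inter> S'"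
        by auto
      then show "\<exists>T e. e > 0 \<and> skorokhod_nhd x T e \<subseteq> S \<inter> S'" by blast
    qed
  next
    fix K assume K: "\<forall>S\<in>K. ?P S"
    show "\<Union>K \<subseteq> cadlag_paths" using K by blast
    show "\<forall>x\<in>\<Union>K. \<exists>T e. e > 0 \<and> skorokhod_nhd x T e \<subseteq> \<Union>K"
      using K by (meson UnionE Union_upper order_trans)
  qed
  then show ?thesis
    unfolding skorokhod_topology_def by (simp add: topology_inverse')
qed

lemma topspace_skorokhod_topology: "topspace skorokhod_topology = cadlag_paths"
proof -
  have "openin skorokhod_topology cadlag_paths"
    unfolding openin_skorokhod_topology
    by (auto simp: skorokhod_nhd_def intro!: exI[of _ "1::real"])
  then show ?thesis
    by (metis openin_skorokhod_topology openin_subset openin_topspace subset_antisym)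
qed


section \<open>Convergence in distribution\<close>

definition borel_sigma :: "'s topology \<Rightarrow> 's measure" where
  "borel_sigma T = sigma (topspace T) {U. openin T U}"

text \<open>
  The limit may live on a different probability space. Measurability is part of the notion: the
  \<open>X n\<close> and \<open>Y\<close> must be random elements of the space, so the integrals are genuine expectations.
\<close>

definition converges_in_distribution ::
  "'s topology \<Rightarrow> 'a measure \<Rightarrow> (nat \<Rightarrow> 'a \<Rightarrow> 's) \<Rightarrow> 'b measure \<Rightarrow> ('b \<Rightarrow> 's) \<Rightarrow> bool" where
  "converges_in_distribution T M X N Y \<longleftrightarrow>
     (\<forall>n. X n \<in> measurable M (borel_sigma T)) \<and> Y \<in> measurable N (borel_sigma T) \<and>
     (\<forall>f. continuous_map T euclideanreal f \<and> bounded (f ` topspace T) \<longrightarrow>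
        (\<lambda>n. \<integral>\<omega>. f (X n \<omega>) \<partial>M) \<longlonglongrightarrow> (\<integral>\<omega>. f (Y \<omega>) \<partial>N))"


section \<open>Elephant random walk\<close>

text \<open>
  \<open>\<epsilon> n\<close> is the coin of step \<open>n \<ge> 2\<close>: 1 to repeat the remembered increment, \<open>-1\<close> to reverse it.
  The independence assumption is joint independence of \<open>X 1\<close>, all coins and all remembered times;
  the values \<open>X 0\<close>, \<open>u 0\<close>, \<open>u 1\<close>, \<open>\<epsilon> 0\<close>, \<open>\<epsilon> 1\<close> play no role.
\<close>

locale elephant_random_walk = prob_space M
  for M :: "'a measure" +
  fixes p :: real
    and X :: "nat \<Rightarrow> 'a \<Rightarrow> int"
    and u :: "nat \<Rightarrow> 'a \<Rightarrow> nat"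
    and \<epsilon> :: "nat \<Rightarrow> 'a \<Rightarrow> int"
  assumes memory_parameter: "0 \<le> p" "p < 1"
    and first_step_range: "\<omega> \<in> space M \<Longrightarrow> X 1 \<omega> \<in> {1, -1}"
    and first_step_uniform: "prob {\<omega> \<in> space M. X 1 \<omega> = 1} = 1 / 2"
    and memory_range: "n \<ge> 2 \<Longrightarrow> \<omega> \<in> space M \<Longrightarrow> u n \<omega> \<in> {1..n - 1}"
    and memory_uniform: "n \<ge> 2 \<Longrightarrow> k \<in> {1..n - 1} \<Longrightarrow>
          prob {\<omega> \<in> space M. u n \<omega> = k} = 1 / (real n - 1)"
    and coin_range: "n \<ge> 2 \<Longrightarrow> \<omega> \<in> space M \<Longrightarrow> \<epsilon> n \<omega> \<in> {1, -1}"
    and coin_bias: "n \<ge> 2 \<Longrightarrow> prob {\<omega> \<in> space M. \<epsilon> n \<omega> = 1} = p"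
    and independent: "indep_vars (\<lambda>_. count_space UNIV)
          (case_sum (\<epsilon>(1 := X 1)) (\<lambda>n \<omega>. int (u n \<omega>))) ({1..} <+> {2..})"
    and step: "n \<ge> 2 \<Longrightarrow> \<omega> \<in> space M \<Longrightarrow> X n \<omega> = \<epsilon> n \<omega> * X (u n \<omega>) \<omega>"

definition walk :: "(nat \<Rightarrow> 'a \<Rightarrow> int) \<Rightarrow> nat \<Rightarrow> 'a \<Rightarrow> int" where
  "walk X n \<omega> = (\<Sum>j=1..n. X j \<omega>)"

definition walk_range :: "(nat \<Rightarrow> 'a \<Rightarrow> int) \<Rightarrow> nat \<Rightarrow> 'a \<Rightarrow> int set" where
  "walk_range X n \<omega> = (\<lambda>k. walk X k \<omega>) ` {0..n}"


section \<open>Brownian motion and its noise-reinforced version\<close>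

locale standard_brownian_motion = prob_space M
  for M :: "'b measure" +
  fixes B :: "real \<Rightarrow> 'b \<Rightarrow> real"
  assumes random_variable: "t \<ge> 0 \<Longrightarrow> random_variable borel (B t)"
    and starts_at_zero: "\<omega> \<in> space M \<Longrightarrow> B 0 \<omega> = 0"
    and continuous_paths: "\<omega> \<in> space M \<Longrightarrow> continuous_on {0..} (\<lambda>t. B t \<omega>)"
    and normal_increments: "0 \<le> s \<Longrightarrow> s < t \<Longrightarrow>
          distributed M lborel (\<lambda>\<omega>. B t \<omega> - B s \<omega>) (normal_density 0 (sqrt (t - s)))"
    and independent_increments: "0 \<le> \<tau> 0 \<Longrightarrow> (\<And>i. i < n \<Longrightarrow> \<tau> i \<le> \<tau> (Suc i)) \<Longrightarrow>
          indep_vars (\<lambda>_. borel) (\<lambda>i \<omega>. B (\<tau> (Suc i)) \<omega> - B (\<tau> i) \<omega>) {..<n}"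

definition time_changed_bm :: "real \<Rightarrow> (real \<Rightarrow> 'b \<Rightarrow> real) \<Rightarrow> real \<Rightarrow> 'b \<Rightarrow> real" where
  "time_changed_bm p B t \<omega> =
     (if t = 0 then 0 else t powr (2 * p - 1) / sqrt (3 - 4 * p) * B (t powr (3 - 4 * p)) \<omega>)"

text \<open>
  The paths of \<^const>\<open>time_changed_bm\<close> are continuous at 0 only almost surely. A noise-reinforced
  Brownian motion is therefore a process with continuous paths that has the same law as
  \<^const>\<open>time_changed_bm\<close>, as a probability measure on the product space indexed by \<open>[0, \<infinity>)\<close>.
\<close>

locale noise_reinforced_brownian_motion =
  bm: standard_brownian_motion M B + prob_space N
  for M :: "'b measure" and B :: "real \<Rightarrow> 'b \<Rightarrow> real" and N :: "'c measure" +
  fixes p :: real and Z :: "real \<Rightarrow> 'c \<Rightarrow> real"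
  assumes memory_parameter: "p < 3 / 4"
    and random_variable: "t \<ge> 0 \<Longrightarrow> random_variable borel (Z t)"
    and continuous_paths: "\<omega> \<in> space N \<Longrightarrow> continuous_on {0..} (\<lambda>t. Z t \<omega>)"
    and same_law:
      "distr N (\<Pi>\<^sub>M t\<in>{0..}. borel) (\<lambda>\<omega>. \<lambda>t\<in>{0..}. Z t \<omega>) =
       distr M (\<Pi>\<^sub>M t\<in>{0..}. borel) (\<lambda>\<omega>. \<lambda>t\<in>{0..}. time_changed_bm p B t \<omega>)"

definition Osc :: "real \<Rightarrow> (real \<Rightarrow> real) \<Rightarrow> real" where
  "Osc t f = (SUP s\<in>{0..t}. f s) - (INF s\<in>{0..t}. f s)"

end

theory Submission
  imports Defs "HOL-Real_Asymp.Real_Asymp"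
begin

text \<open>The walk makes steps \<open>\<plusminus>1\<close>, so the sites visited up to time \<open>k\<close> form an interval, and the rescaled range is,
up to the vanishing term \<open>1 / b n\<close>, the oscillation of the rescaled walk \<open>S (n t) / b n\<close>, where \<open>b n\<close> is
\<open>sqrt n\<close> or \<open>sqrt (n log n)\<close>. The oscillation is a Lipschitz functional of the path, and
\<open>sqrt t * \<bar>B 1\<bar>\<close> is the oscillation of the path \<open>sqrt s * B 1\<close>. Both parts are therefore instances of one
functional limit theorem for the walk, proved in the locale \<open>erw_scaling\<close>, with limit \<open>Bhat\<close> or
\<open>sqrt t * B 1\<close>.

The walk is a Markov chain in spite of its memory: the frequency of each sign among the first \<open>j\<close>
increments is a function of the position, so the next increment has mean \<open>\<alpha> * S j / j\<close> with
\<open>\<alpha> = 2 * p - 1\<close> (\<open>expectation_step\<close>). Hence \<open>S N\<close> has conditional mean \<open>rho n N * S n\<close> given the past of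
\<open>n\<close>, where \<open>rho n N\<close> is the product of the factors \<open>1 + \<alpha> / i\<close> and behaves like \<open>(N / n) powr \<alpha>\<close>; an
increment made at time \<open>j\<close> enters \<open>S N\<close> with weight \<open>rho (Suc j) N\<close>. Replacing the centred increments
one by one by independent Gaussian variables of variance 1 (Lindeberg's method,
\<open>lindeberg_lipschitz\<close>) shows that, given the past of \<open>n\<close>, \<open>S N\<close> is asymptotically normal. For
\<open>\<alpha> < 1 / 2\<close> the squared weights \<open>(N / j) powr (2 * \<alpha>)\<close> sum to order \<open>N\<close> over every macroscopic block of
times, so each block contributes fresh noise. For \<open>\<alpha> = 1 / 2\<close> they sum to \<open>N log N\<close>, but only to order
\<open>N\<close> over the times between \<open>n s\<close> and \<open>n t\<close>: after the scaling, all randomness comes from microscopic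
times and the path is a random multiple of \<open>sqrt t\<close>.

Iterating the one-step approximation gives the convergence at finitely many times
(\<open>sample_convergence\<close>), since the limiting process satisfies exactly the recursion that the walk
satisfies asymptotically (\<open>time_changed_bm_markov\<close>, \<open>sqrt_markov\<close>). The passage to whole paths uses the
fourth moments of the increments, which are of order \<open>(b n)^4 * (length / n)\<^sup>2\<close>
(\<open>fourth_moment_increment\<close>). Because the exponent 2 exceeds 1, a doubling argument bounds the maximum
of the increments over a block by the same order (\<open>maximal_inequality\<close>), and the walk stays uniformly
close to its values on a grid (\<open>range_functional_convergence\<close>).

On the side of the Skorokhod space, a bounded continuous functional is the increasing limit of
functionals that are Lipschitz for a metric of locally uniform convergence, which dominates the
J1 topology. Convergence of the expectations of such Lipschitz functionals is thus enough
(\<open>converges_in_distribution_skorokhodI\<close>).\<close>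

section \<open>Lipschitz functionals of paths\<close>

text \<open>A metric for uniform convergence on bounded time intervals. Cutting the difference off at \<open>1 / (1 + t)\<close>
keeps it a supremum of pseudometrics, so that the triangle inequality and estimates on \<open>[0, T]\<close> are
immediate.\<close>

definition path_dist :: "(real \<Rightarrow> real) \<Rightarrow> (real \<Rightarrow> real) \<Rightarrow> real" where
  "path_dist x y = (SUP t\<in>{0..}. min \<bar>x t - y t\<bar> (1 / (1 + t)))"

lemma path_dist_bdd: "bdd_above ((\<lambda>t::real. min \<bar>x t - y t\<bar> (1 / (1 + t))) ` {0..})"
proof (rule bdd_aboveI2[of _ _ 1])
  fix t :: real assume "t \<in> {0..}"
  then have "1 / (1 + t) \<le> 1" by simp
  then show "min \<bar>x t - y t\<bar> (1 / (1 + t)) \<le> 1" by linarith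
qed

lemma path_dist_upper: "t \<ge> 0 \<Longrightarrow> min \<bar>x t - y t\<bar> (1 / (1 + t)) \<le> path_dist x y"
  unfolding path_dist_def by (rule cSUP_upper2[OF path_dist_bdd, of t]) auto

lemma path_dist_least:
  "(\<And>t. t \<ge> 0 \<Longrightarrow> min \<bar>x t - y t\<bar> (1 / (1 + t)) \<le> c) \<Longrightarrow> path_dist x y \<le> c"
  unfolding path_dist_def by (rule cSUP_least) auto

lemma path_dist_nonneg: "path_dist x y \<ge> 0"
  using path_dist_upper[of 0 x y] by (auto simp: min_def split: if_splits)

lemma path_dist_le_1: "path_dist x y \<le> 1"
proof (rule path_dist_least)
  fix t :: real assume "t \<ge> 0"
  then have "1 / (1 + t) \<le> 1" by simp
  then show "min \<bar>x t - y t\<bar> (1 / (1 + t)) \<le> 1" by linarith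
qed

lemma path_dist_commute: "path_dist x y = path_dist y x"
  unfolding path_dist_def by (simp add: abs_minus_commute)

lemma path_dist_self: "path_dist x x = 0"
  by (intro antisym path_dist_nonneg path_dist_least) auto

lemma path_dist_triangle: "path_dist x z \<le> path_dist x y + path_dist y z"
proof (rule path_dist_least)
  fix t :: real assume t: "t \<ge> 0"
  have "min \<bar>x t - z t\<bar> (1 / (1 + t)) \<le> min \<bar>x t - y t\<bar> (1 / (1 + t)) + min \<bar>y t - z t\<bar> (1 / (1 + t))"
    using t by (auto simp: min_def)
  also have "\<dots> \<le> path_dist x y + path_dist y z"
    using t by (intro add_mono path_dist_upper) auto
  finally show "min \<bar>x t - z t\<bar> (1 / (1 + t)) \<le> path_dist x y + path_dist y z" .
qed

text \<open>Only the paths up to a finite horizon matter: this is how estimates on bounded time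
  intervals become estimates of \<^const>\<open>path_dist\<close>.\<close>

lemma path_dist_le_horizon:
  assumes "T \<ge> 0" and "\<And>t. 0 \<le> t \<Longrightarrow> t \<le> T \<Longrightarrow> \<bar>x t - y t\<bar> \<le> c"
  shows "path_dist x y \<le> max c (1 / (1 + T))"
proof (rule path_dist_least)
  fix t :: real assume "t \<ge> 0"
  show "min \<bar>x t - y t\<bar> (1 / (1 + t)) \<le> max c (1 / (1 + T))"
  proof (cases "t \<le> T")
    case True then show ?thesis using assms(2)[of t] \<open>t \<ge> 0\<close> by linarith
  next
    case False
    then have "1 / (1 + t) \<le> 1 / (1 + T)" using assms(1) by (intro divide_left_mono) auto
    then show ?thesis by linarith
  qed
qed

text \<open>Locally uniform closeness is Skorokhod closeness with the identity as time change.\<close>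

lemma path_dist_ball_subset_nhd:
  assumes "e > 0"
  obtains d where "d > 0" "\<And>y. y \<in> cadlag_paths \<Longrightarrow> path_dist x y < d \<Longrightarrow> y \<in> skorokhod_nhd x T e"
proof
  define d where "d = min e (1 / (1 + max T 0))"
  show "d > 0" using assms by (simp add: d_def)
  fix y assume y: "y \<in> cadlag_paths" "path_dist x y < d"
  have "\<bar>y t - x t\<bar> < e" if t: "t \<in> {0..T}" for t
  proof -
    have "min \<bar>x t - y t\<bar> (1 / (1 + t)) < d"
      using path_dist_upper[of t x y] t y(2) by simp
    moreover have "1 / (1 + max T 0) \<le> 1 / (1 + t)" using t by (intro divide_left_mono) auto
    ultimately have "\<bar>x t - y t\<bar> < e" unfolding d_def min_def by (simp split: if_splits)
    then show ?thesis by (simp add: abs_minus_commute)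
  qed
  moreover have "(\<lambda>t. t) \<in> time_changes"
    by (auto simp: time_changes_def bij_betw_def strict_mono_on_def)
  ultimately show "y \<in> skorokhod_nhd x T e"
    unfolding skorokhod_nhd_def using y assms by (auto intro!: bexI[of _ "\<lambda>t. t"])
qed

definition path_lipschitz :: "real \<Rightarrow> ((real \<Rightarrow> real) \<Rightarrow> real) \<Rightarrow> bool" where
  "path_lipschitz K F \<longleftrightarrow> (\<forall>x y. \<bar>F x - F y\<bar> \<le> K * path_dist x y)"

lemma path_lipschitz_const_nonneg:
  assumes "path_lipschitz K F" shows "K \<ge> 0"
proof -
  have "path_dist (\<lambda>_. 0) (\<lambda>_. 1) \<ge> 1" using path_dist_upper[of 0 "\<lambda>_. 0" "\<lambda>_. 1"] by simp
  moreover have "0 \<le> K * path_dist (\<lambda>_. 0) (\<lambda>_. 1)"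
    using assms unfolding path_lipschitz_def by (meson abs_ge_zero order_trans)
  ultimately show ?thesis by (simp add: zero_le_mult_iff)
qed

lemma path_lipschitz_bounded:
  assumes "path_lipschitz K F"
  shows "\<bar>F x\<bar> \<le> K + \<bar>F (\<lambda>_. 0)\<bar>"
proof -
  have "\<bar>F x - F (\<lambda>_. 0)\<bar> \<le> K * path_dist x (\<lambda>_. 0)" using assms by (simp add: path_lipschitz_def)
  also have "\<dots> \<le> K"
    using path_lipschitz_const_nonneg[OF assms] path_dist_le_1[of x "\<lambda>_. 0"] path_dist_nonneg[of x "\<lambda>_. 0"]
    by (simp add: mult_left_le)
  finally show ?thesis by linarith
qed

text \<open>The inf-convolution (Pasch-Hausdorff envelope) of \<open>f\<close> with \<open>k\<close> times the metric: the largest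
\<open>k\<close>-Lipschitz minorant of \<open>f\<close> on the cadlag paths.\<close>

definition lipschitz_regularization :: "((real \<Rightarrow> real) \<Rightarrow> real) \<Rightarrow> real \<Rightarrow> (real \<Rightarrow> real) \<Rightarrow> real" where
  "lipschitz_regularization f k y = (INF x\<in>cadlag_paths. f x + k * path_dist x y)"

lemma cadlag_paths_nonempty: "cadlag_paths \<noteq> {}"
proof -
  have "(\<lambda>t\<in>{0..}. 0) \<in> cadlag_paths"
  proof -
    have "((\<lambda>t\<in>{0..}. 0::real) \<longlongrightarrow> 0) (at_right t)" if "t \<ge> 0" for t :: real
      by (rule tendsto_eventually) (use that in \<open>auto simp: eventually_at_filter\<close>)
    moreover have "((\<lambda>t\<in>{0..}. 0::real) \<longlongrightarrow> 0) (at_left t)" if "t > 0" for t :: real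
      by (intro tendsto_eventually eventually_mono[OF eventually_at_left_real[OF that]]) auto
    ultimately show ?thesis by (auto simp: cadlag_paths_def intro!: exI[of _ 0])
  qed
  then show ?thesis by blast
qed

context
  fixes f :: "(real \<Rightarrow> real) \<Rightarrow> real" and c :: real
  assumes lower: "\<And>x. x \<in> cadlag_paths \<Longrightarrow> c \<le> f x"
begin

lemma lipschitz_regularization_bdd:
  "k \<ge> 0 \<Longrightarrow> bdd_below ((\<lambda>x. f x + k * path_dist x y) ` cadlag_paths)"
  using lower by (intro bdd_belowI2[of _ c]) (simp add: add_increasing2 path_dist_nonneg)

lemma lipschitz_regularization_ge:
  "k \<ge> 0 \<Longrightarrow> c \<le> lipschitz_regularization f k y"
  unfolding lipschitz_regularization_def using lower
  by (intro cINF_greatest cadlag_paths_nonempty) (simp add: add_increasing2 path_dist_nonneg)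

lemma lipschitz_regularization_le:
  assumes "k \<ge> 0" "y \<in> cadlag_paths"
  shows "lipschitz_regularization f k y \<le> f y"
  unfolding lipschitz_regularization_def
  by (rule cINF_lower2[OF lipschitz_regularization_bdd assms(2)]) (use assms in \<open>auto simp: path_dist_self\<close>)

lemma path_lipschitz_regularization:
  assumes k: "k \<ge> 0"
  shows "path_lipschitz k (lipschitz_regularization f k)"
proof -
  have *: "lipschitz_regularization f k y \<le> lipschitz_regularization f k z + k * path_dist y z" for y z
  proof -
    have "lipschitz_regularization f k y - k * path_dist y z \<le> lipschitz_regularization f k z"
      unfolding lipschitz_regularization_def[of f k z]
    proof (intro cINF_greatest cadlag_paths_nonempty)
      fix x assume x: "x \<in> cadlag_paths"
      have "lipschitz_regularization f k y \<le> f x + k * path_dist x y"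
        unfolding lipschitz_regularization_def
        by (rule cINF_lower[OF lipschitz_regularization_bdd[OF k] x])
      also have "k * path_dist x y \<le> k * (path_dist x z + path_dist z y)"
        by (intro mult_left_mono path_dist_triangle k)
      finally show "lipschitz_regularization f k y - k * path_dist y z \<le> f x + k * path_dist x z"
        by (simp add: path_dist_commute algebra_simps)
    qed
    then show ?thesis by simp
  qed
  show ?thesis unfolding path_lipschitz_def
  proof (intro allI)
    fix x y
    show "\<bar>lipschitz_regularization f k x - lipschitz_regularization f k y\<bar> \<le> k * path_dist x y"
      using *[of x y] *[of y x] by (simp add: path_dist_commute)
  qed
qed

text \<open>In the infimum, a path within distance \<open>d\<close> of \<open>y\<close> has a value of at least \<open>a\<close>, and any other one is
charged the penalty \<open>k * d\<close>. So the envelopes increase to \<open>f\<close> wherever \<open>f\<close> is lower semicontinuous.\<close>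

lemma lipschitz_regularization_greater:
  assumes y: "y \<in> cadlag_paths" and d: "d > 0" and k: "k \<ge> 0" "c + k * d \<ge> a"
    and near: "\<And>x. x \<in> cadlag_paths \<Longrightarrow> path_dist y x < d \<Longrightarrow> a \<le> f x"
  shows "a \<le> lipschitz_regularization f k y"
  unfolding lipschitz_regularization_def
proof (intro cINF_greatest cadlag_paths_nonempty)
  fix x assume x: "x \<in> cadlag_paths"
  show "a \<le> f x + k * path_dist x y"
  proof (cases "path_dist y x < d")
    case True
    then show ?thesis using near[OF x] k path_dist_nonneg[of x y]
      by (metis add.right_neutral add_mono mult_nonneg_nonneg)
  next
    case False
    then have "k * d \<le> k * path_dist x y" using k by (intro mult_left_mono) (auto simp: path_dist_commute)
    then show ?thesis using lower[OF x] k by linarith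
  qed
qed

end

lemma openin_skorokhod_path_ball:
  assumes "openin skorokhod_topology U" "y \<in> U"
  obtains d where "d > 0" "\<And>x. x \<in> cadlag_paths \<Longrightarrow> path_dist y x < d \<Longrightarrow> x \<in> U"
proof -
  obtain T e where "e > 0" "skorokhod_nhd y T e \<subseteq> U"
    using assms unfolding openin_skorokhod_topology by blast
  then show ?thesis using path_dist_ball_subset_nhd[of e y T] that by (metis subsetD)
qed

text \<open>The Borel sets of the Skorokhod topology are generated by open sets \<open>U\<close>, and the envelope of the
indicator of \<open>U\<close> is positive exactly on \<open>U\<close>, because \<open>U\<close> contains a ball of \<^const>\<open>path_dist\<close> around each
of its points.\<close>

lemma measurable_skorokhodI:
  assumes X: "\<And>\<omega>. \<omega> \<in> space M \<Longrightarrow> X \<omega> \<in> cadlag_paths"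
    and meas: "\<And>F K. path_lipschitz K F \<Longrightarrow> (\<lambda>\<omega>. F (X \<omega>)) \<in> borel_measurable M"
  shows "X \<in> measurable M (borel_sigma skorokhod_topology)"
  unfolding borel_sigma_def
proof (rule measurable_measure_of)
  show "{U. openin skorokhod_topology U} \<subseteq> Pow (topspace skorokhod_topology)"
    by (auto dest: openin_subset)
  show "X \<in> space M \<rightarrow> topspace skorokhod_topology"
    using X by (auto simp: topspace_skorokhod_topology)
  fix U assume "U \<in> {U. openin skorokhod_topology U}"
  then have U: "openin skorokhod_topology U" by simp
  \<comment> \<open>The distance to the complement of \<open>U\<close>, or 1 if there is no complement.\<close>
  define G where "G = lipschitz_regularization (indicator U) 1"
  have low: "0 \<le> (indicator U x :: real)" for x by simp
  have "y \<in> U \<longleftrightarrow> G y > 0" if y: "y \<in> cadlag_paths" for y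
  proof
    assume "y \<in> U"
    then obtain d where d: "d > 0" "\<And>x. x \<in> cadlag_paths \<Longrightarrow> path_dist y x < d \<Longrightarrow> x \<in> U"
      using openin_skorokhod_path_ball[OF U] by blast
    have "min 1 d \<le> G y" unfolding G_def
      using d by (intro lipschitz_regularization_greater[OF low y, of d]) auto
    then show "G y > 0" using d(1) by linarith
  next
    assume "G y > 0"
    then show "y \<in> U"
      using lipschitz_regularization_le[of 0 "indicator U" 1 y, OF low _ y]
      by (auto simp: G_def split: split_indicator_asm)
  qed
  then have eq: "X -` U \<inter> space M = {\<omega> \<in> space M. G (X \<omega>) > 0}" using X by auto
  have [measurable]: "(\<lambda>\<omega>. G (X \<omega>)) \<in> borel_measurable M"
    unfolding G_def by (rule meas[OF path_lipschitz_regularization]) auto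
  show "X -` U \<inter> space M \<in> sets M" unfolding eq by measurable
qed

lemma borel_measurable_skorokhod_continuous:
  assumes X: "X \<in> measurable M (borel_sigma skorokhod_topology)"
    and f: "continuous_map skorokhod_topology euclideanreal f"
  shows "(\<lambda>\<omega>. f (X \<omega>)) \<in> borel_measurable M"
  unfolding borel_measurable_iff_greater
proof
  fix a
  let ?U = "{x \<in> topspace skorokhod_topology. f x \<in> {a<..}}"
  have "openin skorokhod_topology ?U"
    using f by (rule openin_continuous_map_preimage) auto
  then have "?U \<in> sets (borel_sigma skorokhod_topology)"
    unfolding borel_sigma_def by (intro in_measure_of) (auto dest: openin_subset)
  then have "X -` ?U \<inter> space M \<in> sets M" using X by (rule measurable_sets[rotated])
  moreover have "X \<omega> \<in> topspace skorokhod_topology" if "\<omega> \<in> space M" for \<omega>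
    using measurable_space[OF X that] by (simp add: borel_sigma_def space_measure_of_conv)
  then have "X -` ?U \<inter> space M = {w \<in> space M. a < f (X w)}" by auto
  ultimately show "{w \<in> space M. a < f (X w)} \<in> sets M" by simp
qed

text \<open>The envelopes of a bounded continuous \<open>f\<close> lie below \<open>f\<close> and increase to it, which gives the lower bound
\<open>E f(Y)\<close> for the limit inferior of \<open>E f(X n)\<close>. The upper bound is the lower bound for \<open>- f\<close>.\<close>

theorem converges_in_distribution_skorokhodI:
  assumes M: "prob_space M" and N: "prob_space N"
    and X: "\<And>n \<omega>. \<omega> \<in> space M \<Longrightarrow> X n \<omega> \<in> cadlag_paths"
    and Y: "\<And>\<omega>. \<omega> \<in> space N \<Longrightarrow> Y \<omega> \<in> cadlag_paths"
    and measX: "\<And>F K n. path_lipschitz K F \<Longrightarrow> (\<lambda>\<omega>. F (X n \<omega>)) \<in> borel_measurable M"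
    and measY: "\<And>F K. path_lipschitz K F \<Longrightarrow> (\<lambda>\<omega>. F (Y \<omega>)) \<in> borel_measurable N"
    and conv: "\<And>F K. path_lipschitz K F \<Longrightarrow>
      (\<lambda>n. \<integral>\<omega>. F (X n \<omega>) \<partial>M) \<longlonglongrightarrow> (\<integral>\<omega>. F (Y \<omega>) \<partial>N)"
  shows "converges_in_distribution skorokhod_topology M X N Y"
proof -
  interpret M: prob_space M by (rule M)
  interpret N: prob_space N by (rule N)
  have mX: "X n \<in> measurable M (borel_sigma skorokhod_topology)" for n
    using X measX by (intro measurable_skorokhodI) auto
  have mY: "Y \<in> measurable N (borel_sigma skorokhod_topology)"
    using Y measY by (intro measurable_skorokhodI) auto
  have lower: "eventually (\<lambda>n. (\<integral>\<omega>. f (X n \<omega>) \<partial>M) > (\<integral>\<omega>. f (Y \<omega>) \<partial>N) - e) sequentially"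
    if f: "continuous_map skorokhod_topology euclideanreal f"
      and b: "\<And>x. x \<in> cadlag_paths \<Longrightarrow> \<bar>f x\<bar> \<le> C" and e: "e > 0" for f C e
  proof -
    have low: "- C \<le> f x" if "x \<in> cadlag_paths" for x using b[OF that] by simp
    define G where "G k = lipschitz_regularization f (real k)" for k
    have Glip: "path_lipschitz (real k) (G k)" for k
      unfolding G_def by (rule path_lipschitz_regularization[OF low]) auto
    have Gle: "G k y \<le> f y" if "y \<in> cadlag_paths" for k y
      unfolding G_def by (rule lipschitz_regularization_le[OF low _ that]) auto
    have Gge: "- C \<le> G k y" for k y
      unfolding G_def by (rule lipschitz_regularization_ge[OF low]) auto
    have Gb: "\<bar>G k y\<bar> \<le> C" if "y \<in> cadlag_paths" for k y
      using Gle[OF that, of k] Gge[of k y] b[OF that] by linarith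
    have lim: "(\<lambda>k. G k y) \<longlonglongrightarrow> f y" if y: "y \<in> cadlag_paths" for y
    proof (rule tendstoI)
      fix r :: real assume r: "r > 0"
      let ?U = "{x \<in> topspace skorokhod_topology. f x \<in> {f y - r/2<..}}"
      have "openin skorokhod_topology ?U"
        using f by (rule openin_continuous_map_preimage) auto
      moreover have "y \<in> ?U" using y r by (simp add: topspace_skorokhod_topology)
      ultimately obtain d where d: "d > 0" "\<And>x. x \<in> cadlag_paths \<Longrightarrow> path_dist y x < d \<Longrightarrow> x \<in> ?U"
        using openin_skorokhod_path_ball by blast
      have "eventually (\<lambda>k. real k > (2 * C) / d) sequentially"
        using filterlim_real_sequentially by (simp add: filterlim_at_top_dense)
      then show "\<forall>\<^sub>F k in sequentially. dist (G k y) (f y) < r"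
      proof eventually_elim
        case (elim k)
        then have "2 * C \<le> real k * d" using d(1) by (simp add: field_simps)
        then have "f y - r/2 \<le> G k y"
          unfolding G_def using d b[OF y] r
          by (intro lipschitz_regularization_greater[OF low y d(1)]) (auto simp: less_imp_le)
        then show ?case using Gle[OF y, of k] r by (simp add: dist_real_def)
      qed
    qed
    have "(\<lambda>k. \<integral>\<omega>. G k (Y \<omega>) \<partial>N) \<longlonglongrightarrow> (\<integral>\<omega>. f (Y \<omega>) \<partial>N)"
      by (rule integral_dominated_convergence[where w = "\<lambda>_. C"])
        (use Y Gb lim measY[OF Glip] borel_measurable_skorokhod_continuous[OF mY f] in auto)
    then have "eventually (\<lambda>k. (\<integral>\<omega>. G k (Y \<omega>) \<partial>N) > (\<integral>\<omega>. f (Y \<omega>) \<partial>N) - e) sequentially"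
      using e by (intro order_tendstoD) auto
    then obtain k where k: "(\<integral>\<omega>. G k (Y \<omega>) \<partial>N) > (\<integral>\<omega>. f (Y \<omega>) \<partial>N) - e"
      by (auto simp: eventually_sequentially)
    have "eventually (\<lambda>n. (\<integral>\<omega>. G k (X n \<omega>) \<partial>M) > (\<integral>\<omega>. f (Y \<omega>) \<partial>N) - e) sequentially"
      using conv[OF Glip] k by (rule order_tendstoD)
    then show ?thesis
    proof eventually_elim
      case (elim n)
      have "(\<integral>\<omega>. G k (X n \<omega>) \<partial>M) \<le> (\<integral>\<omega>. f (X n \<omega>) \<partial>M)"
      proof (rule integral_mono)
        show "integrable M (\<lambda>\<omega>. G k (X n \<omega>))"
          by (rule M.integrable_const_bound[where B = C]) (use X Gb measX[OF Glip] in auto)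
        show "integrable M (\<lambda>\<omega>. f (X n \<omega>))"
          by (rule M.integrable_const_bound[where B = C])
            (use X b borel_measurable_skorokhod_continuous[OF mX f] in auto)
      qed (use Gle X in auto)
      then show ?case using elim by linarith
    qed
  qed
  have "(\<lambda>n. \<integral>\<omega>. f (X n \<omega>) \<partial>M) \<longlonglongrightarrow> (\<integral>\<omega>. f (Y \<omega>) \<partial>N)"
    if f: "continuous_map skorokhod_topology euclideanreal f"
      and b: "bounded (f ` topspace skorokhod_topology)" for f
  proof (rule tendstoI)
    fix e :: real assume e: "e > 0"
    obtain C where C: "\<And>x. x \<in> cadlag_paths \<Longrightarrow> \<bar>f x\<bar> \<le> C"
      using b by (auto simp: bounded_iff topspace_skorokhod_topology)
    have "continuous_map skorokhod_topology euclideanreal (\<lambda>x. - f x)"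
      using f by (rule continuous_map_minus)
    then have "eventually (\<lambda>n. (\<integral>\<omega>. - f (X n \<omega>) \<partial>M) > (\<integral>\<omega>. - f (Y \<omega>) \<partial>N) - e) sequentially"
      by (rule lower[OF _ _ e, of _ C]) (use C in auto)
    moreover have "eventually (\<lambda>n. (\<integral>\<omega>. f (X n \<omega>) \<partial>M) > (\<integral>\<omega>. f (Y \<omega>) \<partial>N) - e) sequentially"
      by (rule lower[OF f C e])
    ultimately show "\<forall>\<^sub>F n in sequentially. dist (\<integral>\<omega>. f (X n \<omega>) \<partial>M) (\<integral>\<omega>. f (Y \<omega>) \<partial>N) < e"
    proof eventually_elim
      case (elim n)
      then show ?case unfolding dist_real_def integral_minus abs_less_iff by linarith
    qed
  qed
  then show ?thesis using mX mY by (simp add: converges_in_distribution_def)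
qed

section \<open>Oscillation of paths\<close>

lemma path_lipschitz_cong:
  assumes "path_lipschitz K F" "\<And>t. t \<ge> 0 \<Longrightarrow> x t = y t"
  shows "F x = F y"
proof -
  have "path_dist x y \<le> 0" by (rule path_dist_least) (use assms(2) in auto)
  then have "path_dist x y = 0" using path_dist_nonneg[of x y] by linarith
  then show ?thesis using assms(1) unfolding path_lipschitz_def
    by (metis abs_le_zero_iff eq_iff_diff_eq_0 mult_zero_right)
qed

lemma Osc_diff_le:
  assumes t: "t \<ge> 0" and f: "bounded (f ` {0..t})" and g: "bounded (g ` {0..t})"
    and W: "\<And>s. 0 \<le> s \<Longrightarrow> s \<le> t \<Longrightarrow> \<bar>f s - g s\<bar> \<le> W"
  shows "\<bar>Osc t f - Osc t g\<bar> \<le> 2 * W"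
proof -
  have *: "(SUP s\<in>{0..t}. f s) \<le> (SUP s\<in>{0..t}. g s) + W \<and> (INF s\<in>{0..t}. g s) - W \<le> (INF s\<in>{0..t}. f s)"
    if g: "bounded (g ` {0..t})" and W: "\<And>s. 0 \<le> s \<Longrightarrow> s \<le> t \<Longrightarrow> \<bar>f s - g s\<bar> \<le> W" for f g
  proof
    show "(SUP s\<in>{0..t}. f s) \<le> (SUP s\<in>{0..t}. g s) + W"
    proof (rule cSUP_least)
      fix s assume s: "s \<in> {0..t}"
      then have "g s \<le> (SUP s\<in>{0..t}. g s)"
        by (intro cSUP_upper bounded_imp_bdd_above g)
      then show "f s \<le> (SUP s\<in>{0..t}. g s) + W" using W[of s] s by auto
    qed (use t in auto)
    show "(INF s\<in>{0..t}. g s) - W \<le> (INF s\<in>{0..t}. f s)"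
    proof (rule cINF_greatest)
      fix s assume s: "s \<in> {0..t}"
      then have "(INF s\<in>{0..t}. g s) \<le> g s"
        by (intro cINF_lower bounded_imp_bdd_below g)
      then show "(INF s\<in>{0..t}. g s) - W \<le> f s" using W[of s] s by auto
    qed (use t in auto)
  qed
  from *[OF g W] *[OF f, of g] W show ?thesis
    unfolding Osc_def by (smt (verit))
qed

text \<open>Stopping a path at time \<open>s\<close> turns the comparison of two times into a comparison of two paths over the
same interval, to which the Lipschitz estimate above applies.\<close>

lemma Osc_stopped:
  assumes "0 \<le> s" "s \<le> t"
  shows "Osc t (\<lambda>u. f (min u s)) = Osc s f"
proof -
  have "(\<lambda>u. f (min u s)) ` {0..t} = f ` {0..s}"
    using assms by (force simp: image_iff min_def)
  then show ?thesis unfolding Osc_def by simp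
qed

lemma bounded_image_interval:
  fixes f :: "real \<Rightarrow> real"
  assumes "continuous_on {0..} f" shows "bounded (f ` {0..t})"
proof -
  have "continuous_on {0..t} f" using assms by (rule continuous_on_subset) auto
  then show ?thesis by (intro compact_imp_bounded compact_continuous_image) auto
qed

lemma bounded_image_step:
  fixes v :: "nat \<Rightarrow> real"
  shows "bounded ((\<lambda>s. v (nat \<lfloor>real n * s\<rfloor>)) ` {0..t})"
proof (rule bounded_subset)
  show "bounded (v ` {..nat \<lfloor>real n * t\<rfloor>})" by (intro finite_imp_bounded) auto
  show "(\<lambda>s. v (nat \<lfloor>real n * s\<rfloor>)) ` {0..t} \<subseteq> v ` {..nat \<lfloor>real n * t\<rfloor>}"
    by (auto intro!: imageI nat_mono floor_mono mult_left_mono)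
qed

lemma continuous_on_Osc:
  assumes f: "continuous_on {0..} f"
  shows "continuous_on {0..} (\<lambda>t. Osc t f)"
  unfolding continuous_on_iff
proof (intro ballI allI impI)
  fix x e :: real assume x: "x \<in> {0..}" and e: "e > 0"
  from f x e obtain d where d: "d > 0" "\<And>y. y \<ge> 0 \<Longrightarrow> \<bar>y - x\<bar> < d \<Longrightarrow> \<bar>f y - f x\<bar> < e / 6"
    unfolding continuous_on_iff dist_real_def by (metis atLeast_iff divide_pos_pos zero_less_numeral)
  have *: "\<bar>Osc t f - Osc s f\<bar> \<le> 2 * (e / 3)" if st: "0 \<le> s" "s \<le> t" "\<bar>s - x\<bar> < d" "\<bar>t - x\<bar> < d" for s t
  proof -
    have "\<bar>Osc t f - Osc t (\<lambda>u. f (min u s))\<bar> \<le> 2 * (e / 3)"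
    proof (rule Osc_diff_le)
      show "bounded (f ` {0..t})" by (rule bounded_image_interval[OF f])
      show "bounded ((\<lambda>u. f (min u s)) ` {0..t})"
        by (rule bounded_subset[OF bounded_image_interval[OF f, of t]]) (use st in auto)
      fix u assume u: "0 \<le> u" "u \<le> t"
      show "\<bar>f u - f (min u s)\<bar> \<le> e / 3"
      proof (cases "u \<le> s")
        case True then show ?thesis using e by simp
      next
        case False
        then have "\<bar>f u - f x\<bar> < e / 6" "\<bar>f s - f x\<bar> < e / 6" "min u s = s"
          using d(2)[of u] d(2)[of s] u st False by auto
        then have "\<bar>f u - f s\<bar> \<le> e / 3" by linarith
        then show ?thesis using False by (simp add: min_def)
      qed
    qed (use st in auto)
    then show ?thesis using Osc_stopped[of s t f] st by simp
  qed
  have "\<bar>Osc y f - Osc x f\<bar> < e" if y: "y \<in> {0..}" "\<bar>y - x\<bar> < d" for y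
    using *[of x y] *[of y x] x y e d(1) by (cases "x \<le> y") (auto simp: abs_minus_commute)
  then show "\<exists>d>0. \<forall>x'\<in>{0..}. dist x' x < d \<longrightarrow> dist (Osc x' f) (Osc x f) < e"
    using d(1) by (auto simp: dist_real_def)
qed

lemma continuous_restrict_cadlag:
  assumes "continuous_on {0..} f" shows "(\<lambda>t\<in>{0..}. f t) \<in> cadlag_paths"
proof -
  have right: "((\<lambda>t\<in>{0..}. f t) \<longlongrightarrow> f t) (at_right t)" if "t \<ge> 0" for t
  proof -
    have "(f \<longlongrightarrow> f t) (at t within {0..})"
      using assms that by (simp add: continuous_on_def)
    then have "(f \<longlongrightarrow> f t) (at_right t)" by (rule tendsto_within_subset) (use that in auto)
    then show ?thesis
      by (rule Lim_transform_eventually) (use that in \<open>auto simp: eventually_at_filter\<close>)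
  qed
  have left: "((\<lambda>t\<in>{0..}. f t) \<longlongrightarrow> f t) (at_left t)" if "t > 0" for t
  proof -
    have "(f \<longlongrightarrow> f t) (at t within {0..})"
      using assms that by (simp add: continuous_on_def)
    then have "(f \<longlongrightarrow> f t) (at t)"
      using that at_within_interior[of t "{0..}"] by simp
    then have "(f \<longlongrightarrow> f t) (at_left t)"
      by (rule tendsto_mono[rotated]) (simp add: at_le)
    then show ?thesis
      by (rule Lim_transform_eventually)
        (intro eventually_mono[OF eventually_at_left_real[OF that]], auto)
  qed
  show ?thesis using right left by (force simp: cadlag_paths_def)
qed

text \<open>Just after \<open>t\<close> the integer part of \<open>n t\<close> does not change, and just before \<open>t\<close> it is the ceiling of \<open>n t\<close>
minus 1.\<close>

lemma step_function_cadlag: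
  fixes h :: "nat \<Rightarrow> real"
  shows "(\<lambda>t\<in>{0..}. h (nat \<lfloor>real n * t\<rfloor>)) \<in> cadlag_paths"
proof (cases "n = 0")
  case True
  then show ?thesis using continuous_restrict_cadlag[of "\<lambda>_. h 0"] by simp
next
  case False
  then have n: "real n > 0" by simp
  have right: "((\<lambda>t\<in>{0..}. h (nat \<lfloor>real n * t\<rfloor>)) \<longlongrightarrow> h (nat \<lfloor>real n * t\<rfloor>)) (at_right t)"
    if t: "t \<ge> 0" for t
  proof (rule tendsto_eventually)
    have "t < (\<lfloor>real n * t\<rfloor> + 1) / n" using n by (simp add: field_simps) linarith
    then have "eventually (\<lambda>s. s \<in> {t<..<(\<lfloor>real n * t\<rfloor> + 1) / n}) (at_right t)"
      by (rule eventually_at_right_real)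
    then show "\<forall>\<^sub>F s in at_right t. (\<lambda>t\<in>{0..}. h (nat \<lfloor>real n * t\<rfloor>)) s = h (nat \<lfloor>real n * t\<rfloor>)"
    proof eventually_elim
      case (elim s)
      then have "real n * t < real n * s" "real n * s < \<lfloor>real n * t\<rfloor> + 1"
        using n by (auto simp: field_simps)
      then have "\<lfloor>real n * s\<rfloor> = \<lfloor>real n * t\<rfloor>" by linarith
      then show ?case using elim t by simp
    qed
  qed
  have left: "\<exists>l. ((\<lambda>t\<in>{0..}. h (nat \<lfloor>real n * t\<rfloor>)) \<longlongrightarrow> l) (at_left t)" if t: "t > 0" for t
  proof (intro exI tendsto_eventually)
    have *: "max 0 ((\<lceil>real n * t\<rceil> - 1) / n) < t" using n t by (simp add: field_simps) linarith
    show "\<forall>\<^sub>F s in at_left t. (\<lambda>t\<in>{0..}. h (nat \<lfloor>real n * t\<rfloor>)) s = h (nat (\<lceil>real n * t\<rceil> - 1))"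
      using eventually_at_left_real[OF *]
    proof eventually_elim
      case (elim s)
      then have "real n * s < real n * t" "\<lceil>real n * t\<rceil> - 1 < real n * s"
        using n by (auto simp: field_simps)
      then have "\<lfloor>real n * s\<rfloor> = \<lceil>real n * t\<rceil> - 1" by linarith
      then show ?case using elim by simp
    qed
  qed
  show ?thesis using right left by (auto simp: cadlag_paths_def)
qed

section \<open>Functionals of finitely many coordinates\<close>

text \<open>One inequality expresses both the Lipschitz property and the dependence on the coordinates up to \<open>J\<close>
alone. Functionals of sequences avoid a change of type when a coordinate is integrated out.\<close>

definition prefix_lipschitz :: "nat \<Rightarrow> real \<Rightarrow> ((nat \<Rightarrow> real) \<Rightarrow> real) \<Rightarrow> bool" where
  "prefix_lipschitz J L g \<longleftrightarrow> (\<forall>x y. \<bar>g x - g y\<bar> \<le> L * (\<Sum>j\<le>J. \<bar>x j - y j\<bar>))"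

lemma prefix_lipschitz_cong:
  assumes "prefix_lipschitz J L g" "\<And>j. j \<le> J \<Longrightarrow> x j = y j"
  shows "g x = g y"
proof -
  have "\<bar>g x - g y\<bar> \<le> L * (\<Sum>j\<le>J. \<bar>x j - y j\<bar>)" using assms(1) by (simp add: prefix_lipschitz_def)
  also have "\<dots> = 0" using assms(2) by simp
  finally show ?thesis by simp
qed

lemma prefix_lipschitz_continuous:
  assumes "prefix_lipschitz J L g" shows "continuous_on UNIV g"
  unfolding continuous_on_def
proof
  fix x :: "nat \<Rightarrow> real"
  have c: "((\<lambda>y. y j) \<longlongrightarrow> x j) (at x)" for j :: nat
  proof -
    have "continuous_on UNIV (\<lambda>y::nat \<Rightarrow> real. y j)" by (rule continuous_on_product_coordinates)
    then show ?thesis by (simp add: continuous_on_def)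
  qed
  have "((\<lambda>y. L * (\<Sum>j\<le>J. \<bar>y j - x j\<bar>)) \<longlongrightarrow> L * (\<Sum>j\<le>J. \<bar>x j - x j\<bar>)) (at x)"
    by (intro tendsto_intros c)
  then have "((\<lambda>y. L * (\<Sum>j\<le>J. \<bar>y j - x j\<bar>)) \<longlongrightarrow> 0) (at x)" by simp
  then have "((\<lambda>y. g y - g x) \<longlongrightarrow> 0) (at x)"
    by (rule Lim_null_comparison[rotated]) (use assms in \<open>auto simp: prefix_lipschitz_def\<close>)
  then show "(g \<longlongrightarrow> g x) (at x within UNIV)" by (simp add: LIM_zero_iff)
qed

lemma prefix_lipschitz_borel: "prefix_lipschitz J L g \<Longrightarrow> g \<in> borel_measurable borel"
  by (intro borel_measurable_continuous_onI prefix_lipschitz_continuous)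

lemma prefix_lipschitz_measurable:
  assumes g: "prefix_lipschitz J L g" and V: "\<And>j. j \<le> J \<Longrightarrow> V j \<in> borel_measurable M"
  shows "(\<lambda>\<omega>. g (\<lambda>j. V j \<omega>)) \<in> borel_measurable M"
proof -
  define V' where "V' \<omega> = (\<lambda>j. if j \<le> J then V j \<omega> else 0)" for \<omega>
  have "V' \<in> measurable M borel"
  proof (rule measurable_coordinatewise_then_product)
    fix i show "(\<lambda>x. V' x i) \<in> borel_measurable M"
      using V by (cases "i \<le> J") (simp_all add: V'_def)
  qed
  then have "(\<lambda>\<omega>. g (V' \<omega>)) \<in> borel_measurable M"
    using prefix_lipschitz_borel[OF g] by (rule measurable_compose)
  also have "(\<lambda>\<omega>. g (V' \<omega>)) = (\<lambda>\<omega>. g (\<lambda>j. V j \<omega>))"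
    by (intro ext prefix_lipschitz_cong[OF g]) (simp add: V'_def)
  finally show ?thesis .
qed

text \<open>Truncation at \<open>J\<close> leaves finitely many values, and the uniform distance of two step paths is at
  most the sum of the differences of their values.\<close>

lemma path_lipschitz_step_Osc:
  fixes v w :: "nat \<Rightarrow> real"
  assumes F: "path_lipschitz K F"
  shows "prefix_lipschitz J (2 * K) (\<lambda>v. F (\<lambda>t. Osc t (\<lambda>s. v (min (nat \<lfloor>real n * s\<rfloor>) J)) + c))"
  unfolding prefix_lipschitz_def
proof (intro allI)
  fix v w :: "nat \<Rightarrow> real"
  let ?O = "\<lambda>v t. Osc t (\<lambda>s. v (min (nat \<lfloor>real n * s\<rfloor>) J)) + c"
  have "\<bar>F (?O v) - F (?O w)\<bar> \<le> K * path_dist (?O v) (?O w)"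
    using F by (simp add: path_lipschitz_def)
  also have "K * path_dist (?O v) (?O w) \<le> K * (2 * (\<Sum>j\<le>J. \<bar>v j - w j\<bar>))"
  proof (rule mult_left_mono[OF path_dist_least path_lipschitz_const_nonneg[OF F]])
    fix t :: real assume t: "t \<ge> 0"
    have "\<bar>Osc t (\<lambda>s. v (min (nat \<lfloor>real n * s\<rfloor>) J)) - Osc t (\<lambda>s. w (min (nat \<lfloor>real n * s\<rfloor>) J))\<bar>
        \<le> 2 * (\<Sum>j\<le>J. \<bar>v j - w j\<bar>)"
      using t by (intro Osc_diff_le bounded_image_step[of "\<lambda>k. v (min k J)"]
          bounded_image_step[of "\<lambda>k. w (min k J)"] member_le_sum) auto
    then show "min \<bar>?O v t - ?O w t\<bar> (1 / (1 + t)) \<le> 2 * (\<Sum>j\<le>J. \<bar>v j - w j\<bar>)" by linarith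
  qed
  finally show "\<bar>F (?O v) - F (?O w)\<bar> \<le> 2 * K * (\<Sum>j\<le>J. \<bar>v j - w j\<bar>)"
    by (simp only: mult.assoc mult.left_commute)
qed

lemma path_lipschitz_tendsto:
  assumes F: "path_lipschitz K F" and "(\<lambda>m. path_dist (Y m) y) \<longlonglongrightarrow> 0"
  shows "(\<lambda>m. F (Y m)) \<longlonglongrightarrow> F y"
proof -
  have "(\<lambda>m. K * path_dist (Y m) y) \<longlonglongrightarrow> 0" using tendsto_mult_left[OF assms(2), of K] by simp
  then have "(\<lambda>m. F (Y m) - F y) \<longlonglongrightarrow> 0"
    by (rule Lim_null_comparison[rotated]) (use F in \<open>auto simp: path_lipschitz_def\<close>)
  then show ?thesis by (simp add: LIM_zero_iff)
qed

text \<open>A step path has infinitely many jumps, but freezing it at a late time moves it little in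
\<^const>\<open>path_dist\<close> and leaves finitely many values.\<close>

lemma step_Osc_measurable:
  assumes F: "path_lipschitz K F" and V: "\<And>j. V j \<in> borel_measurable M"
  shows "(\<lambda>\<omega>. F (\<lambda>t. Osc t (\<lambda>s. V (nat \<lfloor>real n * s\<rfloor>) \<omega>) + c)) \<in> borel_measurable M"
proof (rule borel_measurable_LIMSEQ_real)
  let ?A = "\<lambda>T \<omega> t. Osc t (\<lambda>s. V (min (nat \<lfloor>real n * s\<rfloor>) (n * T)) \<omega>) + c"
  show "(\<lambda>\<omega>. F (?A T \<omega>)) \<in> borel_measurable M" for T
    by (rule prefix_lipschitz_measurable[OF path_lipschitz_step_Osc[OF F] V])
  fix \<omega>
  show "(\<lambda>T. F (?A T \<omega>)) \<longlonglongrightarrow> F (\<lambda>t. Osc t (\<lambda>s. V (nat \<lfloor>real n * s\<rfloor>) \<omega>) + c)"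
  proof (rule path_lipschitz_tendsto[OF F])
    have "path_dist (?A T \<omega>) (\<lambda>t. Osc t (\<lambda>s. V (nat \<lfloor>real n * s\<rfloor>) \<omega>) + c) \<le> max 0 (1 / (1 + real T))" for T
    proof (rule path_dist_le_horizon)
      fix t :: real assume t: "0 \<le> t" "t \<le> real T"
      have "nat \<lfloor>real n * s\<rfloor> \<le> n * T" if "s \<in> {0..t}" for s
      proof -
        have "real n * s \<le> real n * real T" using that t by (intro mult_left_mono) auto
        then show ?thesis by (simp add: nat_le_iff floor_le_iff)
      qed
      then have "Osc t (\<lambda>s. V (min (nat \<lfloor>real n * s\<rfloor>) (n * T)) \<omega>) = Osc t (\<lambda>s. V (nat \<lfloor>real n * s\<rfloor>) \<omega>)"
        unfolding Osc_def by (simp add: min_absorb1)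
      then show "\<bar>?A T \<omega> t - (Osc t (\<lambda>s. V (nat \<lfloor>real n * s\<rfloor>) \<omega>) + c)\<bar> \<le> 0" by simp
    qed simp
    then have le: "path_dist (?A T \<omega>) (\<lambda>t. Osc t (\<lambda>s. V (nat \<lfloor>real n * s\<rfloor>) \<omega>) + c) \<le> 1 / (1 + real T)" for T
      by (simp add: max_def)
    have lim: "(\<lambda>T. 1 / (1 + real T)) \<longlonglongrightarrow> 0" by real_asymp
    show "(\<lambda>T. path_dist (?A T \<omega>) (\<lambda>t. Osc t (\<lambda>s. V (nat \<lfloor>real n * s\<rfloor>) \<omega>) + c)) \<longlonglongrightarrow> 0"
      by (rule tendsto_sandwich[OF _ _ tendsto_const lim])
        (rule always_eventually, rule allI, rule path_dist_nonneg, rule always_eventually, rule allI, rule le)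
  qed
qed

text \<open>A continuous path is sampled with mesh \<open>1 / m\<^sup>2\<close> up to time \<open>m\<close>. The mesh is finer than the
  inverse of the horizon so that moment estimates of order \<open>mesh\<^sup>2\<close> can be summed over all
  cells.\<close>

definition sampled_osc :: "nat \<Rightarrow> (nat \<Rightarrow> real) \<Rightarrow> real \<Rightarrow> real" where
  "sampled_osc m v t = Osc t (\<lambda>s. v (min (nat \<lfloor>real (m ^ 2) * s\<rfloor>) (m ^ 3)))"

lemma sampled_osc_diff_le:
  assumes f: "\<And>t. bounded (f ` {0..t})" and T: "0 \<le> T" "T \<le> real m"
    and W: "\<And>s. 0 \<le> s \<Longrightarrow> s \<le> T \<Longrightarrow> \<bar>f s - v (nat \<lfloor>real (m ^ 2) * s\<rfloor>)\<bar> \<le> W"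
  shows "path_dist (\<lambda>t. Osc t f) (sampled_osc m v) \<le> max (2 * W) (1 / (1 + T))"
proof (rule path_dist_le_horizon)
  fix t :: real assume t: "0 \<le> t" "t \<le> T"
  show "\<bar>Osc t f - sampled_osc m v t\<bar> \<le> 2 * W"
    unfolding sampled_osc_def
  proof (rule Osc_diff_le)
    fix s assume s: "0 \<le> s" "s \<le> t"
    have "real (m ^ 2) * s \<le> real (m ^ 2) * real m" using s t T by (intro mult_left_mono) auto
    then have "real (m ^ 2) * s \<le> real (m ^ 3)" by (simp add: power2_eq_square power3_eq_cube)
    then have "nat \<lfloor>real (m ^ 2) * s\<rfloor> \<le> m ^ 3" by (simp add: nat_le_iff floor_le_iff)
    then show "\<bar>f s - v (min (nat \<lfloor>real (m ^ 2) * s\<rfloor>) (m ^ 3))\<bar> \<le> W"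
      using W[of s] s t by (simp add: min_absorb1)
  qed (use t f bounded_image_step[of "\<lambda>k. v (min k (m^3))" "m^2"] in auto)
qed (use T in auto)

text \<open>Uniform continuity on a fixed interval \<open>[0, T]\<close>; beyond \<open>T\<close> the metric is at most \<open>1 / (1 + T)\<close>.\<close>

lemma sampled_osc_tendsto:
  assumes f: "continuous_on {0..} f"
  shows "(\<lambda>m. path_dist (sampled_osc m (\<lambda>j. f (real j / real (m ^ 2)))) (\<lambda>t. Osc t f)) \<longlonglongrightarrow> 0"
proof (rule tendstoI)
  fix e :: real assume e: "e > 0"
  obtain T :: nat where T: "1 / (1 + real T) < e"
    using reals_Archimedean[OF e] by (auto simp: inverse_eq_divide add.commute)
  have "uniformly_continuous_on {0..real T} f"
    using f by (intro compact_uniformly_continuous continuous_on_subset[OF f]) auto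
  then obtain d where d: "d > 0" "\<And>x y. x \<in> {0..real T} \<Longrightarrow> y \<in> {0..real T} \<Longrightarrow> \<bar>y - x\<bar> < d \<Longrightarrow> \<bar>f y - f x\<bar> < e / 3"
    unfolding uniformly_continuous_on_def dist_real_def using e by (metis divide_pos_pos zero_less_numeral)
  have "eventually (\<lambda>m. 1 / real (m ^ 2) < d) sequentially"
    using d(1) by (intro order_tendstoD[of _ 0]) (real_asymp, simp)
  then show "\<forall>\<^sub>F m in sequentially. dist (path_dist (sampled_osc m (\<lambda>j. f (real j / real (m ^ 2)))) (\<lambda>t. Osc t f)) 0 < e"
    using eventually_ge_at_top[of "max T 1"]
  proof eventually_elim
    case (elim m)
    then have m: "real (m ^ 2) > 0" by simp
    have "path_dist (\<lambda>t. Osc t f) (sampled_osc m (\<lambda>j. f (real j / real (m ^ 2)))) \<le> max (2 * (e / 3)) (1 / (1 + real T))"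
    proof (rule sampled_osc_diff_le)
      fix s :: real assume s: "0 \<le> s" "s \<le> real T"
      let ?r = "real (nat \<lfloor>real (m ^ 2) * s\<rfloor>) / real (m ^ 2)"
      have "0 \<le> real (m ^ 2) * s" using s by simp
      then have eq: "real (nat \<lfloor>real (m ^ 2) * s\<rfloor>) = of_int \<lfloor>real (m ^ 2) * s\<rfloor>"
        by (simp only: of_nat_nat zero_le_floor)
      have "?r \<le> s" unfolding eq using m by (simp add: divide_le_eq mult.commute)
      moreover have "s < ?r + 1 / real (m ^ 2)"
        unfolding eq add_divide_distrib[symmetric] using m by (simp add: less_divide_eq mult.commute)
      moreover have "?r \<ge> 0" by simp
      ultimately show "\<bar>f s - f ?r\<bar> \<le> e / 3"
        using d(2)[of ?r s] s elim(1) by (auto simp: less_imp_le)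
    qed (use elim bounded_image_interval[OF f] in auto)
    also have "\<dots> < e" using T e by simp
    finally show ?case by (simp add: path_dist_commute path_dist_nonneg)
  qed
qed

lemma continuous_Osc_measurable:
  assumes F: "path_lipschitz K F" and Z: "\<And>t. t \<ge> 0 \<Longrightarrow> Z t \<in> borel_measurable M"
    and cont: "\<And>\<omega>. \<omega> \<in> space M \<Longrightarrow> continuous_on {0..} (\<lambda>t. Z t \<omega>)"
  shows "(\<lambda>\<omega>. F (\<lambda>t. Osc t (\<lambda>s. Z s \<omega>))) \<in> borel_measurable M"
proof (rule borel_measurable_LIMSEQ_real)
  let ?A = "\<lambda>m \<omega>. sampled_osc m (\<lambda>j. Z (real j / real (m ^ 2)) \<omega>)"
  show "(\<lambda>\<omega>. F (?A m \<omega>)) \<in> borel_measurable M" for m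
    using prefix_lipschitz_measurable[OF path_lipschitz_step_Osc[OF F, of "m^3" "m^2" 0], of "\<lambda>j. Z (real j / real (m ^ 2))" M] Z
    by (simp add: sampled_osc_def[abs_def])
  fix \<omega> assume \<omega>: "\<omega> \<in> space M"
  show "(\<lambda>m. F (?A m \<omega>)) \<longlonglongrightarrow> F (\<lambda>t. Osc t (\<lambda>s. Z s \<omega>))"
    by (rule path_lipschitz_tendsto[OF F sampled_osc_tendsto[OF cont[OF \<omega>]]])
qed

lemma nearest_neighbour_range:
  fixes f :: "nat \<Rightarrow> int"
  assumes "\<And>k. \<bar>f (Suc k) - f k\<bar> \<le> 1"
  shows "\<exists>a b. a \<le> b \<and> f ` {0..n} = {a..b}"
proof (induction n)
  case 0
  show ?case by (rule exI[of _ "f 0"], rule exI[of _ "f 0"]) auto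
next
  case (Suc n)
  then obtain a b where ab: "a \<le> b" "f ` {0..n} = {a..b}" by blast
  have fn: "f n \<in> {a..b}" using ab(2) by (metis atLeastAtMost_iff imageI le0 order_refl)
  have eq: "f ` {0..Suc n} = insert (f (Suc n)) {a..b}"
    using ab(2) by (simp add: atLeast0_atMost_Suc)
  consider "f (Suc n) \<in> {a..b}" | "f (Suc n) = b + 1" | "f (Suc n) = a - 1"
    using fn assms[of n] by fastforce
  then show ?case
  proof cases
    case 1 then show ?thesis using eq ab(1) by (metis insert_absorb)
  next
    case 2
    then have "f ` {0..Suc n} = {a..b+1}" using eq ab(1) by auto
    then show ?thesis using ab(1) by (metis le_add_same_cancel1 order_trans zero_le_one)
  next
    case 3
    then have "f ` {0..Suc n} = {a-1..b}" using eq ab(1) by auto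
    moreover have "a - 1 \<le> b" using ab(1) by simp
    ultimately show ?thesis by blast
  qed
qed

lemma image_nat_floor:
  assumes "t \<ge> 0"
  shows "(\<lambda>s. nat \<lfloor>real n * s\<rfloor>) ` {0..t} = {0..nat \<lfloor>real n * t\<rfloor>}"
proof
  show "(\<lambda>s. nat \<lfloor>real n * s\<rfloor>) ` {0..t} \<subseteq> {0..nat \<lfloor>real n * t\<rfloor>}"
    by (auto intro!: nat_mono floor_mono mult_left_mono)
  show "{0..nat \<lfloor>real n * t\<rfloor>} \<subseteq> (\<lambda>s. nat \<lfloor>real n * s\<rfloor>) ` {0..t}"
  proof
    fix k assume k: "k \<in> {0..nat \<lfloor>real n * t\<rfloor>}"
    show "k \<in> (\<lambda>s. nat \<lfloor>real n * s\<rfloor>) ` {0..t}"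
    proof (cases "n = 0")
      case True then show ?thesis using k assms by force
    next
      case False
      have "real k \<le> real n * t" using k assms by (simp add: le_nat_iff le_floor_iff)
      then have "real k / real n \<in> {0..t}" using False by (simp add: divide_le_eq mult.commute)
      moreover have "nat \<lfloor>real n * (real k / real n)\<rfloor> = k" using False by simp
      ultimately show ?thesis by (intro image_eqI[of _ _ "real k / real n"]) simp_all
    qed
  qed
qed

text \<open>A nearest neighbour walk visits every site between its minimum and its maximum, whence the
  additional 1. For \<open>b = 0\<close> both sides vanish by the convention on division by 0.\<close>

lemma card_range_eq_Osc:
  fixes f :: "nat \<Rightarrow> int"
  assumes f: "\<And>k. \<bar>f (Suc k) - f k\<bar> \<le> 1" and t: "t \<ge> 0" and b: "b \<ge> 0"
  shows "real (card (f ` {0..nat \<lfloor>real n * t\<rfloor>})) / b =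
    Osc t (\<lambda>s. real_of_int (f (nat \<lfloor>real n * s\<rfloor>)) / b) + 1 / b"
proof -
  obtain c d where cd: "c \<le> d" "f ` {0..nat \<lfloor>real n * t\<rfloor>} = {c..d}"
    using nearest_neighbour_range[of f] f by blast
  have im: "(\<lambda>s. real_of_int (f (nat \<lfloor>real n * s\<rfloor>)) / b) ` {0..t} = (\<lambda>z. real_of_int z / b) ` {c..d}"
    unfolding cd(2)[symmetric] image_nat_floor[OF t, symmetric] by (simp add: image_image)
  have "Sup ((\<lambda>z. real_of_int z / b) ` {c..d}) = d / b"
    by (rule cSup_eq_maximum) (use cd b in \<open>auto intro: divide_right_mono\<close>)
  moreover have "Inf ((\<lambda>z. real_of_int z / b) ` {c..d}) = c / b"
    by (rule cInf_eq_minimum) (use cd b in \<open>auto intro: divide_right_mono\<close>)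
  ultimately show ?thesis
    unfolding Osc_def im cd(2) using cd(1) by (simp add: add_divide_distrib diff_divide_distrib)
qed

section \<open>The Markov property of the walk\<close>

context elephant_random_walk
begin

definition \<alpha> :: real where "\<alpha> = 2 * p - 1"

lemma alpha_bounds: "- 1 \<le> \<alpha>" "\<alpha> < 1"
  using memory_parameter by (auto simp: \<alpha>_def)

abbreviation S :: "nat \<Rightarrow> 'a \<Rightarrow> real" where "S n \<omega> \<equiv> real_of_int (walk X n \<omega>)"

lemma S_0: "S 0 \<omega> = 0" by (simp add: walk_def)

lemma S_Suc: "S (Suc n) \<omega> = S n \<omega> + real_of_int (X (Suc n) \<omega>)" by (simp add: walk_def)

lemma X_range: "n \<ge> 1 \<Longrightarrow> \<omega> \<in> space M \<Longrightarrow> X n \<omega> \<in> {1, -1}"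
proof (induction n rule: less_induct)
  case (less n)
  show ?case
  proof (cases "n = 1")
    case True then show ?thesis using first_step_range less by auto
  next
    case False
    then have n: "n \<ge> 2" using less by simp
    have "u n \<omega> \<in> {1..n - 1}" by (rule memory_range[OF n less(3)])
    then have "X (u n \<omega>) \<omega> \<in> {1, -1}" using less.prems n by (intro less.IH) auto
    then show ?thesis using step[OF n less(3)] coin_range[OF n less(3)] by auto
  qed
qed

lemma abs_S_le: "\<omega> \<in> space M \<Longrightarrow> \<bar>S n \<omega>\<bar> \<le> real n"
proof (induction n)
  case (Suc n)
  then have "\<bar>real_of_int (X (Suc n) \<omega>)\<bar> = 1" using X_range[of "Suc n" \<omega>] by auto
  then show ?case using Suc by (simp add: S_Suc)
qed (simp add: S_0)

text \<open>The coins (with the first step in place of a coin) and the remembered times form one family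
  of independent variables.\<close>

definition innovation :: "nat + nat \<Rightarrow> 'a \<Rightarrow> int" where
  "innovation = case_sum (\<epsilon>(1 := X 1)) (\<lambda>n \<omega>. int (u n \<omega>))"

text \<open>Measurability with respect to a subfamily of the innovations, stated without sigma-algebras: all
innovations have finite range, so a function of finitely many of them is automatically measurable and
bounded.\<close>

definition determined_by :: "(nat + nat) set \<Rightarrow> ('a \<Rightarrow> 'c) \<Rightarrow> bool" where
  "determined_by A G \<longleftrightarrow> (\<forall>\<omega>\<in>space M. \<forall>\<omega>'\<in>space M.
     (\<forall>a\<in>A. innovation a \<omega> = innovation a \<omega>') \<longrightarrow> G \<omega> = G \<omega>')"

lemma innovation_indep: "indep_vars (\<lambda>_. count_space UNIV) innovation ({1..} <+> {2..})"
  using independent by (simp add: innovation_def)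

lemma innovation_measurable:
  "a \<in> {1..} <+> {2..} \<Longrightarrow> innovation a \<in> measurable M (count_space UNIV)"
  using innovation_indep by (auto simp: indep_vars_def)

lemma innovation_finite_range:
  assumes "a \<in> {1..} <+> {2..}"
  obtains R where "finite R" "\<And>\<omega>. \<omega> \<in> space M \<Longrightarrow> innovation a \<omega> \<in> R"
proof (cases a)
  case (Inl n)
  then have "n \<ge> 1" using assms by auto
  then have "innovation a \<omega> \<in> {1, -1}" if "\<omega> \<in> space M" for \<omega>
    using Inl that first_step_range[OF that] coin_range[of n \<omega>] by (cases "n = 1") (auto simp: innovation_def)
  then show ?thesis using that[of "{1, -1}"] by blast
next
  case (Inr n)
  then have "n \<ge> 2" using assms by auto
  then have "innovation a \<omega> \<in> int ` {1..n - 1}" if "\<omega> \<in> space M" for \<omega>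
    using Inr that memory_range[of n \<omega>] by (auto simp: innovation_def)
  then show ?thesis using that[of "int ` {1..n - 1}"] by blast
qed

lemma determined_by_factor:
  assumes "determined_by A G"
  obtains h where "\<And>\<omega>. \<omega> \<in> space M \<Longrightarrow> G \<omega> = h (restrict (\<lambda>a. innovation a \<omega>) A)"
proof
  define h where "h v = G (SOME \<omega>. \<omega> \<in> space M \<and> restrict (\<lambda>a. innovation a \<omega>) A = v)" for v
  fix \<omega> assume \<omega>: "\<omega> \<in> space M"
  let ?P = "\<lambda>\<omega>'. \<omega>' \<in> space M \<and> restrict (\<lambda>a. innovation a \<omega>') A = restrict (\<lambda>a. innovation a \<omega>) A"
  have "?P (SOME \<omega>'. ?P \<omega>')" by (rule someI[of ?P \<omega>]) (use \<omega> in simp)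
  then have "G (SOME \<omega>'. ?P \<omega>') = G \<omega>"
    using assms \<omega> unfolding determined_by_def by (metis (mono_tags, lifting) restrict_apply')
  then show "G \<omega> = h (restrict (\<lambda>a. innovation a \<omega>) A)" by (simp add: h_def)
qed

lemma restricted_innovation_measurable:
  assumes "A \<subseteq> {1..} <+> {2..}"
  shows "(\<lambda>\<omega>. restrict (\<lambda>a. innovation a \<omega>) A) \<in> measurable M (PiM A (\<lambda>_. count_space UNIV))"
  by (rule measurable_restrict) (use assms innovation_measurable in auto)

lemma determined_by_measurable:
  assumes A: "finite A" "A \<subseteq> {1..} <+> {2..}" and G: "determined_by A G"
  shows "G \<in> measurable M (count_space UNIV)"
proof -
  obtain h where h: "\<And>\<omega>. \<omega> \<in> space M \<Longrightarrow> G \<omega> = h (restrict (\<lambda>a. innovation a \<omega>) A)"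
    using determined_by_factor[OF G] by blast
  have "(\<lambda>\<omega>. restrict (\<lambda>a. innovation a \<omega>) A) \<in> measurable M (count_space (PiE A (\<lambda>_. UNIV)))"
    using restricted_innovation_measurable[OF A(2)]
      count_space_PiM_finite[OF A(1), of "\<lambda>_. UNIV :: int set"] by simp
  then have "(\<lambda>\<omega>. h (restrict (\<lambda>a. innovation a \<omega>) A)) \<in> measurable M (count_space UNIV)"
    by (rule measurable_compose) simp
  then show ?thesis using h by (simp cong: measurable_cong)
qed

lemma determined_by_finite_range:
  assumes A: "finite A" "A \<subseteq> {1..} <+> {2..}" and G: "determined_by A G"
  shows "finite (G ` space M)"
proof -
  obtain h where h: "\<And>\<omega>. \<omega> \<in> space M \<Longrightarrow> G \<omega> = h (restrict (\<lambda>a. innovation a \<omega>) A)"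
    using determined_by_factor[OF G] by blast
  have "\<forall>a\<in>A. \<exists>R. finite R \<and> (\<forall>\<omega>\<in>space M. innovation a \<omega> \<in> R)"
  proof
    fix a assume "a \<in> A"
    then obtain R where "finite R" "\<And>\<omega>. \<omega> \<in> space M \<Longrightarrow> innovation a \<omega> \<in> R"
      using innovation_finite_range[of a] A(2) by blast
    then show "\<exists>R. finite R \<and> (\<forall>\<omega>\<in>space M. innovation a \<omega> \<in> R)" by blast
  qed
  then obtain R where R: "\<And>a. a \<in> A \<Longrightarrow> finite (R a)" "\<And>a \<omega>. a \<in> A \<Longrightarrow> \<omega> \<in> space M \<Longrightarrow> innovation a \<omega> \<in> R a"
    by metis
  have "G ` space M \<subseteq> h ` (PiE A R)" using h R by auto
  moreover have "finite (PiE A R)" using A(1) R(1) by (rule finite_PiE)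
  ultimately show ?thesis by (meson finite_imageI finite_subset)
qed

lemma determined_by_integrable:
  fixes G :: "'a \<Rightarrow> real"
  assumes A: "finite A" "A \<subseteq> {1..} <+> {2..}" and G: "determined_by A G"
  shows "integrable M G"
proof -
  have "G \<in> borel_measurable M"
    using measurable_compose[OF determined_by_measurable[OF assms], of "\<lambda>x. x" borel] by simp
  moreover obtain B where "\<And>\<omega>. \<omega> \<in> space M \<Longrightarrow> norm (G \<omega>) \<le> B"
    using finite_imp_bounded[OF determined_by_finite_range[OF assms]] by (auto simp: bounded_iff)
  ultimately show ?thesis by (intro integrable_const_bound[where B = B]) auto
qed

lemma expectation_innovation:
  fixes G :: "'a \<Rightarrow> real"
  assumes A: "finite A" "A \<subseteq> {1..} <+> {2..}" and G: "determined_by A G"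
    and b: "b \<in> {1..} <+> {2..}" "b \<notin> A"
  shows "expectation (\<lambda>\<omega>. G \<omega> * of_bool (innovation b \<omega> = c)) =
    expectation G * prob {\<omega> \<in> space M. innovation b \<omega> = c}"
proof -
  obtain h where h: "\<And>\<omega>. \<omega> \<in> space M \<Longrightarrow> G \<omega> = h (restrict (\<lambda>a. innovation a \<omega>) A)"
    using determined_by_factor[OF G] by blast
  let ?PA = "\<lambda>A. PiM A (\<lambda>_::nat+nat. count_space (UNIV :: int set))"
  let ?g = "\<lambda>v. of_bool (v b = c) :: real"
  have iv: "indep_var (?PA A) (\<lambda>\<omega>. restrict (\<lambda>a. innovation a \<omega>) A)
     (?PA {b}) (\<lambda>\<omega>. restrict (\<lambda>a. innovation a \<omega>) {b})"
    by (rule indep_var_restrict[OF innovation_indep]) (use A b in auto)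
  have PA: "?PA A = count_space (PiE A (\<lambda>_. UNIV))" if "finite A" for A
    using count_space_PiM_finite[OF that, of "\<lambda>_. UNIV :: int set"] by simp
  have "indep_var borel (h \<circ> (\<lambda>\<omega>. restrict (\<lambda>a. innovation a \<omega>) A))
     borel (?g \<circ> (\<lambda>\<omega>. restrict (\<lambda>a. innovation a \<omega>) {b}))"
    by (rule indep_var_compose[OF iv]) (simp_all add: PA A)
  then have iv2: "indep_var borel (\<lambda>\<omega>. h (restrict (\<lambda>a. innovation a \<omega>) A))
     borel (\<lambda>\<omega>. of_bool (innovation b \<omega> = c))"
    by (simp add: comp_def)
  have int1: "integrable M (\<lambda>\<omega>. h (restrict (\<lambda>a. innovation a \<omega>) A))"
    using determined_by_integrable[OF A G] h by (simp cong: Bochner_Integration.integrable_cong)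
  have db: "determined_by {b} (\<lambda>\<omega>. of_bool (innovation b \<omega> = c) :: real)" by (auto simp: determined_by_def)
  have int2: "integrable M (\<lambda>\<omega>. of_bool (innovation b \<omega> = c) :: real)"
    by (rule determined_by_integrable[OF _ _ db]) (use b in auto)
  have "expectation (\<lambda>\<omega>. G \<omega> * of_bool (innovation b \<omega> = c)) =
     expectation (\<lambda>\<omega>. h (restrict (\<lambda>a. innovation a \<omega>) A) * of_bool (innovation b \<omega> = c))"
    by (rule Bochner_Integration.integral_cong) (auto simp: h)
  also have "\<dots> = expectation (\<lambda>\<omega>. h (restrict (\<lambda>a. innovation a \<omega>) A)) * expectation (\<lambda>\<omega>. of_bool (innovation b \<omega> = c))"
    by (rule indep_var_lebesgue_integral[OF iv2 int1 int2])
  also have "expectation (\<lambda>\<omega>. h (restrict (\<lambda>a. innovation a \<omega>) A)) = expectation G"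
    by (rule Bochner_Integration.integral_cong) (auto simp: h)
  also have "expectation (\<lambda>\<omega>. of_bool (innovation b \<omega> = c)) = prob {\<omega> \<in> space M. innovation b \<omega> = c}"
  proof -
    have "expectation (\<lambda>\<omega>. of_bool (innovation b \<omega> = c) :: real) =
      expectation (indicator {\<omega> \<in> space M. innovation b \<omega> = c})"
      by (rule Bochner_Integration.integral_cong) (auto simp: indicator_def)
    moreover have "{\<omega> \<in> space M. innovation b \<omega> = c} \<inter> space M = {\<omega> \<in> space M. innovation b \<omega> = c}" by auto
    ultimately show ?thesis by simp
  qed
  finally show ?thesis .
qed

text \<open>Being a function of the first \<open>j\<close> increments. The function itself never has to be named, and closure
under compositions is pure logic.\<close>

definition determined :: "nat \<Rightarrow> ('a \<Rightarrow> 'c) \<Rightarrow> bool" where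
  "determined j G \<longleftrightarrow> (\<forall>\<omega>\<in>space M. \<forall>\<omega>'\<in>space M.
     (\<forall>i\<in>{1..j}. X i \<omega> = X i \<omega>') \<longrightarrow> G \<omega> = G \<omega>')"

lemma determined_const [intro, simp]: "determined j (\<lambda>_. c)" by (simp add: determined_def)

lemma determined_comp: "determined j f \<Longrightarrow> determined j (\<lambda>\<omega>. h (f \<omega>))"
  unfolding determined_def by metis

lemma determined_comp2: "determined j f \<Longrightarrow> determined j g \<Longrightarrow> determined j (\<lambda>\<omega>. h (f \<omega>) (g \<omega>))"
  unfolding determined_def by metis

lemma determined_fun: "(\<And>i. determined j (\<lambda>\<omega>. f \<omega> i)) \<Longrightarrow> determined j f"
  unfolding determined_def by (meson ext)

lemma determined_mono: "determined i f \<Longrightarrow> i \<le> j \<Longrightarrow> determined j f"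
  unfolding determined_def by (meson atLeastAtMost_iff le_trans)

lemma determined_walk: "i \<le> j \<Longrightarrow> determined j (walk X i)"
  unfolding determined_def walk_def by (auto intro!: sum.cong)

lemma determined_S: "i \<le> j \<Longrightarrow> determined j (S i)"
  using determined_comp[OF determined_walk] .

text \<open>Unfolding the recursion: each increment is a product of coins along the chain of remembered times.\<close>

lemma determined_by_X:
  "1 \<le> i \<Longrightarrow> i \<le> j \<Longrightarrow> determined_by ({1..j} <+> {2..j}) (X i)"
proof (induction i rule: less_induct)
  case (less i)
  show ?case
  proof (cases "i = 1")
    case True
    have "X 1 \<omega> = X 1 \<omega>'" if "\<forall>a\<in>{1..j} <+> {2..j}. innovation a \<omega> = innovation a \<omega>'" for \<omega> \<omega>'
      using bspec[OF that, of "Inl 1"] less by (simp add: innovation_def InlI)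
    then show ?thesis using True unfolding determined_by_def by blast
  next
    case False
    then have i: "i \<ge> 2" using less by simp
    have "X i \<omega> = X i \<omega>'" if \<omega>: "\<omega> \<in> space M" "\<omega>' \<in> space M"
      and eq: "\<forall>a\<in>{1..j} <+> {2..j}. innovation a \<omega> = innovation a \<omega>'" for \<omega> \<omega>'
    proof -
      have "\<epsilon> i \<omega> = \<epsilon> i \<omega>'" using bspec[OF eq, of "Inl i"] less i by (simp add: innovation_def InlI)
      moreover have "u i \<omega> = u i \<omega>'" using bspec[OF eq, of "Inr i"] less i by (simp add: innovation_def InrI)
      moreover have "u i \<omega> \<in> {1..i - 1}" by (rule memory_range[OF i \<omega>(1)])
      moreover have "X (u i \<omega>) \<omega> = X (u i \<omega>) \<omega>'"
      proof -
        have "determined_by ({1..j} <+> {2..j}) (X (u i \<omega>))"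
          using calculation(3) less.prems i by (intro less.IH) auto
        then show ?thesis using \<omega> eq unfolding determined_by_def by blast
      qed
      ultimately show ?thesis using step[OF i] \<omega> by simp
    qed
    then show ?thesis unfolding determined_by_def by blast
  qed
qed

lemma determined_imp_determined_by:
  assumes "determined j G" shows "determined_by ({1..j} <+> {2..j}) G"
  unfolding determined_by_def
proof (intro ballI impI)
  fix \<omega> \<omega>' assume *: "\<omega> \<in> space M" "\<omega>' \<in> space M"
    "\<forall>a\<in>{1..j} <+> {2..j}. innovation a \<omega> = innovation a \<omega>'"
  have "X i \<omega> = X i \<omega>'" if "i \<in> {1..j}" for i
    using determined_by_X[of i j] that * unfolding determined_by_def by (meson atLeastAtMost_iff)
  then show "G \<omega> = G \<omega>'" using assms * unfolding determined_def by blast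
qed

lemma innovation_index_subset: "finite ({1..j::nat} <+> {2..j::nat})" "{1..j} <+> {2..j} \<subseteq> {1..} <+> {2..}"
  by auto

lemma determined_integrable: "determined j G \<Longrightarrow> integrable M (G :: 'a \<Rightarrow> real)"
  by (rule determined_by_integrable[OF innovation_index_subset determined_imp_determined_by])

lemma S_measurable [measurable]: "S j \<in> borel_measurable M"
  using determined_integrable[OF determined_S[of j j]] by simp

text \<open>The past, the new coin and the new remembered time are independent; the coin and the time are split
off one after the other.\<close>

lemma expectation_new_step:
  assumes j: "j \<ge> 1" and G: "determined j G" and k: "k \<in> {1..j}" and e: "e = 1 \<or> e = -1"
  shows "expectation (\<lambda>\<omega>. G \<omega> * of_bool (\<epsilon> (Suc j) \<omega> = e) * of_bool (u (Suc j) \<omega> = k)) =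
    expectation G * (if e = 1 then p else 1 - p) / real j"
proof -
  let ?A = "{1..j} <+> {2..j}"
  let ?B = "insert (Inl (Suc j)) ?A"
  have GA: "determined_by ?A G" by (rule determined_imp_determined_by[OF G])
  have GB: "determined_by ?B (\<lambda>\<omega>. G \<omega> * of_bool (innovation (Inl (Suc j)) \<omega> = e))"
    using GA unfolding determined_by_def by (metis insert_iff)
  have eq: "innovation (Inl (Suc j)) = \<epsilon> (Suc j)" "innovation (Inr (Suc j)) = (\<lambda>\<omega>. int (u (Suc j) \<omega>))"
    using j by (auto simp: innovation_def)
  have "expectation (\<lambda>\<omega>. (G \<omega> * of_bool (innovation (Inl (Suc j)) \<omega> = e)) * of_bool (innovation (Inr (Suc j)) \<omega> = int k)) =
    expectation (\<lambda>\<omega>. G \<omega> * of_bool (innovation (Inl (Suc j)) \<omega> = e)) * prob {\<omega> \<in> space M. innovation (Inr (Suc j)) \<omega> = int k}"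
    using j by (intro expectation_innovation[OF _ _ GB]) auto
  also have "prob {\<omega> \<in> space M. innovation (Inr (Suc j)) \<omega> = int k} = 1 / real j"
    using memory_uniform[of "Suc j" k] j k by (simp add: eq)
  also have "expectation (\<lambda>\<omega>. G \<omega> * of_bool (innovation (Inl (Suc j)) \<omega> = e)) =
      expectation G * prob {\<omega> \<in> space M. innovation (Inl (Suc j)) \<omega> = e}"
    using j by (intro expectation_innovation[OF _ _ GA]) auto
  also have "prob {\<omega> \<in> space M. innovation (Inl (Suc j)) \<omega> = e} = (if e = 1 then p else 1 - p)"
  proof -
    have 1: "prob {\<omega> \<in> space M. \<epsilon> (Suc j) \<omega> = 1} = p" using j by (intro coin_bias) simp
    have [measurable]: "\<epsilon> (Suc j) \<in> measurable M (count_space UNIV)"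
      using innovation_measurable[of "Inl (Suc j)"] by (simp add: eq InlI)
    have "{\<omega> \<in> space M. \<epsilon> (Suc j) \<omega> = -1} = space M - {\<omega> \<in> space M. \<epsilon> (Suc j) \<omega> = 1}"
      using coin_range[of "Suc j"] j by force
    then have "prob {\<omega> \<in> space M. \<epsilon> (Suc j) \<omega> = -1} = 1 - p"
      using prob_compl[of "{\<omega> \<in> space M. \<epsilon> (Suc j) \<omega> = 1}"] 1 by simp
    then show ?thesis using 1 e by (auto simp: eq)
  qed
  finally show ?thesis by (simp add: eq mult.assoc)
qed

text \<open>The Markov property of the walk: given the first \<open>j\<close> increments, the next one is \<open>1\<close> with
  probability \<open>(1 + \<alpha> S j / j) / 2\<close>, because the frequency of each sign among the remembered
  increments is a function of the position. For \<open>j = 0\<close> the formula holds with \<open>0 / 0 = 0\<close>.\<close>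

lemma expectation_step:
  fixes F :: "'a \<Rightarrow> int \<Rightarrow> real"
  assumes F: "\<And>e. determined j (\<lambda>\<omega>. F \<omega> e)"
  shows "expectation (\<lambda>\<omega>. F \<omega> (X (Suc j) \<omega>)) =
    expectation (\<lambda>\<omega>. (F \<omega> 1 + F \<omega> (-1)) / 2 + \<alpha> * (S j \<omega> / real j) * ((F \<omega> 1 - F \<omega> (-1)) / 2))"
proof (cases "j = 0")
  case True
  obtain \<omega>0 where \<omega>0: "\<omega>0 \<in> space M" using not_empty by (meson all_not_in_conv)
  have const: "F \<omega> e = F \<omega>0 e" if "\<omega> \<in> space M" for \<omega> e
  proof -
    have "\<forall>i\<in>{1..j}. X i \<omega> = X i \<omega>0" using True by simp
    then show ?thesis using F[of e] that \<omega>0 unfolding determined_def by blast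
  qed
  have m: "X 1 \<in> measurable M (count_space UNIV)"
    using innovation_measurable[of "Inl 1"] by (simp add: innovation_def InlI)
  then have meas: "{\<omega> \<in> space M. X 1 \<omega> = 1} \<in> events" by measurable
  have "expectation (\<lambda>\<omega>. F \<omega> (X (Suc j) \<omega>)) =
     expectation (\<lambda>\<omega>. F \<omega>0 (-1) + (F \<omega>0 1 - F \<omega>0 (-1)) * indicator {\<omega> \<in> space M. X 1 \<omega> = 1} \<omega>)"
  proof (rule Bochner_Integration.integral_cong)
    fix \<omega> assume \<omega>: "\<omega> \<in> space M"
    then show "F \<omega> (X (Suc j) \<omega>) = F \<omega>0 (-1) + (F \<omega>0 1 - F \<omega>0 (-1)) * indicator {\<omega> \<in> space M. X 1 \<omega> = 1} \<omega>"
      using first_step_range[OF \<omega>] True const[OF \<omega>] by (auto simp: indicator_def)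
  qed simp
  also have "\<dots> = F \<omega>0 (-1) + (F \<omega>0 1 - F \<omega>0 (-1)) * prob {\<omega> \<in> space M. X 1 \<omega> = 1}"
    using meas by (subst Bochner_Integration.integral_add) (auto simp: prob_space emeasure_eq_measure)
  also have "\<dots> = (F \<omega>0 1 + F \<omega>0 (-1)) / 2" unfolding first_step_uniform by (simp add: field_simps)
  also have "\<dots> = expectation (\<lambda>\<omega>. (F \<omega>0 1 + F \<omega>0 (-1)) / 2)" by (simp add: prob_space)
  also have "\<dots> = expectation (\<lambda>\<omega>. (F \<omega> 1 + F \<omega> (-1)) / 2 + \<alpha> * (S j \<omega> / real j) * ((F \<omega> 1 - F \<omega> (-1)) / 2))"
    by (rule Bochner_Integration.integral_cong) (use True const in \<open>auto simp: S_0\<close>)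
  finally show ?thesis .
next
  case False
  then have j: "j \<ge> 1" by simp
  define G where "G e k \<omega> = F \<omega> (e * X k \<omega>)" for e k \<omega>
  have GF: "determined j (G e k)" if "k \<in> {1..j}" for e k
    using F that unfolding determined_def G_def by (metis (mono_tags, lifting))
  have intG: "integrable M (G e k)" if "k \<in> {1..j}" for e k by (rule determined_integrable[OF GF[OF that]])
  have mm: "\<epsilon> (Suc j) \<in> measurable M (count_space UNIV)" "(\<lambda>\<omega>. int (u (Suc j) \<omega>)) \<in> measurable M (count_space UNIV)"
    using innovation_measurable[of "Inl (Suc j)"] innovation_measurable[of "Inr (Suc j)"] j
    by (auto simp: innovation_def InrI InlI)
  then have mm': "u (Suc j) \<in> measurable M (count_space UNIV)"
    using measurable_compose[OF mm(2), of nat] by simp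
  have intI: "integrable M (\<lambda>\<omega>. G e k \<omega> * of_bool (\<epsilon> (Suc j) \<omega> = e) * of_bool (u (Suc j) \<omega> = k))"
    if "k \<in> {1..j}" for e k
    using mm(1) mm' borel_measurable_integrable[OF intG[OF that]]
    by (intro Bochner_Integration.integrable_bound[OF intG[OF that, of e]]) auto
  have "expectation (\<lambda>\<omega>. F \<omega> (X (Suc j) \<omega>)) = expectation (\<lambda>\<omega>. \<Sum>k\<in>{1..j}. \<Sum>e\<in>{1,-1}.
      G e k \<omega> * of_bool (\<epsilon> (Suc j) \<omega> = e) * of_bool (u (Suc j) \<omega> = k))"
  proof (rule Bochner_Integration.integral_cong)
    fix \<omega> assume \<omega>: "\<omega> \<in> space M"
    have s: "X (Suc j) \<omega> = \<epsilon> (Suc j) \<omega> * X (u (Suc j) \<omega>) \<omega>"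
      using step[of "Suc j"] j \<omega> by simp
    have u: "u (Suc j) \<omega> \<in> {1..j}" using memory_range[of "Suc j" \<omega>] j \<omega> by simp
    have e: "\<epsilon> (Suc j) \<omega> \<in> {1, -1}" using coin_range[of "Suc j" \<omega>] j \<omega> by simp
    have "(\<Sum>k\<in>{1..j}. \<Sum>e\<in>{1,-1}. G e k \<omega> * of_bool (\<epsilon> (Suc j) \<omega> = e) * of_bool (u (Suc j) \<omega> = k))
      = (\<Sum>k\<in>{1..j}. if k = u (Suc j) \<omega> then G (\<epsilon> (Suc j) \<omega>) k \<omega> else 0)"
      using e by (intro sum.cong) auto
    also have "\<dots> = G (\<epsilon> (Suc j) \<omega>) (u (Suc j) \<omega>) \<omega>" using u by simp
    finally show "F \<omega> (X (Suc j) \<omega>) = (\<Sum>k\<in>{1..j}. \<Sum>e\<in>{1,-1}.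
      G e k \<omega> * of_bool (\<epsilon> (Suc j) \<omega> = e) * of_bool (u (Suc j) \<omega> = k))"
      by (simp add: G_def s)
  qed simp
  also have "\<dots> = (\<Sum>k\<in>{1..j}. expectation (\<lambda>\<omega>. \<Sum>e\<in>{1,-1}.
      G e k \<omega> * of_bool (\<epsilon> (Suc j) \<omega> = e) * of_bool (u (Suc j) \<omega> = k)))"
    by (intro Bochner_Integration.integral_sum Bochner_Integration.integrable_sum intI)
  also have "\<dots> = (\<Sum>k\<in>{1..j}. \<Sum>e\<in>{1,-1}. expectation (\<lambda>\<omega>.
      G e k \<omega> * of_bool (\<epsilon> (Suc j) \<omega> = e) * of_bool (u (Suc j) \<omega> = k)))"
    by (intro sum.cong refl Bochner_Integration.integral_sum intI)
  also have "\<dots> = (\<Sum>k\<in>{1..j}. \<Sum>e\<in>{1,-1}. expectation (G e k) * (if e = 1 then p else 1 - p) / real j)"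
    using j GF by (intro sum.cong refl expectation_new_step) auto
  also have "\<dots> = (\<Sum>k\<in>{1..j}. (p * expectation (G 1 k) + (1 - p) * expectation (G (-1) k)) / real j)"
    by (intro sum.cong) (auto simp: algebra_simps add_divide_distrib diff_divide_distrib)
  also have "\<dots> = expectation (\<lambda>\<omega>. \<Sum>k\<in>{1..j}. (p * G 1 k \<omega> + (1 - p) * G (-1) k \<omega>) / real j)"
    using intG by (simp add: Bochner_Integration.integral_sum)
  also have "\<dots> = expectation (\<lambda>\<omega>. (F \<omega> 1 + F \<omega> (-1)) / 2 + \<alpha> * (S j \<omega> / real j) * ((F \<omega> 1 - F \<omega> (-1)) / 2))"
  proof (rule Bochner_Integration.integral_cong)
    fix \<omega> assume \<omega>: "\<omega> \<in> space M"
    define a b where "a = (F \<omega> 1 + F \<omega> (-1)) / 2" and "b = (F \<omega> 1 - F \<omega> (-1)) / 2"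
    have *: "p * G 1 k \<omega> + (1 - p) * G (-1) k \<omega> = a + \<alpha> * real_of_int (X k \<omega>) * b" if "k \<in> {1..j}" for k
      using X_range[of k \<omega>] \<omega> that by (auto simp: G_def \<alpha>_def a_def b_def field_simps)
    have "(\<Sum>k\<in>{1..j}. (p * G 1 k \<omega> + (1 - p) * G (-1) k \<omega>) / real j) =
      (\<Sum>k\<in>{1..j}. a / real j + \<alpha> * b / real j * real_of_int (X k \<omega>))"
      by (intro sum.cong refl) (simp add: * add_divide_distrib)
    also have "\<dots> = a + \<alpha> * b / real j * S j \<omega>"
      using j by (simp add: sum.distrib walk_def sum_distrib_left sum_divide_distrib)
    finally show "(\<Sum>k\<in>{1..j}. (p * G 1 k \<omega> + (1 - p) * G (-1) k \<omega>) / real j) =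
        (F \<omega> 1 + F \<omega> (-1)) / 2 + \<alpha> * (S j \<omega> / real j) * ((F \<omega> 1 - F \<omega> (-1)) / 2)"
      by (simp add: a_def[symmetric] b_def[symmetric])
  qed simp
  finally show ?thesis .
qed

end

section \<open>Moments of the walk\<close>

text \<open>Young's inequality with exponents \<open>4 / 3\<close> and 4, as a sum of squares.\<close>

lemma young_cubic: "4 * (a::real) ^ 3 * t \<le> 3 * a ^ 4 + t ^ 4"
proof -
  have "3 * a ^ 4 + t ^ 4 - 4 * a ^ 3 * t = (a - t)\<^sup>2 * ((a + t)\<^sup>2 + 2 * a\<^sup>2)"
    by (simp add: power2_eq_square power3_eq_cube power4_eq_xxxx algebra_simps)
  moreover have "\<dots> \<ge> 0" by (intro mult_nonneg_nonneg add_nonneg_nonneg) auto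
  ultimately show ?thesis by linarith
qed

text \<open>The coefficient of \<open>b^4\<close> matters: doubling an interval produces \<open>1 + 2 = 3\<close> times the bound for one half,
which is less than the factor \<open>2\<^sup>2 = 4\<close> available for a quadratic bound.\<close>

lemma fourth_power_sum_le: "(a + b) ^ 4 \<le> 2 * (b::real) ^ 4 + 125 * a ^ 4"
proof -
  have sq: "(x + y)\<^sup>2 \<le> 5/4 * x\<^sup>2 + 5 * y\<^sup>2" for x y :: real
    using zero_le_power2[of "x / 2 - 2 * y"] by (simp add: power2_eq_square algebra_simps)
  have "(a + b) ^ 4 = ((b + a)\<^sup>2)\<^sup>2" by (simp add: add.commute)
  also have "\<dots> \<le> (5/4 * b\<^sup>2 + 5 * a\<^sup>2)\<^sup>2" by (rule power_mono[OF sq]) simp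
  also have "\<dots> \<le> 5/4 * (5/4 * b\<^sup>2)\<^sup>2 + 5 * (5 * a\<^sup>2)\<^sup>2" by (rule sq)
  also have "\<dots> = 125/64 * b ^ 4 + 125 * a ^ 4"
    by (simp add: power_mult_distrib power2_eq_square power4_eq_xxxx)
  also have "\<dots> \<le> 2 * b ^ 4 + 125 * a ^ 4" by simp
  finally show ?thesis .
qed

text \<open>The left-hand side is the conditional expectation of the fourth power of an increment \<open>D\<close> of length \<open>m\<close>
after one more step with drift \<open>b\<close>. The terms in \<open>D\<^sup>3\<close> and \<open>D\<^sup>2\<close> are split by Young's inequality with
weight \<open>4 * m\<close> so that \<open>D^4\<close> grows by the factor \<open>1 + 3 / (2 * m)\<close> only, while a quadratic bound
\<open>K * m\<^sup>2\<close> has room for \<open>1 + 2 / m\<close>.\<close>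

lemma increment_drift_le:
  fixes D b :: real
  assumes m: "m \<ge> 1" "\<bar>D\<bar> \<le> m" "\<bar>b\<bar> \<le> 1"
  shows "D ^ 4 + 6 * D\<^sup>2 + 1 + b * (4 * D ^ 3 + 4 * D) \<le> D ^ 4 * (1 + 3 / (2 * m)) + 17 * m + 64 * m ^ 3 * b ^ 4"
proof -
  have "4 * D ^ 3 * (4 * m * b) \<le> 3 * D ^ 4 + (4 * m * b) ^ 4" by (rule young_cubic)
  then have "(4 * D ^ 3 * (4 * m * b)) / (4 * m) \<le> (3 * D ^ 4 + (4 * m * b) ^ 4) / (4 * m)"
    using m by (intro divide_right_mono) auto
  also have "(4 * D ^ 3 * (4 * m * b)) / (4 * m) = b * (4 * D ^ 3)" using m by (simp add: field_simps)
  also have "(3 * D ^ 4 + (4 * m * b) ^ 4) / (4 * m) = 3 / (4 * m) * D ^ 4 + 64 * m ^ 3 * b ^ 4"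
    using m by (simp add: field_simps power_mult_distrib eval_nat_numeral)
  finally have 1: "b * (4 * D ^ 3) \<le> 3 / (4 * m) * D ^ 4 + 64 * m ^ 3 * b ^ 4" .
  have "0 \<le> (D\<^sup>2 - 4 * m)\<^sup>2 * 3 / (4 * m)" using m by simp
  also have "\<dots> = 3 / (4 * m) * D ^ 4 - 6 * D\<^sup>2 + 12 * m"
    using m by (simp add: field_simps power2_eq_square eval_nat_numeral)
  finally have 2: "6 * D\<^sup>2 \<le> 3 / (4 * m) * D ^ 4 + 12 * m" by simp
  have "\<bar>b * D\<bar> \<le> 1 * m" unfolding abs_mult using m by (intro mult_mono) auto
  then have 3: "b * (4 * D) \<le> 4 * m" by linarith
  have "3 / (4 * m) * D ^ 4 + 3 / (4 * m) * D ^ 4 = D ^ 4 * (3 / (2 * m))" using m by (simp add: field_simps)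
  then show ?thesis using 1 2 3 m(1) by (simp add: distrib_left)
qed

text \<open>Both sides compare with \<open>exp (\<gamma> / n)\<close>. Iterated, this bounds products of factors \<open>1 + \<gamma> / n\<close>.\<close>

lemma powr_growth:
  assumes "\<gamma> \<ge> 0" "n \<ge> 2"
  shows "(1 + \<gamma> / real n) * (real n - 1) powr \<gamma> \<le> real n powr \<gamma>"
proof -
  have "1 + \<gamma> / real n \<le> exp (\<gamma> / real n)" by (rule exp_ge_add_one_self)
  moreover have "(1 - 1 / real n) powr \<gamma> \<le> exp (- (1 / real n)) powr \<gamma>"
    using exp_ge_add_one_self[of "- (1 / real n)"] assms by (intro powr_mono2) (auto simp: field_simps)
  ultimately have "(1 + \<gamma> / real n) * (1 - 1 / real n) powr \<gamma> \<le> exp (\<gamma> / real n) * exp (- (1 / real n)) powr \<gamma>"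
    using assms by (intro mult_mono) auto
  also have "\<dots> = 1" by (simp add: powr_def mult_exp_exp)
  finally have "(1 + \<gamma> / real n) * (1 - 1 / real n) powr \<gamma> * real n powr \<gamma> \<le> 1 * real n powr \<gamma>"
    by (intro mult_right_mono) auto
  also have "(1 + \<gamma> / real n) * (1 - 1 / real n) powr \<gamma> * real n powr \<gamma> = (1 + \<gamma> / real n) * ((1 - 1 / real n) * real n) powr \<gamma>"
    using assms by (simp add: powr_mult)
  also have "(1 - 1 / real n) * real n = real n - 1" using assms by (simp add: field_simps)
  finally show ?thesis by simp
qed

context elephant_random_walk
begin

lemma integrable_S [simp]:
  "integrable M (\<lambda>\<omega>. h (S i \<omega>) (S j \<omega>) :: real)"
  by (rule determined_integrable[OF determined_comp2[of "max i j"]]) (auto intro: determined_S)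

lemma integrable_S1 [simp]: "integrable M (\<lambda>\<omega>. h (S i \<omega>) :: real)"
  using integrable_S[of "\<lambda>x y. h x" i i] .

definition m2 :: "nat \<Rightarrow> real" where "m2 n = expectation (\<lambda>\<omega>. S n \<omega> ^ 2)"
definition m4 :: "nat \<Rightarrow> real" where "m4 n = expectation (\<lambda>\<omega>. S n \<omega> ^ 4)"

lemma m2_nonneg: "m2 n \<ge> 0" and m4_nonneg: "m4 n \<ge> 0"
  by (simp_all add: m2_def m4_def)

lemma m2_0: "m2 0 = 0" and m4_0: "m4 0 = 0" by (simp_all add: m2_def m4_def S_0)

text \<open>The Markov property, for functions of the present position and one past position.\<close>

lemma expectation_next:
  fixes h :: "real \<Rightarrow> real \<Rightarrow> real"
  assumes "i \<le> n"
  shows "expectation (\<lambda>\<omega>. h (S i \<omega>) (S (Suc n) \<omega>)) = expectation (\<lambda>\<omega>.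
    (h (S i \<omega>) (S n \<omega> + 1) + h (S i \<omega>) (S n \<omega> - 1)) / 2
    + \<alpha> * (S n \<omega> / real n) * ((h (S i \<omega>) (S n \<omega> + 1) - h (S i \<omega>) (S n \<omega> - 1)) / 2))"
proof -
  have "determined n (\<lambda>\<omega>. h (S i \<omega>) (S n \<omega> + real_of_int e))" for e
    using determined_comp2[of n "S i" "S n" "\<lambda>x y. h x (y + real_of_int e)"] assms
    by (simp add: determined_S)
  from expectation_step[of n "\<lambda>\<omega> e. h (S i \<omega>) (S n \<omega> + real_of_int e)", OF this]
  show ?thesis by (simp add: S_Suc)
qed

lemma m2_Suc: "m2 (Suc n) = m2 n * (1 + 2 * \<alpha> / real n) + 1"
proof -
  have "m2 (Suc n) = expectation (\<lambda>\<omega>. (1 + 2 * \<alpha> / real n) * S n \<omega> ^ 2 + 1)"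
    unfolding m2_def expectation_next[OF order_refl, of "\<lambda>_ y. y ^ 2" n]
    by (intro Bochner_Integration.integral_cong refl) (simp add: power2_eq_square field_simps)
  also have "\<dots> = m2 n * (1 + 2 * \<alpha> / real n) + 1"
    using integrable_S1[of "\<lambda>x. x ^ 2" n] by (simp add: m2_def prob_space)
  finally show ?thesis .
qed

lemma m4_Suc: "m4 (Suc n) = m4 n * (1 + 4 * \<alpha> / real n) + m2 n * (6 + 4 * \<alpha> / real n) + 1"
proof -
  have alg: "((s + 1) ^ 4 + (s - 1) ^ 4) / 2 + a * (s / r) * (((s + 1) ^ 4 - (s - 1) ^ 4) / 2)
     = (1 + 4 * a / r) * s ^ 4 + ((6 + 4 * a / r) * s ^ 2 + 1)" for s a r :: real
  proof -
    have "((s + 1) ^ 4 + (s - 1) ^ 4) / 2 = s ^ 4 + 6 * s ^ 2 + 1"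
      and "((s + 1) ^ 4 - (s - 1) ^ 4) / 2 = 4 * s ^ 3 + 4 * s"
      by (simp_all add: power2_eq_square power3_eq_cube power4_eq_xxxx algebra_simps)
    then show ?thesis by (simp only:) (simp add: power2_eq_square power3_eq_cube power4_eq_xxxx algebra_simps add_divide_distrib)
  qed
  have "m4 (Suc n) = expectation (\<lambda>\<omega>. (1 + 4 * \<alpha> / real n) * S n \<omega> ^ 4 + ((6 + 4 * \<alpha> / real n) * S n \<omega> ^ 2 + 1))"
    unfolding m4_def expectation_next[OF order_refl, of "\<lambda>_ y. y ^ 4" n]
    by (intro Bochner_Integration.integral_cong refl) (simp only: alg)
  also have "\<dots> = m4 n * (1 + 4 * \<alpha> / real n) + m2 n * (6 + 4 * \<alpha> / real n) + 1"
    using integrable_S1[of "\<lambda>x. x ^ 2" n] integrable_S1[of "\<lambda>x. x ^ 4" n]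
    by (simp add: m2_def m4_def prob_space)
  finally show ?thesis .
qed

text \<open>Induction on the length of the increment. The drift at time \<open>n = i + m\<close> is \<open>\<alpha> * S n / n\<close>, whose fourth
moment is at most \<open>R / n\<^sup>2 \<le> R / m\<^sup>2\<close> by hypothesis.\<close>

lemma fourth_moment_increment:
  assumes R: "R \<ge> 1" "\<And>j. j \<le> N \<Longrightarrow> m4 j \<le> R * real j ^ 2" and ij: "i + m \<le> N"
  shows "expectation (\<lambda>\<omega>. (S (i + m) \<omega> - S i \<omega>) ^ 4) \<le> 162 * R * real m ^ 2"
  using ij
proof (induction m)
  case 0 then show ?case by simp
next
  case (Suc m)
  define n where "n = i + m"
  have alg: "((d + 1) ^ 4 + (d - 1) ^ 4) / 2 + a * (s / r) * (((d + 1) ^ 4 - (d - 1) ^ 4) / 2)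
     = d ^ 4 + 6 * d\<^sup>2 + 1 + a * (s / r) * (4 * d ^ 3 + 4 * d)" for d s a r :: real
  proof -
    have "((d + 1) ^ 4 + (d - 1) ^ 4) / 2 = d ^ 4 + 6 * d ^ 2 + 1"
      and "((d + 1) ^ 4 - (d - 1) ^ 4) / 2 = 4 * d ^ 3 + 4 * d"
      by (simp_all add: power2_eq_square power3_eq_cube power4_eq_xxxx algebra_simps)
    then show ?thesis by (simp only:)
  qed
  have "expectation (\<lambda>\<omega>. (S (i + Suc m) \<omega> - S i \<omega>) ^ 4) =
    expectation (\<lambda>\<omega>. (\<lambda>x y. (y - x) ^ 4) (S i \<omega>) (S (Suc n) \<omega>))" by (simp add: n_def)
  also have "\<dots> = expectation (\<lambda>\<omega>. (S n \<omega> - S i \<omega>) ^ 4 + 6 * (S n \<omega> - S i \<omega>)\<^sup>2 + 1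
      + \<alpha> * (S n \<omega> / real n) * (4 * (S n \<omega> - S i \<omega>) ^ 3 + 4 * (S n \<omega> - S i \<omega>)))"
  proof -
    have i: "i \<le> n" by (simp add: n_def)
    show ?thesis
      unfolding expectation_next[OF i, of "\<lambda>x y. (y - x) ^ 4"]
    proof (intro Bochner_Integration.integral_cong refl)
      fix \<omega>
      have "S n \<omega> + 1 - S i \<omega> = (S n \<omega> - S i \<omega>) + 1" "S n \<omega> - 1 - S i \<omega> = (S n \<omega> - S i \<omega>) - 1"
        by simp_all
      then show "((S n \<omega> + 1 - S i \<omega>) ^ 4 + (S n \<omega> - 1 - S i \<omega>) ^ 4) / 2 +
          \<alpha> * (S n \<omega> / real n) * (((S n \<omega> + 1 - S i \<omega>) ^ 4 - (S n \<omega> - 1 - S i \<omega>) ^ 4) / 2) =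
          (S n \<omega> - S i \<omega>) ^ 4 + 6 * (S n \<omega> - S i \<omega>)\<^sup>2 + 1
          + \<alpha> * (S n \<omega> / real n) * (4 * (S n \<omega> - S i \<omega>) ^ 3 + 4 * (S n \<omega> - S i \<omega>))"
        by (simp only: alg)
    qed
  qed
  also have "\<dots> \<le> 162 * R * real (Suc m) ^ 2"
  proof (cases "m = 0")
    case True
    then show ?thesis using R(1) by (simp add: n_def prob_space)
  next
    case False
    have \<alpha>1: "\<bar>\<alpha>\<bar> \<le> 1" using alpha_bounds by auto
    have n0: "real n > 0" using False by (simp add: n_def)
    have le: "(S n \<omega> - S i \<omega>) ^ 4 + 6 * (S n \<omega> - S i \<omega>)\<^sup>2 + 1
      + \<alpha> * (S n \<omega> / real n) * (4 * (S n \<omega> - S i \<omega>) ^ 3 + 4 * (S n \<omega> - S i \<omega>))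
      \<le> (S n \<omega> - S i \<omega>) ^ 4 * (1 + 3 / (2 * real m)) + 17 * real m + 64 / real m * (S n \<omega>) ^ 4 * (real m / real n) ^ 4"
      if \<omega>: "\<omega> \<in> space M" for \<omega>
    proof -
      have Sn: "\<bar>S n \<omega> / real n\<bar> \<le> 1" using abs_S_le[OF \<omega>, of n] False by (simp add: n_def divide_le_eq)
      have D: "\<bar>S (i + k) \<omega> - S i \<omega>\<bar> \<le> real k" for k
      proof (induction k)
        case (Suc k)
        have "\<bar>real_of_int (X (Suc (i + k)) \<omega>)\<bar> = 1" using X_range[of "Suc (i + k)" \<omega>] \<omega> by auto
        then show ?case using Suc by (simp add: S_Suc)
      qed simp
      have b: "\<bar>\<alpha> * (S n \<omega> / real n)\<bar> \<le> \<bar>S n \<omega> / real n\<bar>"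
        unfolding abs_mult using \<alpha>1 by (intro mult_left_le_one_le) auto
      have "64 * real m ^ 3 * (\<alpha> * (S n \<omega> / real n)) ^ 4 \<le> 64 * real m ^ 3 * (S n \<omega> / real n) ^ 4"
        by (intro mult_left_mono power_mono_even b) auto
      also have "\<dots> = 64 / real m * (S n \<omega>) ^ 4 * (real m / real n) ^ 4"
        using False by (simp add: power_divide field_simps eval_nat_numeral)
      finally have last: "64 * real m ^ 3 * (\<alpha> * (S n \<omega> / real n)) ^ 4 \<le> 64 / real m * (S n \<omega>) ^ 4 * (real m / real n) ^ 4" .
      have "1 \<le> real m" using False by simp
      moreover have "\<bar>S n \<omega> - S i \<omega>\<bar> \<le> real m" using D[of m] by (simp add: n_def)
      moreover have "\<bar>\<alpha> * (S n \<omega> / real n)\<bar> \<le> 1" using b Sn by linarith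
      ultimately show ?thesis
        using increment_drift_le[of "real m" "S n \<omega> - S i \<omega>" "\<alpha> * (S n \<omega> / real n)"] last
        by linarith
    qed
    have int1: "integrable M (\<lambda>\<omega>. (S n \<omega> - S i \<omega>) ^ 4 + 6 * (S n \<omega> - S i \<omega>)\<^sup>2 + 1
      + \<alpha> * (S n \<omega> / real n) * (4 * (S n \<omega> - S i \<omega>) ^ 3 + 4 * (S n \<omega> - S i \<omega>)))"
      by (rule integrable_S)
    have int2: "integrable M (\<lambda>\<omega>. (S n \<omega> - S i \<omega>) ^ 4 * (1 + 3 / (2 * real m)) + 17 * real m + 64 / real m * (S n \<omega>) ^ 4 * (real m / real n) ^ 4)"
      by (rule integrable_S)
    have int3: "integrable M (\<lambda>\<omega>. (S n \<omega> - S i \<omega>) ^ 4)" by (rule integrable_S)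
    have "expectation (\<lambda>\<omega>. (S n \<omega> - S i \<omega>) ^ 4 + 6 * (S n \<omega> - S i \<omega>)\<^sup>2 + 1
      + \<alpha> * (S n \<omega> / real n) * (4 * (S n \<omega> - S i \<omega>) ^ 3 + 4 * (S n \<omega> - S i \<omega>)))
      \<le> expectation (\<lambda>\<omega>. (S n \<omega> - S i \<omega>) ^ 4 * (1 + 3 / (2 * real m)) + 17 * real m + 64 / real m * (S n \<omega>) ^ 4 * (real m / real n) ^ 4)"
      by (rule integral_mono[OF int1 int2 le])
    also have "\<dots> = expectation (\<lambda>\<omega>. (S n \<omega> - S i \<omega>) ^ 4) * (1 + 3 / (2 * real m)) + 17 * real m + 64 / real m * m4 n * (real m / real n) ^ 4"
      using int3 integrable_S1[of "\<lambda>x. x ^ 4" n] by (simp add: m4_def prob_space)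
    also have "\<dots> \<le> 162 * R * real m ^ 2 * (1 + 3 / (2 * real m)) + 17 * R * real m + 64 * R * real m"
    proof (intro add_mono)
      show "expectation (\<lambda>\<omega>. (S n \<omega> - S i \<omega>) ^ 4) * (1 + 3 / (2 * real m)) \<le> 162 * R * real m ^ 2 * (1 + 3 / (2 * real m))"
        using Suc by (intro mult_right_mono) (auto simp: n_def)
      show "17 * real m \<le> 17 * R * real m"
        using mult_right_mono[OF R(1), of "real m"] by simp
      have "64 / real m * m4 n * (real m / real n) ^ 4 \<le> 64 / real m * (R * real n ^ 2) * (real m / real n) ^ 4"
        using R(2)[of n] Suc.prems by (intro mult_right_mono mult_left_mono) (auto simp: n_def)
      also have "\<dots> = 64 * R * real m * (real m / real n) ^ 2"
        using False n0 by (simp add: field_simps eval_nat_numeral)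
      also have "\<dots> \<le> 64 * R * real m * 1"
        using R(1) by (intro mult_left_mono power_le_one) (auto simp: n_def divide_le_eq)
      finally show "64 / real m * m4 n * (real m / real n) ^ 4 \<le> 64 * R * real m" by simp
    qed
    also have "\<dots> = 162 * R * (real m ^ 2 + 2 * real m)"
      using False by (simp add: field_simps power2_eq_square)
    also have "\<dots> \<le> 162 * R * real (Suc m) ^ 2"
      using R(1) by (intro mult_left_mono) (auto simp: power2_eq_square algebra_simps)
    finally show ?thesis .
  qed
  finally show ?case .
qed

definition max4 :: "nat \<Rightarrow> nat \<Rightarrow> 'a \<Rightarrow> real" where
  "max4 i L \<omega> = Max ((\<lambda>k. (S (i + k) \<omega> - S i \<omega>) ^ 4) ` {..L})"

lemma max4_upper: "k \<le> L \<Longrightarrow> (S (i + k) \<omega> - S i \<omega>) ^ 4 \<le> max4 i L \<omega>"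
  unfolding max4_def by (intro Max_ge) auto

lemma max4_integrable: "integrable M (max4 i L)"
proof (rule determined_integrable)
  show "determined (i + L) (max4 i L)"
    unfolding determined_def
  proof (intro ballI impI)
    fix \<omega> \<omega>' assume *: "\<omega> \<in> space M" "\<omega>' \<in> space M" "\<forall>k\<in>{1..i + L}. X k \<omega> = X k \<omega>'"
    have "S k \<omega> = S k \<omega>'" if "k \<le> i + L" for k
      using determined_S[OF that] * unfolding determined_def by blast
    then show "max4 i L \<omega> = max4 i L \<omega>'"
      unfolding max4_def by (intro arg_cong[where f = Max] image_cong) auto
  qed
qed

text \<open>A maximal inequality by doubling: a bound of order (length)\<open>\<^sup>2\<close> for the fourth moments of all
  increments passes to the maximum, since the exponent 2 exceeds 1.\<close>

lemma maximal_inequality: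
  assumes "\<And>a m. i \<le> a \<Longrightarrow> a + m \<le> i + 2 ^ l \<Longrightarrow> expectation (\<lambda>\<omega>. (S (a + m) \<omega> - S a \<omega>) ^ 4) \<le> \<Lambda> * real m ^ 2"
  shows "expectation (max4 i (2 ^ l)) \<le> 125 * \<Lambda> * 4 ^ l"
  using assms
proof (induction l arbitrary: i)
  case 0
  have 1: "expectation (\<lambda>\<omega>. (S (i + 1) \<omega> - S i \<omega>) ^ 4) \<le> \<Lambda>" using 0[of i 1] by simp
  have eq: "max4 i (2 ^ 0) = (\<lambda>\<omega>. (S (i + 1) \<omega> - S i \<omega>) ^ 4)"
    unfolding max4_def by (simp add: atMost_Suc fun_eq_iff)
  have "0 \<le> expectation (\<lambda>\<omega>. (S (i + 1) \<omega> - S i \<omega>) ^ 4)" by simp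
  then show ?case unfolding eq by (simp only: power_0) (use 1 in linarith)
next
  case (Suc l)
  let ?L = "2 ^ l :: nat"
  let ?D = "\<lambda>\<omega>. (S (i + ?L) \<omega> - S i \<omega>) ^ 4"
  have le: "max4 i (2 ^ Suc l) \<omega> \<le> max4 i ?L \<omega> + (2 * max4 (i + ?L) ?L \<omega> + 125 * ?D \<omega>)" for \<omega>
    unfolding max4_def[of i "2 ^ Suc l"]
  proof (subst Max_le_iff; (intro ballI)?)
    have nn: "0 \<le> max4 j K \<omega>" for j K using max4_upper[of 0 K j \<omega>] by simp
    fix x assume "x \<in> (\<lambda>k. (S (i + k) \<omega> - S i \<omega>) ^ 4) ` {..2 ^ Suc l}"
    then obtain k where k: "k \<le> 2 * ?L" "x = (S (i + k) \<omega> - S i \<omega>) ^ 4" by auto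
    show "x \<le> max4 i ?L \<omega> + (2 * max4 (i + ?L) ?L \<omega> + 125 * ?D \<omega>)"
    proof (cases "k \<le> ?L")
      case True
      then have "x \<le> max4 i ?L \<omega>" using k max4_upper by simp
      moreover have "0 \<le> ?D \<omega>" by simp
      ultimately show ?thesis using nn[of "i + ?L" ?L] by linarith
    next
      case False
      then obtain k' where k': "k = ?L + k'" "k' \<le> ?L" using k(1) by (metis add_le_cancel_left le_Suc_ex less_imp_le linorder_not_less mult_2)
      have "x \<le> 2 * (S (i + ?L + k') \<omega> - S (i + ?L) \<omega>) ^ 4 + 125 * ?D \<omega>"
        using fourth_power_sum_le[of "S (i + ?L) \<omega> - S i \<omega>" "S (i + ?L + k') \<omega> - S (i + ?L) \<omega>"]
        by (simp add: k(2) k'(1) add.assoc)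
      also have "\<dots> \<le> 2 * max4 (i + ?L) ?L \<omega> + 125 * ?D \<omega>"
        using max4_upper[OF k'(2), of "i + ?L" \<omega>] by simp
      finally show ?thesis using nn[of i ?L] by simp
    qed
  qed auto
  have int: "integrable M ?D" by (rule integrable_S)
  have "expectation (max4 i (2 ^ Suc l)) \<le> expectation (\<lambda>\<omega>. max4 i ?L \<omega> + (2 * max4 (i + ?L) ?L \<omega> + 125 * ?D \<omega>))"
    using max4_integrable int le by (intro integral_mono) auto
  also have "\<dots> = expectation (max4 i ?L) + (2 * expectation (max4 (i + ?L) ?L) + 125 * expectation ?D)"
    using max4_integrable int by simp
  also have "\<dots> \<le> 125 * \<Lambda> * 4 ^ l + (2 * (125 * \<Lambda> * 4 ^ l) + 125 * (\<Lambda> * real ?L ^ 2))"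
  proof (intro add_mono mult_left_mono)
    show "expectation (max4 i ?L) \<le> 125 * \<Lambda> * 4 ^ l"
      by (rule Suc.IH, rule Suc.prems) auto
    show "expectation (max4 (i + ?L) ?L) \<le> 125 * \<Lambda> * 4 ^ l"
      by (rule Suc.IH, rule Suc.prems) auto
    show "expectation ?D \<le> \<Lambda> * real ?L ^ 2" using Suc.prems[of i ?L] by simp
  qed simp_all
  also have "real ?L ^ 2 = 4 ^ l" by (simp add: power2_eq_square flip: power_mult_distrib)
  also have "125 * \<Lambda> * 4 ^ l + (2 * (125 * \<Lambda> * 4 ^ l) + 125 * (\<Lambda> * 4 ^ l)) = 125 * \<Lambda> * 4 ^ Suc l"
    by simp
  finally show ?case .
qed

end

section \<open>Gaussian averages\<close>

definition gauss :: "real measure" where "gauss = density lborel (\<lambda>x. ennreal (std_normal_density x))"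

lemma prob_space_gauss: "prob_space gauss"
  unfolding gauss_def using prob_space_normal_density[of 1 0] by simp

interpretation gauss: prob_space gauss by (rule prob_space_gauss)

lemma space_gauss [simp]: "space gauss = UNIV" and sets_gauss [simp, measurable_cong]: "sets gauss = sets borel"
  by (simp_all add: gauss_def)

lemma integral_gauss:
  "f \<in> borel_measurable borel \<Longrightarrow> (\<integral>y. f y \<partial>gauss) = (\<integral>y. std_normal_density y * f y \<partial>lborel :: real)"
  unfolding gauss_def by (subst integral_real_density) auto

lemma integrable_gauss_iff:
  "f \<in> borel_measurable borel \<Longrightarrow> integrable gauss f \<longleftrightarrow> integrable lborel (\<lambda>y. std_normal_density y * f y :: real)"
  unfolding gauss_def by (subst integrable_real_density) auto

lemma integrable_gauss_power [simp]: "integrable gauss (\<lambda>y. y ^ k)"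
  by (simp add: integrable_gauss_iff integrable_std_normal_moment)

lemma integrable_gauss_abs_power [simp]: "integrable gauss (\<lambda>y. \<bar>y\<bar> ^ k)"
  by (simp add: integrable_gauss_iff integrable_std_normal_moment_abs)

lemma integrable_gauss_id [simp]: "integrable gauss (\<lambda>y. y)" "integrable gauss (\<lambda>y. \<bar>y\<bar>)"
  using integrable_gauss_power[of 1] integrable_gauss_abs_power[of 1] by simp_all

lemma gauss_moments: "(\<integral>y. y \<partial>gauss) = 0" "(\<integral>y. y\<^sup>2 \<partial>gauss) = 1"
  using integral_std_normal_moment_odd[of 0] integral_std_normal_moment_even[of 1]
  by (simp_all add: integral_gauss)

definition gauss_abs3 :: real where "gauss_abs3 = (\<integral>y. \<bar>y\<bar> ^ 3 \<partial>gauss)"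

text \<open>Every centred normal variable is referred to the one measure \<^const>\<open>gauss\<close>, so that a vanishing standard
deviation becomes a harmless special case.\<close>

lemma (in prob_space) expectation_normal:
  fixes g :: "real \<Rightarrow> real"
  assumes X: "distributed M lborel X (normal_density 0 \<sigma>)" and \<sigma>: "\<sigma> > 0" and g: "g \<in> borel_measurable borel"
  shows "expectation (\<lambda>\<omega>. g (X \<omega>)) = (\<integral>y. g (\<sigma> * y) \<partial>gauss)"
proof -
  have "distributed M lborel (\<lambda>\<omega>. X \<omega> / \<sigma>) std_normal_density"
    using normal_standard_normal_convert[OF \<sigma>, of X 0] X by simp
  then have "(\<integral>x. std_normal_density x * g (\<sigma> * x) \<partial>lborel) = (\<integral>\<omega>. g (\<sigma> * (X \<omega> / \<sigma>)) \<partial>M)"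
    using g by (intro distributed_integral) auto
  then show ?thesis using g \<sigma> by (simp add: integral_gauss)
qed

text \<open>The semigroup property of Gaussian averages: sums of independent normal variables are normal.\<close>

lemma gauss_add:
  fixes f :: "real \<Rightarrow> real"
  assumes f: "f \<in> borel_measurable borel" and b: "\<And>x. \<bar>f x\<bar> \<le> K" and st: "s \<ge> 0" "t \<ge> 0"
  shows "(\<integral>y. (\<integral>z. f (s * y + t * z) \<partial>gauss) \<partial>gauss) = (\<integral>y. f (sqrt (s\<^sup>2 + t\<^sup>2) * y) \<partial>gauss)"
proof -
  consider "s = 0" | "t = 0" | "s > 0" "t > 0" using st by fastforce
  then show ?thesis
  proof cases
    case 1 then show ?thesis using st gauss.prob_space by simp
  next
    case 2 then show ?thesis using st gauss.prob_space by simp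
  next
    case 3
    interpret P: pair_prob_space gauss gauss ..
    let ?P = "gauss \<Otimes>\<^sub>M gauss"
    have fst: "distr ?P borel fst = gauss"
    proof -
      have "distr ?P gauss fst = gauss" by (rule gauss.distr_pair_fst)
      then show ?thesis by (metis distr_cong sets_gauss)
    qed
    have snd: "distr ?P borel snd = gauss"
    proof (rule measure_eqI)
      fix A assume A: "A \<in> sets (distr ?P borel snd)"
      then have A': "A \<in> sets gauss" by simp
      have "emeasure (distr ?P borel snd) A = emeasure ?P (snd -` A \<inter> space ?P)"
        using A by (intro emeasure_distr) auto
      also have "snd -` A \<inter> space ?P = UNIV \<times> A" by (auto simp: space_pair_measure)
      also have "emeasure ?P (UNIV \<times> A) = emeasure gauss UNIV * emeasure gauss A"
        using A' by (intro gauss.emeasure_pair_measure_Times) auto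
      also have "emeasure gauss UNIV = 1" using gauss.emeasure_space_1 by simp
      finally show "emeasure (distr ?P borel snd) A = emeasure gauss A" by simp
    qed simp
    have ind0: "P.indep_var borel fst borel snd"
      unfolding P.indep_var_distribution_eq
    proof (intro conjI)
      have "distr ?P (borel \<Otimes>\<^sub>M borel) (\<lambda>x. (fst x, snd x)) = distr ?P ?P (\<lambda>x. x)"
        by (rule distr_cong) (auto intro!: sets_pair_measure_cong)
      then show "distr ?P borel fst \<Otimes>\<^sub>M distr ?P borel snd = distr ?P (borel \<Otimes>\<^sub>M borel) (\<lambda>x. (fst x, snd x))"
        by (simp add: fst snd distr_id)
    qed measurable
    have dist: "distributed ?P lborel fst std_normal_density" "distributed ?P lborel snd std_normal_density"
      unfolding distributed_def
      using fst snd by (auto simp: gauss_def measurable_lborel2 cong: distr_cong)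
    have dist1: "distributed ?P lborel (\<lambda>z. s * fst z) (normal_density 0 s)"
      using P.normal_density_affine[OF dist(1), of s 0] 3 by simp
    have dist2: "distributed ?P lborel (\<lambda>z. t * snd z) (normal_density 0 t)"
      using P.normal_density_affine[OF dist(2), of t 0] 3 by simp
    have "P.indep_var borel ((\<lambda>x. s * x) \<circ> fst) borel ((\<lambda>x. t * x) \<circ> snd)"
      by (rule P.indep_var_compose[OF ind0]) auto
    then have ind: "P.indep_var borel (\<lambda>z. s * fst z) borel (\<lambda>z. t * snd z)" by (simp add: comp_def)
    have "distributed ?P lborel (\<lambda>z. s * fst z + t * snd z) (normal_density 0 (sqrt (s\<^sup>2 + t\<^sup>2)))"
      using P.add_indep_normal[OF ind 3 dist1 dist2] by simp
    then have 1: "P.expectation (\<lambda>z. f (s * fst z + t * snd z)) = (\<integral>y. f (sqrt (s\<^sup>2 + t\<^sup>2) * y) \<partial>gauss)"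
      by (rule P.expectation_normal) (use 3 f in \<open>auto simp: sum_power2_gt_zero_iff\<close>)
    have "integrable ?P (\<lambda>z. f (s * fst z + t * snd z))"
      by (rule P.P.integrable_const_bound[where B = K]) (use b f in auto)
    then have "(\<integral>y. (\<integral>z. f (s * fst (y, z) + t * snd (y, z)) \<partial>gauss) \<partial>gauss) = P.expectation (\<lambda>z. f (s * fst z + t * snd z))"
      by (rule P.integral_fst')
    then show ?thesis using 1 by simp
  qed
qed

section \<open>Functions with a second order Taylor expansion\<close>

text \<open>The functions with a uniformly bounded second order Taylor expansion are closed under Gaussian
  averages without any differentiation under the integral sign.\<close>

definition taylor2 :: "real \<Rightarrow> (real \<Rightarrow> real) \<Rightarrow> (real \<Rightarrow> real) \<Rightarrow> (real \<Rightarrow> real) \<Rightarrow> bool" where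
  "taylor2 K f f1 f2 \<longleftrightarrow>
     f \<in> borel_measurable borel \<and> f1 \<in> borel_measurable borel \<and> f2 \<in> borel_measurable borel \<and>
     (\<forall>x. \<bar>f x\<bar> \<le> K \<and> \<bar>f1 x\<bar> \<le> K \<and> \<bar>f2 x\<bar> \<le> K) \<and>
     (\<forall>x h. \<bar>f (x + h) - f x - f1 x * h - f2 x * h\<^sup>2 / 2\<bar> \<le> K * \<bar>h\<bar> ^ 3)"

definition gauss_average :: "real \<Rightarrow> (real \<Rightarrow> real) \<Rightarrow> real \<Rightarrow> real" where
  "gauss_average \<tau> f x = (\<integral>y. f (x + \<tau> * y) \<partial>gauss)"

lemma integrable_gauss_bounded:
  "f \<in> borel_measurable borel \<Longrightarrow> (\<And>x. \<bar>f x\<bar> \<le> K) \<Longrightarrow> integrable gauss (\<lambda>y. f (x + \<tau> * y) :: real)"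
  by (rule gauss.integrable_const_bound[where B = K]) auto

lemma gauss_average_bound:
  assumes "f \<in> borel_measurable borel" "\<And>x. \<bar>f x\<bar> \<le> K"
  shows "\<bar>gauss_average \<tau> f x\<bar> \<le> K"
proof -
  have "\<bar>gauss_average \<tau> f x\<bar> \<le> (\<integral>y. \<bar>f (x + \<tau> * y)\<bar> \<partial>gauss)"
    unfolding gauss_average_def by (rule integral_abs_bound)
  also have "\<dots> \<le> (\<integral>y. K \<partial>gauss)"
    by (rule integral_mono) (use integrable_gauss_bounded[OF assms] assms(2) in auto)
  finally show ?thesis using gauss.prob_space by simp
qed

lemma gauss_average_measurable:
  assumes [measurable]: "f \<in> borel_measurable borel"
  shows "gauss_average \<tau> f \<in> borel_measurable borel"
  unfolding gauss_average_def[abs_def] by measurable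

lemma taylor2_gauss_average:
  assumes "taylor2 K f f1 f2"
  shows "taylor2 K (gauss_average \<tau> f) (gauss_average \<tau> f1) (gauss_average \<tau> f2)"
proof -
  have m: "f \<in> borel_measurable borel" "f1 \<in> borel_measurable borel" "f2 \<in> borel_measurable borel"
    and b: "\<And>x. \<bar>f x\<bar> \<le> K" "\<And>x. \<bar>f1 x\<bar> \<le> K" "\<And>x. \<bar>f2 x\<bar> \<le> K"
    and t: "\<And>x h. \<bar>f (x + h) - f x - f1 x * h - f2 x * h\<^sup>2 / 2\<bar> \<le> K * \<bar>h\<bar> ^ 3"
    using assms by (auto simp: taylor2_def)
  note i = integrable_gauss_bounded[OF m(1) b(1)] integrable_gauss_bounded[OF m(2) b(2)] integrable_gauss_bounded[OF m(3) b(3)]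
  have "\<bar>gauss_average \<tau> f (x + h) - gauss_average \<tau> f x - gauss_average \<tau> f1 x * h - gauss_average \<tau> f2 x * h\<^sup>2 / 2\<bar> \<le> K * \<bar>h\<bar> ^ 3" for x h
  proof -
    let ?d = "\<lambda>y. f ((x + h) + \<tau> * y) - f (x + \<tau> * y) - f1 (x + \<tau> * y) * h - f2 (x + \<tau> * y) * h\<^sup>2 / 2"
    have eq: "gauss_average \<tau> f (x + h) - gauss_average \<tau> f x - gauss_average \<tau> f1 x * h - gauss_average \<tau> f2 x * h\<^sup>2 / 2
      = (\<integral>y. ?d y \<partial>gauss)"
      unfolding gauss_average_def using i by simp
    have "\<bar>\<integral>y. ?d y \<partial>gauss\<bar> \<le> (\<integral>y. \<bar>?d y\<bar> \<partial>gauss)" by (rule integral_abs_bound)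
    also have "\<dots> \<le> (\<integral>y. K * \<bar>h\<bar> ^ 3 \<partial>gauss)"
    proof (rule integral_mono)
      show "integrable gauss (\<lambda>y. \<bar>?d y\<bar>)"
        by (intro Bochner_Integration.integrable_abs Bochner_Integration.integrable_diff
            Bochner_Integration.integrable_mult_left Bochner_Integration.integrable_divide i)
      fix y
      have "x + \<tau> * y + h = x + h + \<tau> * y" by simp
      then show "\<bar>?d y\<bar> \<le> K * \<bar>h\<bar> ^ 3" using t[of "x + \<tau> * y" h] by (simp only:)
    qed simp
    finally show ?thesis unfolding eq using gauss.prob_space by simp
  qed
  then show ?thesis
    unfolding taylor2_def using gauss_average_measurable m gauss_average_bound b by blast
qed

lemma gauss_average_average:
  assumes f: "f \<in> borel_measurable borel" and b: "\<And>x. \<bar>f x\<bar> \<le> K" and st: "s \<ge> 0" "t \<ge> 0"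
  shows "gauss_average s (gauss_average t f) x = gauss_average (sqrt (s\<^sup>2 + t\<^sup>2)) f x"
  unfolding gauss_average_def
  using gauss_add[of "\<lambda>z. f (x + z)" K s t] f b st by (simp add: add.assoc)

text \<open>Both a centred two-point step of nearly unit variance and a Gaussian step of unit variance
  change the expectation of a function by half its second derivative, up to third order.\<close>

lemma two_point_gauss_comparison:
  assumes w: "taylor2 K w w1 w2" and h: "h \<ge> 0" and b: "\<bar>b\<bar> \<le> 1"
  shows "\<bar>(1 + b) / 2 * w (y + h * (1 - b)) + (1 - b) / 2 * w (y - h * (1 + b)) - gauss_average h w y\<bar>
    \<le> K * h ^ 3 * (8 + gauss_abs3) + K * h\<^sup>2 * b\<^sup>2 / 2"
proof -
  have m: "w \<in> borel_measurable borel"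
    and bd: "\<And>x. \<bar>w x\<bar> \<le> K" "\<And>x. \<bar>w2 x\<bar> \<le> K"
    and t: "\<And>x h. \<bar>w (x + h) - w x - w1 x * h - w2 x * h\<^sup>2 / 2\<bar> \<le> K * \<bar>h\<bar> ^ 3"
    using w by (auto simp: taylor2_def)
  have K: "K \<ge> 0" using bd(1)[of 0] by linarith
  define r where "r d = w (y + d) - w y - w1 y * d - w2 y * d\<^sup>2 / 2" for d
  have r: "\<bar>r d\<bar> \<le> K * \<bar>d\<bar> ^ 3" for d using t by (simp add: r_def)
  have weq: "w (y + d) = w y + w1 y * d + w2 y * d\<^sup>2 / 2 + r d" for d by (simp add: r_def)
  have r8: "\<bar>r d\<bar> \<le> K * (8 * h ^ 3)" if "\<bar>d\<bar> \<le> 2 * h" for d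
  proof -
    have "\<bar>d\<bar> ^ 3 \<le> (2 * h) ^ 3" using that by (intro power_mono) auto
    then have "K * \<bar>d\<bar> ^ 3 \<le> K * (8 * h ^ 3)" using K by (intro mult_left_mono) (auto simp: power_mult_distrib)
    then show ?thesis using r[of d] by linarith
  qed
  define d1 d2 where "d1 = h * (1 - b)" and "d2 = - (h * (1 + b))"
  have "h * (1 - b) \<le> h * 2" "h * (1 + b) \<le> h * 2" "0 \<le> h * (1 - b)" "0 \<le> h * (1 + b)"
    using h b by (auto intro!: mult_left_mono mult_nonneg_nonneg)
  then have d: "\<bar>d1\<bar> \<le> 2 * h" "\<bar>d2\<bar> \<le> 2 * h" by (auto simp: d1_def d2_def)
  have "(1 + b) / 2 * w (y + d1) + (1 - b) / 2 * w (y + d2) =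
    w y + w1 y * ((1 + b) / 2 * d1 + (1 - b) / 2 * d2) + w2 y * ((1 + b) / 2 * d1\<^sup>2 + (1 - b) / 2 * d2\<^sup>2) / 2
    + ((1 + b) / 2 * r d1 + (1 - b) / 2 * r d2)"
    unfolding weq by (simp add: field_simps)
  also have "(1 + b) / 2 * d1 + (1 - b) / 2 * d2 = 0" by (simp add: d1_def d2_def field_simps)
  also have "(1 + b) / 2 * d1\<^sup>2 + (1 - b) / 2 * d2\<^sup>2 = h\<^sup>2 * (1 - b\<^sup>2)"
    by (simp add: d1_def d2_def field_simps power2_eq_square)
  finally have two: "(1 + b) / 2 * w (y + d1) + (1 - b) / 2 * w (y + d2) =
    w y + w2 y * (h\<^sup>2 * (1 - b\<^sup>2)) / 2 + ((1 + b) / 2 * r d1 + (1 - b) / 2 * r d2)" by simp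
  have "\<bar>(1 + b) / 2 * r d1 + (1 - b) / 2 * r d2\<bar> \<le> (1 + b) / 2 * \<bar>r d1\<bar> + (1 - b) / 2 * \<bar>r d2\<bar>"
    using b by (intro order_trans[OF abs_triangle_ineq]) (auto simp: abs_mult)
  also have "\<dots> \<le> (1 + b) / 2 * (K * (8 * h ^ 3)) + (1 - b) / 2 * (K * (8 * h ^ 3))"
    using b d by (intro add_mono mult_left_mono r8) auto
  also have "\<dots> = K * (8 * h ^ 3)" by (simp add: field_simps)
  finally have e1: "\<bar>(1 + b) / 2 * r d1 + (1 - b) / 2 * r d2\<bar> \<le> K * (8 * h ^ 3)" .
  have ir: "integrable gauss (\<lambda>z. r (h * z))"
    unfolding r_def using integrable_gauss_bounded[OF m bd(1)] by (simp add: power_mult_distrib)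
  have "gauss_average h w y = (\<integral>z. w y + w1 y * h * z + w2 y * h\<^sup>2 / 2 * z\<^sup>2 + r (h * z) \<partial>gauss)"
    unfolding gauss_average_def weq
    by (rule Bochner_Integration.integral_cong) (simp_all add: power_mult_distrib)
  also have "\<dots> = w y + w2 y * h\<^sup>2 / 2 + (\<integral>z. r (h * z) \<partial>gauss)"
    using ir gauss.prob_space by (simp add: gauss_moments)
  finally have ga: "gauss_average h w y = w y + w2 y * h\<^sup>2 / 2 + (\<integral>z. r (h * z) \<partial>gauss)" .
  have "\<bar>\<integral>z. r (h * z) \<partial>gauss\<bar> \<le> (\<integral>z. \<bar>r (h * z)\<bar> \<partial>gauss)" by (rule integral_abs_bound)
  also have "\<dots> \<le> (\<integral>z. K * h ^ 3 * \<bar>z\<bar> ^ 3 \<partial>gauss)"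
  proof (rule integral_mono)
    fix z show "\<bar>r (h * z)\<bar> \<le> K * h ^ 3 * \<bar>z\<bar> ^ 3"
      using r[of "h * z"] h by (simp add: abs_mult power_mult_distrib mult.assoc)
  qed (use ir in auto)
  also have "\<dots> = K * h ^ 3 * gauss_abs3" by (simp add: gauss_abs3_def)
  finally have e2: "\<bar>\<integral>z. r (h * z) \<partial>gauss\<bar> \<le> K * h ^ 3 * gauss_abs3" .
  have e3: "\<bar>w2 y * (h\<^sup>2 * b\<^sup>2) / 2\<bar> \<le> K * h\<^sup>2 * b\<^sup>2 / 2"
    using mult_right_mono[OF bd(2)[of y], of "h\<^sup>2 * b\<^sup>2"] by (simp add: abs_mult mult.assoc)
  have "(1 + b) / 2 * w (y + d1) + (1 - b) / 2 * w (y + d2) - gauss_average h w y =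
    ((1 + b) / 2 * r d1 + (1 - b) / 2 * r d2) - (\<integral>z. r (h * z) \<partial>gauss) - w2 y * (h\<^sup>2 * b\<^sup>2) / 2"
    unfolding two ga by (simp add: field_simps)
  then have "\<bar>(1 + b) / 2 * w (y + d1) + (1 - b) / 2 * w (y + d2) - gauss_average h w y\<bar>
     \<le> K * (8 * h ^ 3) + K * h ^ 3 * gauss_abs3 + K * h\<^sup>2 * b\<^sup>2 / 2"
    using e1 e2 e3 by linarith
  then show ?thesis by (simp add: d1_def d2_def algebra_simps)
qed

section \<open>Smoothing Lipschitz functions\<close>

text \<open>Averaging over \<open>[x, x + \<delta>]\<close> gains one derivative, a difference quotient of the original function, and
keeps the bound and the Lipschitz constant by the mean value theorem.\<close>

lemma moving_average:
  fixes \<phi> :: "real \<Rightarrow> real"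
  assumes b: "\<And>x. \<bar>\<phi> x\<bar> \<le> B" and l: "\<And>x y. \<bar>\<phi> x - \<phi> y\<bar> \<le> L * \<bar>x - y\<bar>" and d: "\<delta> > 0"
  obtains \<psi> where "\<And>x. \<bar>\<psi> x\<bar> \<le> B" "\<And>x y. \<bar>\<psi> x - \<psi> y\<bar> \<le> L * \<bar>x - y\<bar>" "\<And>x. \<bar>\<psi> x - \<phi> x\<bar> \<le> L * \<delta>"
    "\<And>x. (\<psi> has_real_derivative (\<phi> (x + \<delta>) - \<phi> x) / \<delta>) (at x)"
proof -
  have L: "L \<ge> 0" using l[of 0 1] by simp
  have cont: "isCont \<phi> x" for x
  proof -
    have "((\<lambda>y. L * \<bar>y - x\<bar>) \<longlongrightarrow> L * \<bar>x - x\<bar>) (at x)" by (intro tendsto_intros)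
    then have "((\<lambda>y. \<phi> y - \<phi> x) \<longlongrightarrow> 0) (at x)"
      by (intro Lim_null_comparison[of "\<lambda>y. \<phi> y - \<phi> x" "\<lambda>y. L * \<bar>y - x\<bar>"]) (use l in auto)
    then show ?thesis by (simp add: isCont_def LIM_zero_iff)
  qed
  obtain \<Phi> where \<Phi>0: "\<And>x::real. (\<Phi> has_vector_derivative \<phi> x) (at x)"
    using einterval_antiderivative[of "-\<infinity>" "\<infinity>" \<phi>] cont by auto
  then have \<Phi>: "(\<Phi> has_real_derivative \<phi> x) (at x)" for x
    by (simp add: has_real_derivative_iff_has_vector_derivative)
  define \<psi> where "\<psi> x = (\<Phi> (x + \<delta>) - \<Phi> x) / \<delta>" for x
  have mvt: "\<exists>z. x < z \<and> z < x + \<delta> \<and> \<psi> x = \<phi> z" for x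
    using MVT2[of x "x + \<delta>" \<Phi> \<phi>] \<Phi> d by (auto simp: \<psi>_def field_simps)
  have shift: "((\<lambda>t. \<Phi> (x + t)) has_real_derivative \<phi> (x + t)) (at t)" for x t
    using \<Phi>[of "t + x"] unfolding DERIV_shift by (simp add: add.commute)
  show ?thesis
  proof (rule that[of \<psi>])
    fix x
    show "\<bar>\<psi> x\<bar> \<le> B" using mvt[of x] b by auto
    obtain z where z: "x < z" "z < x + \<delta>" "\<psi> x = \<phi> z" using mvt[of x] by blast
    have "\<bar>\<phi> z - \<phi> x\<bar> \<le> L * \<bar>z - x\<bar>" by (rule l)
    also have "\<dots> \<le> L * \<delta>" using z L by (intro mult_left_mono) auto
    finally show "\<bar>\<psi> x - \<phi> x\<bar> \<le> L * \<delta>" using z(3) by simp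
    have "((\<lambda>x. \<Phi> (x + \<delta>)) has_real_derivative \<phi> (x + \<delta>)) (at x)"
      using shift[of \<delta> x] by (simp add: add.commute)
    then show "(\<psi> has_real_derivative (\<phi> (x + \<delta>) - \<phi> x) / \<delta>) (at x)"
      unfolding \<psi>_def[abs_def] by (intro DERIV_cdivide DERIV_diff \<Phi>)
  next
    fix x y
    have "\<exists>z>0. z < \<delta> \<and> (\<Phi> (x + \<delta>) - \<Phi> (y + \<delta>)) - (\<Phi> (x + 0) - \<Phi> (y + 0)) = (\<delta> - 0) * (\<phi> (x + z) - \<phi> (y + z))"
      by (rule MVT2) (use d in \<open>auto intro!: DERIV_diff shift\<close>)
    then obtain z where z: "(\<Phi> (x + \<delta>) - \<Phi> (y + \<delta>)) - (\<Phi> x - \<Phi> y) = \<delta> * (\<phi> (x + z) - \<phi> (y + z))" by auto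
    have "\<psi> x - \<psi> y = ((\<Phi> (x + \<delta>) - \<Phi> (y + \<delta>)) - (\<Phi> x - \<Phi> y)) / \<delta>"
      by (simp add: \<psi>_def diff_divide_distrib)
    then have "\<psi> x - \<psi> y = \<phi> (x + z) - \<phi> (y + z)" unfolding z using d by simp
    then show "\<bar>\<psi> x - \<psi> y\<bar> \<le> L * \<bar>x - y\<bar>" using l[of "x + z" "y + z"] by simp
  qed
qed

lemma lipschitz_measurable:
  fixes \<phi> :: "real \<Rightarrow> real"
  assumes "\<And>x y. \<bar>\<phi> x - \<phi> y\<bar> \<le> L * \<bar>x - y\<bar>"
  shows "\<phi> \<in> borel_measurable borel"
proof (rule borel_measurable_continuous_onI)
  have "continuous (at x) \<phi>" for x
  proof -
    have "((\<lambda>y. L * \<bar>y - x\<bar>) \<longlongrightarrow> L * \<bar>x - x\<bar>) (at x)" by (intro tendsto_intros)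
    then have "((\<lambda>y. \<phi> y - \<phi> x) \<longlongrightarrow> 0) (at x)"
      by (intro Lim_null_comparison[of "\<lambda>y. \<phi> y - \<phi> x" "\<lambda>y. L * \<bar>y - x\<bar>"]) (use assms in auto)
    then show ?thesis by (simp add: continuous_at LIM_zero_iff)
  qed
  then show "continuous_on UNIV \<phi>" by (simp add: continuous_at_imp_continuous_on)
qed

text \<open>Three successive moving averages give a function with a bounded third derivative. The constant
depends on the bound \<open>B\<close> and the scale \<open>\<delta>\<close> only, hence it is uniform over a family of functions.\<close>

lemma lipschitz_smoothing:
  fixes \<phi> :: "real \<Rightarrow> real"
  assumes b: "\<And>x. \<bar>\<phi> x\<bar> \<le> B" and l: "\<And>x y. \<bar>\<phi> x - \<phi> y\<bar> \<le> L * \<bar>x - y\<bar>" and d: "\<delta> > 0"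
  obtains \<psi> \<psi>1 \<psi>2 where "taylor2 (B * (1 + 2 / \<delta> + 4 / \<delta>\<^sup>2 + 8 / \<delta> ^ 3)) \<psi> \<psi>1 \<psi>2" "\<And>x. \<bar>\<psi> x - \<phi> x\<bar> \<le> 3 * L * \<delta>"
proof -
  have B: "B \<ge> 0" using b[of 0] by linarith
  obtain a1 where a1: "\<And>x. \<bar>a1 x\<bar> \<le> B" "\<And>x y. \<bar>a1 x - a1 y\<bar> \<le> L * \<bar>x - y\<bar>" "\<And>x. \<bar>a1 x - \<phi> x\<bar> \<le> L * \<delta>"
    "\<And>x. (a1 has_real_derivative (\<phi> (x + \<delta>) - \<phi> x) / \<delta>) (at x)"
    using moving_average[OF b l d] by blast
  obtain a2 where a2: "\<And>x. \<bar>a2 x\<bar> \<le> B" "\<And>x y. \<bar>a2 x - a2 y\<bar> \<le> L * \<bar>x - y\<bar>" "\<And>x. \<bar>a2 x - a1 x\<bar> \<le> L * \<delta>"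
    "\<And>x. (a2 has_real_derivative (a1 (x + \<delta>) - a1 x) / \<delta>) (at x)"
    using moving_average[OF a1(1,2) d] by blast
  obtain a3 where a3: "\<And>x. \<bar>a3 x\<bar> \<le> B" "\<And>x y. \<bar>a3 x - a3 y\<bar> \<le> L * \<bar>x - y\<bar>" "\<And>x. \<bar>a3 x - a2 x\<bar> \<le> L * \<delta>"
    "\<And>x. (a3 has_real_derivative (a2 (x + \<delta>) - a2 x) / \<delta>) (at x)"
    using moving_average[OF a2(1,2) d] by blast
  let ?D = "\<lambda>f x. (f (x + \<delta>) - f x) / \<delta>"
  have Dm: "?D f \<in> borel_measurable borel" if [measurable]: "f \<in> borel_measurable borel" for f :: "real \<Rightarrow> real"
    by measurable
  have DD: "(?D f has_real_derivative ?D f' x) (at x)" if "\<And>x. (f has_real_derivative f' x) (at x)" for f f' :: "real \<Rightarrow> real" and x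
  proof -
    have "((\<lambda>x. f (x + \<delta>)) has_real_derivative f' (x + \<delta>)) (at x)"
      using that[of "x + \<delta>"] unfolding DERIV_shift .
    then show ?thesis by (intro DERIV_cdivide DERIV_diff that)
  qed
  have Db: "\<bar>?D f x\<bar> \<le> 2 * C / \<delta>" if "\<And>x. \<bar>f x\<bar> \<le> C" for f :: "real \<Rightarrow> real" and C x
    using that[of x] that[of "x + \<delta>"] d by (simp add: abs_divide divide_right_mono)
  define D where "D f x = ?D f x" for f x
  note D = D_def[abs_def, symmetric]
  define K where "K = B * (1 + 2 / \<delta> + 4 / \<delta>\<^sup>2 + 8 / \<delta> ^ 3)"
  have Keq: "K = B + 2 * B / \<delta> + 2 * (2 * B / \<delta>) / \<delta> + 2 * (2 * (2 * B / \<delta>) / \<delta>) / \<delta>"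
    using d by (simp add: K_def field_simps eval_nat_numeral)
  have d1: "(a3 has_real_derivative D a2 x) (at x)" for x using a3(4) by (simp add: D_def)
  have d2: "(D a2 has_real_derivative D (D a1) x) (at x)" for x using DD[OF a2(4)] by (simp add: D_def[abs_def])
  have d3: "(D (D a1) has_real_derivative D (D (D \<phi>)) x) (at x)" for x
    using DD[OF DD[OF a1(4)]] by (simp add: D_def[abs_def])
  have b1: "\<bar>D a2 x\<bar> \<le> 2 * B / \<delta>" for x unfolding D_def by (rule Db) (rule a2)
  have b2: "\<bar>D (D a1) x\<bar> \<le> 2 * (2 * B / \<delta>) / \<delta>" for x
    unfolding D_def[abs_def] by (rule Db, rule Db) (rule a1)
  have b3: "\<bar>D (D (D \<phi>)) x\<bar> \<le> 2 * (2 * (2 * B / \<delta>) / \<delta>) / \<delta>" for x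
    unfolding D_def[abs_def] by (rule Db, rule Db, rule Db) (rule b)
  have nn: "0 \<le> 2 * B / \<delta>" "0 \<le> 2 * (2 * B / \<delta>) / \<delta>" "0 \<le> 2 * (2 * (2 * B / \<delta>) / \<delta>) / \<delta>"
    using B d by auto
  have taylor: "\<bar>a3 (x + h) - a3 x - D a2 x * h - D (D a1) x * h\<^sup>2 / 2\<bar> \<le> K * \<bar>h\<bar> ^ 3" for x h
  proof -
    define diff where "diff m t = (if m = 0 then a3 (x + t) else if m = 1 then D a2 (x + t)
      else if m = 2 then D (D a1) (x + t) else D (D (D \<phi>)) (x + t))" for m :: nat and t
    have sh: "((\<lambda>t. f (x + t)) has_real_derivative f' (x + t)) (at t)" if "\<And>x. (f has_real_derivative f' x) (at x)" for f f' :: "real \<Rightarrow> real" and t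
      using that[of "t + x"] unfolding DERIV_shift by (simp add: add.commute)
    have "\<exists>t. \<bar>t\<bar> \<le> \<bar>h\<bar> \<and> a3 (x + h) = (\<Sum>m<3. diff m 0 / fact m * h ^ m) + diff 3 t / fact 3 * h ^ 3"
    proof (rule Maclaurin_bi_le)
      show "diff 0 = (\<lambda>h. a3 (x + h))" by (simp add: diff_def fun_eq_iff)
      show "\<forall>m t. m < 3 \<and> \<bar>t\<bar> \<le> \<bar>h\<bar> \<longrightarrow> (diff m has_real_derivative diff (Suc m) t) (at t)"
      proof (intro allI impI)
        fix m :: nat and t assume "m < 3 \<and> \<bar>t\<bar> \<le> \<bar>h\<bar>"
        then consider "m = 0" | "m = 1" | "m = 2" by linarith
        then show "(diff m has_real_derivative diff (Suc m) t) (at t)"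
          by cases (simp_all add: diff_def[abs_def] sh[OF d1] sh[OF d2] sh[OF d3])
      qed
    qed
    then obtain t where t: "a3 (x + h) = (\<Sum>m<3. diff m 0 / fact m * h ^ m) + diff 3 t / fact 3 * h ^ 3" by blast
    have "a3 (x + h) - a3 x - D a2 x * h - D (D a1) x * h\<^sup>2 / 2 = D (D (D \<phi>)) (x + t) / 6 * h ^ 3"
      unfolding t by (simp add: diff_def eval_nat_numeral)
    also have "\<bar>\<dots>\<bar> \<le> K * \<bar>h\<bar> ^ 3"
    proof -
      have "\<bar>D (D (D \<phi>)) (x + t) / 6\<bar> \<le> K" using b3[of "x + t"] nn B unfolding Keq by linarith
      then show ?thesis unfolding abs_mult[of "_ / 6"] power_abs by (rule mult_right_mono) simp
    qed
    finally show ?thesis .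
  qed
  have "taylor2 K a3 (D a2) (D (D a1))"
    unfolding taylor2_def
  proof (intro conjI allI)
    show "a3 \<in> borel_measurable borel" by (rule lipschitz_measurable[OF a3(2)])
    show "D a2 \<in> borel_measurable borel" unfolding D_def[abs_def] by (rule Dm[OF lipschitz_measurable[OF a2(2)]])
    show "D (D a1) \<in> borel_measurable borel" unfolding D_def[abs_def] by (rule Dm[OF Dm[OF lipschitz_measurable[OF a1(2)]]])
    fix x
    show "\<bar>a3 x\<bar> \<le> K" "\<bar>D a2 x\<bar> \<le> K" "\<bar>D (D a1) x\<bar> \<le> K"
      using a3(1)[of x] b1[of x] b2[of x] nn B unfolding Keq by linarith+
  qed (rule taylor)
  moreover have "\<bar>a3 x - \<phi> x\<bar> \<le> 3 * L * \<delta>" for x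
    using a1(3)[of x] a2(3)[of x] a3(3)[of x] by (simp add: abs_if split: if_splits)
  ultimately show ?thesis using that unfolding K_def by blast
qed

section \<open>Gaussian approximation of the walk\<close>

context elephant_random_walk
begin

text \<open>The conditional mean of \<open>S N\<close> given the first \<open>j\<close> increments is \<open>rho j N * S j\<close>. A product that ends at
\<open>N\<close>, rather than a quotient of two products starting at 1, stays meaningful for \<open>\<alpha> = -1\<close>, where the
factor at 1 vanishes.\<close>

definition rho :: "nat \<Rightarrow> nat \<Rightarrow> real" where "rho j N = (\<Prod>i\<in>{j..<N}. 1 + \<alpha> / real i)"

text \<open>The variance of the Gaussian noise that replaces the steps between the times \<open>n\<close> and \<open>N\<close>.\<close>

definition tau2 :: "nat \<Rightarrow> nat \<Rightarrow> real" where "tau2 n N = (\<Sum>j\<in>{n..<N}. (rho (Suc j) N)\<^sup>2)"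

text \<open>The amount by which the conditional variances \<open>1 - (\<alpha> * S j / j)\<^sup>2\<close> of the steps fall short of 1, with
the weights of \<^const>\<open>tau2\<close> and up to the factor \<open>\<alpha>\<^sup>2\<close>.\<close>

definition err2 :: "nat \<Rightarrow> nat \<Rightarrow> real" where
  "err2 n N = (\<Sum>j\<in>{n..<N}. (rho (Suc j) N)\<^sup>2 * (m2 j / (real j)\<^sup>2))"

lemma rho_self [simp]: "rho N N = 1" by (simp add: rho_def)

lemma rho_unfold: "j < N \<Longrightarrow> rho j N = (1 + \<alpha> / real j) * rho (Suc j) N"
  by (simp add: rho_def prod.atLeast_Suc_lessThan)

lemma rho_Suc: "j \<le> N \<Longrightarrow> rho j (Suc N) = rho j N * (1 + \<alpha> / real N)"
  by (simp add: rho_def)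

lemma growth_factor_nonneg: "1 + \<alpha> / real i \<ge> 0"
proof (cases "i = 0")
  case False
  have "- \<alpha> \<le> real i" using alpha_bounds False by (simp add: order_trans[of _ 1])
  then show ?thesis using False by (simp add: field_simps)
qed simp

lemma rho_nonneg: "rho j N \<ge> 0"
  unfolding rho_def by (intro prod_nonneg growth_factor_nonneg)

lemma tau2_unfold: "j < N \<Longrightarrow> tau2 j N = (rho (Suc j) N)\<^sup>2 + tau2 (Suc j) N"
  by (simp add: tau2_def sum.atLeast_Suc_lessThan)

lemma tau2_nonneg: "tau2 j N \<ge> 0" by (simp add: tau2_def sum_nonneg)

lemma err2_nonneg: "err2 n N \<ge> 0" by (simp add: err2_def sum_nonneg m2_nonneg)

lemma err2_antimono: "err2 n N \<le> err2 0 N"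
  unfolding err2_def by (rule sum_mono2) (auto simp: m2_nonneg)

text \<open>The variance identity of the martingale behind the walk. It yields the limit of \<^const>\<open>tau2\<close> from that
of the second moments, without evaluating the sum.\<close>

lemma m2_decomposition:
  "n \<le> N \<Longrightarrow> m2 N = (rho n N)\<^sup>2 * m2 n + tau2 n N - \<alpha>\<^sup>2 * err2 n N"
proof (induction N rule: dec_induct)
  case base then show ?case by (simp add: tau2_def err2_def)
next
  case (step N)
  define f where "f = 1 + \<alpha> / real N"
  define q where "q = m2 N / (real N)\<^sup>2"
  have t: "tau2 n (Suc N) = f\<^sup>2 * tau2 n N + 1"
    using step by (simp add: f_def tau2_def sum_distrib_left rho_Suc power_mult_distrib mult.commute)
  have e: "err2 n (Suc N) = f\<^sup>2 * err2 n N + q"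
    using step by (simp add: f_def q_def err2_def sum_distrib_left rho_Suc power_mult_distrib mult_ac)
  have r: "rho n (Suc N) = f * rho n N" using step by (simp add: f_def rho_Suc)
  have "m2 (Suc N) = f\<^sup>2 * m2 N + 1 - \<alpha>\<^sup>2 * q"
  proof (cases "N = 0")
    case True then show ?thesis by (simp add: m2_Suc m2_0 f_def q_def)
  next
    case False then show ?thesis unfolding m2_Suc f_def q_def by (simp add: field_simps power2_eq_square)
  qed
  then show ?case unfolding t e r step.IH by (simp add: algebra_simps power2_eq_square)
qed

text \<open>\<open>U j\<close> is the expectation after all steps from \<open>j\<close> on have been replaced by Gaussian ones. Exchanging
step \<open>j\<close> compares a two-point step with a Gaussian step of the same size \<open>h\<close>, and the Gaussian steps
combine by the semigroup property.\<close>

lemma lindeberg_one_step: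
  fixes \<psi> \<psi>1 \<psi>2 :: "'a \<Rightarrow> real \<Rightarrow> real"
  assumes det: "determined n \<psi>" and t: "\<And>\<omega>. taylor2 K (\<psi> \<omega>) (\<psi>1 \<omega>) (\<psi>2 \<omega>)"
    and j: "n \<le> j" "j < N" and b: "b > 0"
  defines "U \<equiv> \<lambda>j. expectation (\<lambda>\<omega>. gauss_average (sqrt (tau2 j N) / b) (\<psi> \<omega>) (rho j N * S j \<omega> / b))"
  shows "\<bar>U (Suc j) - U j\<bar> \<le> K * (8 + gauss_abs3) * (rho (Suc j) N / b) ^ 3
    + K / 2 * ((rho (Suc j) N)\<^sup>2 * (m2 j / (real j)\<^sup>2) / b\<^sup>2)"
proof -
  define h where "h = rho (Suc j) N / b"
  define W where "W \<omega> = gauss_average (sqrt (tau2 (Suc j) N) / b) (\<psi> \<omega>)" for \<omega>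
  define c where "c \<omega> = \<alpha> * (S j \<omega> / real j)" for \<omega>
  define y where "y \<omega> = rho j N * S j \<omega> / b" for \<omega>
  have h0: "h \<ge> 0" using b rho_nonneg by (simp add: h_def)
  have bd: "\<bar>\<psi> \<omega> x\<bar> \<le> K" and meas: "\<psi> \<omega> \<in> borel_measurable borel" for \<omega> x
    using t[of \<omega>] by (auto simp: taylor2_def)
  have K: "K \<ge> 0" using bd[of undefined 0] by linarith
  have det': "determined j \<psi>" using determined_mono[OF det j(1)] .
  have detW: "determined j W" unfolding W_def[abs_def] by (rule determined_comp[OF det'])
  have detS: "determined j (S j)" by (rule determined_S) simp
  have "U (Suc j) = expectation (\<lambda>\<omega>. W \<omega> (rho (Suc j) N * (S j \<omega> + real_of_int (X (Suc j) \<omega>)) / b))"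
    unfolding U_def W_def by (simp add: S_Suc)
  also have "\<dots> = expectation (\<lambda>\<omega>. (W \<omega> (rho (Suc j) N * (S j \<omega> + real_of_int 1) / b) + W \<omega> (rho (Suc j) N * (S j \<omega> + real_of_int (-1)) / b)) / 2
      + \<alpha> * (S j \<omega> / real j) * ((W \<omega> (rho (Suc j) N * (S j \<omega> + real_of_int 1) / b) - W \<omega> (rho (Suc j) N * (S j \<omega> + real_of_int (-1)) / b)) / 2))"
    by (rule expectation_step[where F = "\<lambda>\<omega> e. W \<omega> (rho (Suc j) N * (S j \<omega> + real_of_int e) / b)"],
        rule determined_comp2[OF detW detS, of "\<lambda>w s. w (rho (Suc j) N * (s + real_of_int _) / b)"])
  also have "\<dots> = expectation (\<lambda>\<omega>. (1 + c \<omega>) / 2 * W \<omega> (y \<omega> + h * (1 - c \<omega>)) + (1 - c \<omega>) / 2 * W \<omega> (y \<omega> - h * (1 + c \<omega>)))"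
  proof (rule Bochner_Integration.integral_cong[OF refl])
    fix \<omega>
    have y: "y \<omega> = h * S j \<omega> + h * c \<omega>"
      unfolding y_def h_def c_def rho_unfold[OF j(2)] by (simp add: algebra_simps add_divide_distrib)
    have 1: "rho (Suc j) N * (S j \<omega> + real_of_int 1) / b = y \<omega> + h * (1 - c \<omega>)"
      unfolding y h_def by (simp add: algebra_simps add_divide_distrib diff_divide_distrib)
    have 2: "rho (Suc j) N * (S j \<omega> + real_of_int (-1)) / b = y \<omega> - h * (1 + c \<omega>)"
      unfolding y h_def by (simp add: algebra_simps add_divide_distrib diff_divide_distrib)
    have alg: "(p + q) / 2 + r * ((p - q) / 2) = (1 + r) / 2 * p + (1 - r) / 2 * q" for p q r :: real
      by (simp add: field_simps)
    show "(W \<omega> (rho (Suc j) N * (S j \<omega> + real_of_int 1) / b) + W \<omega> (rho (Suc j) N * (S j \<omega> + real_of_int (-1)) / b)) / 2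
      + \<alpha> * (S j \<omega> / real j) * ((W \<omega> (rho (Suc j) N * (S j \<omega> + real_of_int 1) / b) - W \<omega> (rho (Suc j) N * (S j \<omega> + real_of_int (-1)) / b)) / 2)
      = (1 + c \<omega>) / 2 * W \<omega> (y \<omega> + h * (1 - c \<omega>)) + (1 - c \<omega>) / 2 * W \<omega> (y \<omega> - h * (1 + c \<omega>))"
      unfolding 1 2 c_def[symmetric] by (rule alg)
  qed
  finally have U1: "U (Suc j) = expectation (\<lambda>\<omega>. (1 + c \<omega>) / 2 * W \<omega> (y \<omega> + h * (1 - c \<omega>)) + (1 - c \<omega>) / 2 * W \<omega> (y \<omega> - h * (1 + c \<omega>)))" .
  have avg: "gauss_average h (W \<omega>) x = gauss_average (sqrt (tau2 j N) / b) (\<psi> \<omega>) x" for \<omega> x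
  proof -
    have "gauss_average h (W \<omega>) x = gauss_average (sqrt (h\<^sup>2 + (sqrt (tau2 (Suc j) N) / b)\<^sup>2)) (\<psi> \<omega>) x"
      unfolding W_def by (rule gauss_average_average[OF meas bd h0]) (use b tau2_nonneg in auto)
    also have "h\<^sup>2 + (sqrt (tau2 (Suc j) N) / b)\<^sup>2 = tau2 j N / b\<^sup>2"
      using b tau2_nonneg[of "Suc j" N] by (simp add: tau2_unfold[OF j(2)] h_def power_divide add_divide_distrib)
    also have "sqrt (tau2 j N / b\<^sup>2) = sqrt (tau2 j N) / b" using b by (simp add: real_sqrt_divide)
    finally show ?thesis .
  qed
  have U0: "U j = expectation (\<lambda>\<omega>. gauss_average h (W \<omega>) (y \<omega>))"
    unfolding U_def avg y_def ..
  define D where "D \<omega> = (1 + c \<omega>) / 2 * W \<omega> (y \<omega> + h * (1 - c \<omega>)) + (1 - c \<omega>) / 2 * W \<omega> (y \<omega> - h * (1 + c \<omega>)) - gauss_average h (W \<omega>) (y \<omega>)" for \<omega>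
  have detD: "determined j D"
    unfolding D_def[abs_def] c_def y_def
    by (rule determined_comp2[OF detW detS, of "\<lambda>w s. (1 + \<alpha> * (s / real j)) / 2 * w (rho j N * s / b + h * (1 - \<alpha> * (s / real j)))
      + (1 - \<alpha> * (s / real j)) / 2 * w (rho j N * s / b - h * (1 + \<alpha> * (s / real j))) - gauss_average h w (rho j N * s / b)"])
  have i1: "integrable M (\<lambda>\<omega>. (1 + c \<omega>) / 2 * W \<omega> (y \<omega> + h * (1 - c \<omega>)) + (1 - c \<omega>) / 2 * W \<omega> (y \<omega> - h * (1 + c \<omega>)))"
    unfolding c_def y_def
    by (rule determined_integrable, rule determined_comp2[OF detW detS, of "\<lambda>w s. (1 + \<alpha> * (s / real j)) / 2 * w (rho j N * s / b + h * (1 - \<alpha> * (s / real j)))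
      + (1 - \<alpha> * (s / real j)) / 2 * w (rho j N * s / b - h * (1 + \<alpha> * (s / real j)))"])
  have i2: "integrable M (\<lambda>\<omega>. gauss_average h (W \<omega>) (y \<omega>))"
    unfolding y_def
    by (rule determined_integrable, rule determined_comp2[OF detW detS, of "\<lambda>w s. gauss_average h w (rho j N * s / b)"])
  have "U (Suc j) - U j = expectation D"
    unfolding U1 U0 D_def using i1 i2 by simp
  then have "\<bar>U (Suc j) - U j\<bar> \<le> expectation (\<lambda>\<omega>. \<bar>D \<omega>\<bar>)" by (simp only: integral_abs_bound)
  also have "\<dots> \<le> expectation (\<lambda>\<omega>. K * h ^ 3 * (8 + gauss_abs3) + K * h\<^sup>2 / 2 * (1 / (real j)\<^sup>2) * (S j \<omega>)\<^sup>2)"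
  proof (rule integral_mono)
    show "integrable M (\<lambda>\<omega>. \<bar>D \<omega>\<bar>)" using determined_integrable[OF detD] by simp
    show "integrable M (\<lambda>\<omega>. K * h ^ 3 * (8 + gauss_abs3) + K * h\<^sup>2 / 2 * (1 / (real j)\<^sup>2) * (S j \<omega>)\<^sup>2)"
      by (rule integrable_S1)
    fix \<omega> assume \<omega>: "\<omega> \<in> space M"
    have \<alpha>1: "\<bar>\<alpha>\<bar> \<le> 1" using alpha_bounds by auto
    have Sj: "\<bar>S j \<omega> / real j\<bar> \<le> 1" using abs_S_le[OF \<omega>, of j] by (simp add: divide_le_eq)
    have cle: "\<bar>c \<omega>\<bar> \<le> \<bar>S j \<omega> / real j\<bar>"
      unfolding c_def abs_mult using \<alpha>1 by (intro mult_left_le_one_le) auto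
    have "\<bar>D \<omega>\<bar> \<le> K * h ^ 3 * (8 + gauss_abs3) + K * h\<^sup>2 * (c \<omega>)\<^sup>2 / 2"
      unfolding D_def
      by (rule two_point_gauss_comparison[OF taylor2_gauss_average[OF t, of "sqrt (tau2 (Suc j) N) / b" \<omega>, folded W_def] h0])
        (use cle Sj in linarith)
    also have "K * h\<^sup>2 * (c \<omega>)\<^sup>2 / 2 \<le> K * h\<^sup>2 * (S j \<omega> / real j)\<^sup>2 / 2"
      using K cle by (intro divide_right_mono mult_left_mono) (auto simp: abs_le_square_iff[symmetric])
    finally show "\<bar>D \<omega>\<bar> \<le> K * h ^ 3 * (8 + gauss_abs3) + K * h\<^sup>2 / 2 * (1 / (real j)\<^sup>2) * (S j \<omega>)\<^sup>2"
      by (simp add: power_divide)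
  qed
  also have "\<dots> = K * h ^ 3 * (8 + gauss_abs3) + K * h\<^sup>2 / 2 * (1 / (real j)\<^sup>2) * m2 j"
    using integrable_S1[of "\<lambda>x. x ^ 2" j] by (simp add: m2_def prob_space)
  finally show ?thesis by (simp add: h_def power_divide mult_ac)
qed

lemma lindeberg_sum:
  fixes \<psi> \<psi>1 \<psi>2 :: "'a \<Rightarrow> real \<Rightarrow> real"
  assumes det: "determined n \<psi>" and t: "\<And>\<omega>. taylor2 K (\<psi> \<omega>) (\<psi>1 \<omega>) (\<psi>2 \<omega>)"
    and nN: "n \<le> N" and b: "b > 0"
  shows "\<bar>expectation (\<lambda>\<omega>. \<psi> \<omega> (S N \<omega> / b)) -
      expectation (\<lambda>\<omega>. gauss_average (sqrt (tau2 n N) / b) (\<psi> \<omega>) (rho n N * S n \<omega> / b))\<bar>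
    \<le> K * (8 + gauss_abs3) * (\<Sum>j\<in>{n..<N}. (rho (Suc j) N / b) ^ 3) + K / 2 * (err2 n N / b\<^sup>2)"
proof -
  define U where "U j = expectation (\<lambda>\<omega>. gauss_average (sqrt (tau2 j N) / b) (\<psi> \<omega>) (rho j N * S j \<omega> / b))" for j
  have "U N = expectation (\<lambda>\<omega>. \<psi> \<omega> (S N \<omega> / b))"
    using gauss.prob_space by (simp add: U_def gauss_average_def tau2_def)
  moreover have "U N - U n = (\<Sum>j\<in>{n..<N}. U (Suc j) - U j)"
    using nN by (simp add: sum_Suc_diff')
  moreover have "\<bar>\<Sum>j\<in>{n..<N}. U (Suc j) - U j\<bar> \<le>
     (\<Sum>j\<in>{n..<N}. K * (8 + gauss_abs3) * (rho (Suc j) N / b) ^ 3 + K / 2 * ((rho (Suc j) N)\<^sup>2 * (m2 j / (real j)\<^sup>2) / b\<^sup>2))"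
    unfolding U_def by (rule order_trans[OF sum_abs sum_mono]) (use lindeberg_one_step[OF det t _ _ b] in auto)
  moreover have "\<dots> = K * (8 + gauss_abs3) * (\<Sum>j\<in>{n..<N}. (rho (Suc j) N / b) ^ 3) + K / 2 * (err2 n N / b\<^sup>2)"
    by (simp add: sum.distrib sum_distrib_left err2_def sum_divide_distrib)
  ultimately show ?thesis by (simp add: U_def)
qed

text \<open>The test function may depend on the past: smoothing at scale \<open>\<delta>\<close> is done for each past separately,
with a Taylor constant that does not depend on the past.\<close>

lemma lindeberg_lipschitz:
  fixes \<phi> :: "'a \<Rightarrow> real \<Rightarrow> real"
  assumes det: "determined n \<phi>" and bd: "\<And>\<omega> x. \<bar>\<phi> \<omega> x\<bar> \<le> B"
    and lip: "\<And>\<omega> x y. \<bar>\<phi> \<omega> x - \<phi> \<omega> y\<bar> \<le> L * \<bar>x - y\<bar>"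
    and nN: "n \<le> N" and b: "b > 0" and d: "\<delta> > 0"
  shows "\<bar>expectation (\<lambda>\<omega>. \<phi> \<omega> (S N \<omega> / b)) -
      expectation (\<lambda>\<omega>. gauss_average (sqrt (tau2 n N) / b) (\<phi> \<omega>) (rho n N * S n \<omega> / b))\<bar>
    \<le> 6 * L * \<delta> + B * (1 + 2 / \<delta> + 4 / \<delta>\<^sup>2 + 8 / \<delta> ^ 3) *
       ((8 + gauss_abs3) * (\<Sum>j\<in>{n..<N}. (rho (Suc j) N / b) ^ 3) + err2 n N / b\<^sup>2)"
proof -
  define K where "K = B * (1 + 2 / \<delta> + 4 / \<delta>\<^sup>2 + 8 / \<delta> ^ 3)"
  have B: "B \<ge> 0" using bd[of undefined 0] by linarith
  have K: "K \<ge> 0" unfolding K_def using B d by simp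
  let ?good = "\<lambda>f::real \<Rightarrow> real. (\<forall>x. \<bar>f x\<bar> \<le> B) \<and> (\<forall>x y. \<bar>f x - f y\<bar> \<le> L * \<bar>x - y\<bar>)"
  have "\<exists>\<psi> \<psi>1 \<psi>2. taylor2 K \<psi> \<psi>1 \<psi>2 \<and> (\<forall>x. \<bar>\<psi> x - f x\<bar> \<le> 3 * L * \<delta>)" if "?good f" for f
    using lipschitz_smoothing[of f B L \<delta>] that d unfolding K_def by metis
  then obtain \<Psi> \<Psi>1 \<Psi>2 where \<Psi>: "\<And>f. ?good f \<Longrightarrow> taylor2 K (\<Psi> f) (\<Psi>1 f) (\<Psi>2 f)"
    "\<And>f x. ?good f \<Longrightarrow> \<bar>\<Psi> f x - f x\<bar> \<le> 3 * L * \<delta>"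
    by metis
  have good: "?good (\<phi> \<omega>)" for \<omega> using bd lip by blast
  define \<psi> where "\<psi> \<omega> = \<Psi> (\<phi> \<omega>)" for \<omega>
  have t: "taylor2 K (\<psi> \<omega>) (\<Psi>1 (\<phi> \<omega>)) (\<Psi>2 (\<phi> \<omega>))" and close: "\<bar>\<psi> \<omega> x - \<phi> \<omega> x\<bar> \<le> 3 * L * \<delta>" for \<omega> x
    unfolding \<psi>_def using \<Psi> good by blast+
  have det\<psi>: "determined n \<psi>" unfolding \<psi>_def[abs_def] by (rule determined_comp[OF det])
  have m\<psi>: "\<psi> \<omega> \<in> borel_measurable borel" "\<And>x. \<bar>\<psi> \<omega> x\<bar> \<le> K" for \<omega> using t[of \<omega>] by (auto simp: taylor2_def)
  have m\<phi>: "\<phi> \<omega> \<in> borel_measurable borel" for \<omega> using lip by (rule lipschitz_measurable)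
  let ?\<tau> = "sqrt (tau2 n N) / b"
  have detN: "determined N \<psi>" "determined N \<phi>" using det\<psi> det nN determined_mono by blast+
  have SN: "determined N (S N)" "determined n (S n)" by (auto intro: determined_S)
  have i: "integrable M (\<lambda>\<omega>. \<phi> \<omega> (S N \<omega> / b))" "integrable M (\<lambda>\<omega>. \<psi> \<omega> (S N \<omega> / b))"
    "integrable M (\<lambda>\<omega>. gauss_average ?\<tau> (\<phi> \<omega>) (rho n N * S n \<omega> / b))"
    "integrable M (\<lambda>\<omega>. gauss_average ?\<tau> (\<psi> \<omega>) (rho n N * S n \<omega> / b))"
    by (rule determined_integrable, rule determined_comp2[OF detN(2) SN(1), of "\<lambda>f s. f (s / b)"],
        rule determined_integrable, rule determined_comp2[OF detN(1) SN(1), of "\<lambda>f s. f (s / b)"],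
        rule determined_integrable, rule determined_comp2[OF det SN(2), of "\<lambda>f s. gauss_average ?\<tau> f (rho n N * s / b)"],
        rule determined_integrable, rule determined_comp2[OF det\<psi> SN(2), of "\<lambda>f s. gauss_average ?\<tau> f (rho n N * s / b)"])
  have E: "\<bar>expectation f - expectation g\<bar> \<le> c" if "integrable M f" "integrable M g" "\<And>\<omega>. \<bar>f \<omega> - g \<omega>\<bar> \<le> c" for f g :: "'a \<Rightarrow> real" and c
  proof -
    have "\<bar>expectation f - expectation g\<bar> = \<bar>expectation (\<lambda>\<omega>. f \<omega> - g \<omega>)\<bar>" using that by simp
    also have "\<dots> \<le> expectation (\<lambda>\<omega>. \<bar>f \<omega> - g \<omega>\<bar>)" by (rule integral_abs_bound)
    also have "\<dots> \<le> expectation (\<lambda>\<omega>. c)" by (rule integral_mono) (use that in auto)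
    finally show ?thesis by (simp add: prob_space)
  qed
  have 1: "\<bar>expectation (\<lambda>\<omega>. \<psi> \<omega> (S N \<omega> / b)) - expectation (\<lambda>\<omega>. \<phi> \<omega> (S N \<omega> / b))\<bar> \<le> 3 * L * \<delta>"
    by (rule E[OF i(2) i(1) close])
  have gc: "\<bar>gauss_average ?\<tau> (\<psi> \<omega>) x - gauss_average ?\<tau> (\<phi> \<omega>) x\<bar> \<le> 3 * L * \<delta>" for \<omega> x
  proof -
    have eq: "gauss_average ?\<tau> (\<psi> \<omega>) x - gauss_average ?\<tau> (\<phi> \<omega>) x = gauss_average ?\<tau> (\<lambda>x. \<psi> \<omega> x - \<phi> \<omega> x) x"
      unfolding gauss_average_def
      by (rule Bochner_Integration.integral_diff[symmetric])
        (rule integrable_gauss_bounded[OF m\<psi>], rule integrable_gauss_bounded[OF m\<phi> bd])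
    show ?thesis unfolding eq
      by (rule gauss_average_bound) (use m\<psi>(1) m\<phi> close in \<open>auto intro: borel_measurable_diff\<close>)
  qed
  have 2: "\<bar>expectation (\<lambda>\<omega>. gauss_average ?\<tau> (\<psi> \<omega>) (rho n N * S n \<omega> / b)) - expectation (\<lambda>\<omega>. gauss_average ?\<tau> (\<phi> \<omega>) (rho n N * S n \<omega> / b))\<bar> \<le> 3 * L * \<delta>"
    by (rule E[OF i(4) i(3) gc])
  have 3: "K / 2 * (err2 n N / b\<^sup>2) \<le> K * (err2 n N / b\<^sup>2)"
    using K err2_nonneg[of n N] by (intro mult_right_mono) auto
  note 4 = lindeberg_sum[OF det\<psi> t nN b]
  show ?thesis
    using 1 2 3 4[unfolded mult.assoc[of K]] unfolding K_def[symmetric] distrib_left[of K "(8 + gauss_abs3) * _"]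
    by linarith
qed

end

section \<open>Convergence of the finite-dimensional distributions\<close>

text \<open>What the Gaussian approximation needs of a normalization \<open>b\<close>: asymptotic variances \<open>V t\<close> of the rescaled
walk, asymptotic negligibility of every single step, asymptotically deterministic conditional
variances, and limits of the factors that propagate the conditional mean.\<close>

locale erw_scaling = elephant_random_walk +
  fixes b :: "nat \<Rightarrow> real" and V :: "real \<Rightarrow> real" and step_bound :: "nat \<Rightarrow> real \<Rightarrow> real"
  assumes b_nonneg: "b n \<ge> 0" and b_pos: "eventually (\<lambda>n. b n > 0) sequentially"
    and variance: "t \<ge> 0 \<Longrightarrow> (\<lambda>n. m2 (nat \<lfloor>real n * t\<rfloor>) / (b n)\<^sup>2) \<longlonglongrightarrow> V t"
    and max_step: "t \<ge> 0 \<Longrightarrow> j < nat \<lfloor>real n * t\<rfloor> \<Longrightarrow> rho (Suc j) (nat \<lfloor>real n * t\<rfloor>) \<le> step_bound n t"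
    and max_step_small: "t \<ge> 0 \<Longrightarrow> (\<lambda>n. step_bound n t / b n) \<longlonglongrightarrow> 0"
    and variance_defect: "t \<ge> 0 \<Longrightarrow> (\<lambda>n. err2 0 (nat \<lfloor>real n * t\<rfloor>) / (b n)\<^sup>2) \<longlonglongrightarrow> 0"
    and rho_limit: "0 < s \<Longrightarrow> s \<le> t \<Longrightarrow>
      (\<lambda>n. rho (nat \<lfloor>real n * s\<rfloor>) (nat \<lfloor>real n * t\<rfloor>)) \<longlonglongrightarrow> (t / s) powr \<alpha>"
begin

definition ratio :: "real \<Rightarrow> real \<Rightarrow> real" where "ratio s t = (t / s) powr \<alpha>"

definition noise :: "real \<Rightarrow> real \<Rightarrow> real" where "noise s t = sqrt (V t - (ratio s t)\<^sup>2 * V s)"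

lemma rho_limit': "0 < s \<Longrightarrow> s \<le> t \<Longrightarrow>
  (\<lambda>n. rho (nat \<lfloor>real n * s\<rfloor>) (nat \<lfloor>real n * t\<rfloor>)) \<longlonglongrightarrow> ratio s t"
  unfolding ratio_def by (rule rho_limit)

lemma floor_mono_times: "0 \<le> s \<Longrightarrow> s \<le> t \<Longrightarrow> nat \<lfloor>real n * s\<rfloor> \<le> nat \<lfloor>real n * t\<rfloor>"
  by (intro nat_mono floor_mono mult_left_mono) auto

text \<open>The variance of the noise is what the variance at time \<open>t\<close> has in excess of the propagated variance
from time \<open>s\<close>. For \<open>s = 0\<close> there is nothing to propagate, and \<open>ratio 0 t = 0\<close> by the convention
\<open>t / 0 = 0\<close>.\<close>

lemma noise_limit:
  assumes st: "0 \<le> s" "s \<le> t"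
  shows "(\<lambda>n. tau2 (nat \<lfloor>real n * s\<rfloor>) (nat \<lfloor>real n * t\<rfloor>) / (b n)\<^sup>2) \<longlonglongrightarrow> V t - (ratio s t)\<^sup>2 * V s"
proof -
  let ?n = "\<lambda>n. nat \<lfloor>real n * s\<rfloor>" and ?N = "\<lambda>n. nat \<lfloor>real n * t\<rfloor>"
  have eq: "tau2 (?n n) (?N n) / (b n)\<^sup>2 =
    m2 (?N n) / (b n)\<^sup>2 - (rho (?n n) (?N n))\<^sup>2 * (m2 (?n n) / (b n)\<^sup>2) + \<alpha>\<^sup>2 * (err2 (?n n) (?N n) / (b n)\<^sup>2)" for n
  proof -
    have "tau2 (?n n) (?N n) = m2 (?N n) - (rho (?n n) (?N n))\<^sup>2 * m2 (?n n) + \<alpha>\<^sup>2 * err2 (?n n) (?N n)"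
      using m2_decomposition[OF floor_mono_times[OF st, of n]] by simp
    then show ?thesis by (simp add: add_divide_distrib diff_divide_distrib)
  qed
  have e: "(\<lambda>n. err2 (?n n) (?N n) / (b n)\<^sup>2) \<longlonglongrightarrow> 0"
    by (rule tendsto_sandwich[OF _ _ tendsto_const variance_defect[of t]])
      (use st err2_nonneg err2_antimono in \<open>auto intro!: always_eventually divide_right_mono\<close>)
  have r: "(\<lambda>n. (rho (?n n) (?N n))\<^sup>2 * (m2 (?n n) / (b n)\<^sup>2)) \<longlonglongrightarrow> (ratio s t)\<^sup>2 * V s"
  proof (cases "s = 0")
    case True
    have "V 0 = 0" using variance[of 0] by (auto simp: m2_0 LIMSEQ_const_iff)
    then show ?thesis using True by (simp add: m2_0)
  next
    case False
    then show ?thesis using st by (intro tendsto_mult tendsto_power rho_limit' variance) auto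
  qed
  have "(\<lambda>n. tau2 (?n n) (?N n) / (b n)\<^sup>2) \<longlonglongrightarrow> V t - (ratio s t)\<^sup>2 * V s + \<alpha>\<^sup>2 * 0"
    unfolding eq by (rule tendsto_add[OF tendsto_diff[OF variance r] tendsto_mult_left[OF e]]) (use st in simp)
  then show ?thesis by simp
qed

lemma noise_limit_sqrt:
  assumes st: "0 \<le> s" "s \<le> t"
  shows "(\<lambda>n. sqrt (tau2 (nat \<lfloor>real n * s\<rfloor>) (nat \<lfloor>real n * t\<rfloor>)) / b n) \<longlonglongrightarrow> noise s t"
  using tendsto_real_sqrt[OF noise_limit[OF st]] b_nonneg unfolding noise_def by (simp add: real_sqrt_divide)

lemma sum_cubes_limit:
  assumes st: "0 \<le> s" "s \<le> t"
  shows "(\<lambda>n. \<Sum>j\<in>{nat \<lfloor>real n * s\<rfloor>..<nat \<lfloor>real n * t\<rfloor>}. (rho (Suc j) (nat \<lfloor>real n * t\<rfloor>) / b n) ^ 3) \<longlonglongrightarrow> 0"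
proof -
  let ?n = "\<lambda>n. nat \<lfloor>real n * s\<rfloor>" and ?N = "\<lambda>n. nat \<lfloor>real n * t\<rfloor>"
  have t: "t \<ge> 0" using st by simp
  have "(\<lambda>n. step_bound n t / b n * (tau2 (?n n) (?N n) / (b n)\<^sup>2)) \<longlonglongrightarrow> 0 * (V t - (ratio s t)\<^sup>2 * V s)"
    by (intro tendsto_mult max_step_small noise_limit st t)
  then have lim: "(\<lambda>n. step_bound n t / b n * (tau2 (?n n) (?N n) / (b n)\<^sup>2)) \<longlonglongrightarrow> 0" by simp
  have le: "(\<Sum>j\<in>{?n n..<?N n}. (rho (Suc j) (?N n) / b n) ^ 3) \<le> step_bound n t / b n * (tau2 (?n n) (?N n) / (b n)\<^sup>2)" for n
  proof -
    have "(\<Sum>j\<in>{?n n..<?N n}. (rho (Suc j) (?N n) / b n) ^ 3) \<le>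
      (\<Sum>j\<in>{?n n..<?N n}. step_bound n t / b n * ((rho (Suc j) (?N n))\<^sup>2 / (b n)\<^sup>2))"
    proof (rule sum_mono)
      fix j assume "j \<in> {?n n..<?N n}"
      then have "rho (Suc j) (?N n) / b n \<le> step_bound n t / b n"
        using max_step[OF t] b_nonneg by (intro divide_right_mono) auto
      then have "rho (Suc j) (?N n) / b n * (rho (Suc j) (?N n) / b n)\<^sup>2 \<le> step_bound n t / b n * (rho (Suc j) (?N n) / b n)\<^sup>2"
        by (rule mult_right_mono) simp
      then show "(rho (Suc j) (?N n) / b n) ^ 3 \<le> step_bound n t / b n * ((rho (Suc j) (?N n))\<^sup>2 / (b n)\<^sup>2)"
        by (simp add: power3_eq_cube power2_eq_square)
    qed
    also have "\<dots> = step_bound n t / b n * (tau2 (?n n) (?N n) / (b n)\<^sup>2)"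
      by (simp add: tau2_def sum_distrib_left sum_divide_distrib)
    finally show ?thesis .
  qed
  show ?thesis
    by (rule tendsto_sandwich[OF _ _ tendsto_const lim])
      (use le rho_nonneg b_nonneg in \<open>auto intro!: always_eventually sum_nonneg\<close>)
qed

text \<open>The transition operator of the limiting Gaussian Markov chain along the times \<open>t\<close>: coordinate \<open>Suc J\<close>
is integrated out given coordinate \<open>J\<close>.\<close>

definition kernel :: "(nat \<Rightarrow> real) \<Rightarrow> nat \<Rightarrow> ((nat \<Rightarrow> real) \<Rightarrow> real) \<Rightarrow> (nat \<Rightarrow> real) \<Rightarrow> real" where
  "kernel t J g x = (\<integral>y. g (x(Suc J := ratio (t J) (t (Suc J)) * x J + noise (t J) (t (Suc J)) * y)) \<partial>gauss)"

lemma prefix_lipschitz_const_nonneg: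
  assumes "prefix_lipschitz J L g" shows "L \<ge> 0"
proof -
  have "\<bar>g (\<lambda>_. 1) - g (\<lambda>_. 0)\<bar> \<le> L * (1 + real J)"
    using assms[unfolded prefix_lipschitz_def, rule_format, of "\<lambda>_. 1" "\<lambda>_. 0"] by simp
  then have "0 \<le> L * (1 + real J)" by (rule order_trans[OF abs_ge_zero])
  then show ?thesis by (simp add: zero_le_mult_iff)
qed

lemma prefix_lipschitz_update:
  assumes g: "prefix_lipschitz (Suc J) L g"
  shows "\<bar>g (x(Suc J := a)) - g (y(Suc J := c))\<bar> \<le> L * ((\<Sum>j\<le>J. \<bar>x j - y j\<bar>) + \<bar>a - c\<bar>)"
proof -
  have "(\<Sum>j\<le>Suc J. \<bar>(x(Suc J := a)) j - (y(Suc J := c)) j\<bar>) = (\<Sum>j\<le>J. \<bar>x j - y j\<bar>) + \<bar>a - c\<bar>" by simp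
  then show ?thesis
    using g[unfolded prefix_lipschitz_def, rule_format, of "x(Suc J := a)" "y(Suc J := c)"] by (simp only:)
qed

lemma prefix_lipschitz_last_measurable:
  assumes g: "prefix_lipschitz (Suc J) L g"
  shows "(\<lambda>y. g (x(Suc J := r + s * y))) \<in> borel_measurable borel"
proof (rule lipschitz_measurable)
  fix y z
  have "\<bar>g (x(Suc J := r + s * y)) - g (x(Suc J := r + s * z))\<bar> \<le> L * \<bar>(r + s * y) - (r + s * z)\<bar>"
    using prefix_lipschitz_update[OF g, of x "r + s * y" x "r + s * z"] by simp
  also have "\<bar>(r + s * y) - (r + s * z)\<bar> = \<bar>s\<bar> * \<bar>y - z\<bar>" by (simp flip: abs_mult right_diff_distrib)
  finally show "\<bar>g (x(Suc J := r + s * y)) - g (x(Suc J := r + s * z))\<bar> \<le> (L * \<bar>s\<bar>) * \<bar>y - z\<bar>" by (simp only: mult.assoc)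
qed

lemma integrable_kernel:
  assumes g: "prefix_lipschitz (Suc J) L g" and B: "\<And>x. \<bar>g x\<bar> \<le> B"
  shows "integrable gauss (\<lambda>y. g (x(Suc J := r + s * y)))"
  by (rule gauss.integrable_const_bound[where B = B])
    (use B prefix_lipschitz_last_measurable[OF g] in auto)

lemma kernel_integral_diff:
  assumes g: "prefix_lipschitz (Suc J) L g" and B: "\<And>x. \<bar>g x\<bar> \<le> B"
  shows "\<bar>(\<integral>y. g (x(Suc J := r + s * y)) \<partial>gauss) - (\<integral>y. g (x'(Suc J := r' + s' * y)) \<partial>gauss)\<bar>
    \<le> L * ((\<Sum>j\<le>J. \<bar>x j - x' j\<bar>) + \<bar>r - r'\<bar> + \<bar>s - s'\<bar> * (\<integral>y. \<bar>y\<bar> \<partial>gauss))"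
proof -
  have L: "L \<ge> 0" by (rule prefix_lipschitz_const_nonneg[OF g])
  let ?D = "\<lambda>y. g (x(Suc J := r + s * y)) - g (x'(Suc J := r' + s' * y))"
  let ?c = "(\<Sum>j\<le>J. \<bar>x j - x' j\<bar>) + \<bar>r - r'\<bar>"
  note i = integrable_kernel[OF g B]
  have eq: "(\<integral>y. g (x(Suc J := r + s * y)) \<partial>gauss) - (\<integral>y. g (x'(Suc J := r' + s' * y)) \<partial>gauss) = (\<integral>y. ?D y \<partial>gauss)"
    by (rule Bochner_Integration.integral_diff[symmetric]) (rule i)+
  have "\<bar>\<integral>y. ?D y \<partial>gauss\<bar> \<le> (\<integral>y. \<bar>?D y\<bar> \<partial>gauss)" by (rule integral_abs_bound)
  also have "\<dots> \<le> (\<integral>y. L * ?c + L * \<bar>s - s'\<bar> * \<bar>y\<bar> \<partial>gauss)"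
  proof (rule integral_mono)
    show "integrable gauss (\<lambda>y. \<bar>?D y\<bar>)"
      by (intro Bochner_Integration.integrable_abs Bochner_Integration.integrable_diff i)
    fix y
    have "\<bar>?D y\<bar> \<le> L * ((\<Sum>j\<le>J. \<bar>x j - x' j\<bar>) + \<bar>(r + s * y) - (r' + s' * y)\<bar>)"
      by (rule prefix_lipschitz_update[OF g])
    also have "\<bar>(r + s * y) - (r' + s' * y)\<bar> \<le> \<bar>r - r'\<bar> + \<bar>s - s'\<bar> * \<bar>y\<bar>"
      unfolding abs_mult[symmetric] by (rule order_trans[OF _ abs_triangle_ineq]) (simp add: algebra_simps)
    finally have "\<bar>?D y\<bar> \<le> L * ((\<Sum>j\<le>J. \<bar>x j - x' j\<bar>) + (\<bar>r - r'\<bar> + \<bar>s - s'\<bar> * \<bar>y\<bar>))"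
      using mult_left_mono[OF _ L] by (simp only: add_left_mono)
    then show "\<bar>?D y\<bar> \<le> L * ?c + L * \<bar>s - s'\<bar> * \<bar>y\<bar>" by (simp only: distrib_left mult.assoc add.assoc)
  qed simp
  also have "\<dots> = L * (?c + \<bar>s - s'\<bar> * (\<integral>y. \<bar>y\<bar> \<partial>gauss))"
    using gauss.prob_space by (simp add: algebra_simps)
  finally show ?thesis unfolding eq .
qed

lemma kernel_lipschitz:
  assumes g: "prefix_lipschitz (Suc J) L g" and B: "\<And>x. \<bar>g x\<bar> \<le> B"
  shows "prefix_lipschitz J (L * (1 + \<bar>ratio (t J) (t (Suc J))\<bar>)) (kernel t J g)"
  unfolding prefix_lipschitz_def
proof (intro allI)
  fix x y
  have L: "L \<ge> 0" by (rule prefix_lipschitz_const_nonneg[OF g])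
  let ?r = "ratio (t J) (t (Suc J))"
  have "\<bar>kernel t J g x - kernel t J g y\<bar> \<le> L * ((\<Sum>j\<le>J. \<bar>x j - y j\<bar>) + \<bar>?r * x J - ?r * y J\<bar>)"
    using kernel_integral_diff[OF g B, of x "?r * x J" "noise (t J) (t (Suc J))" y "?r * y J" "noise (t J) (t (Suc J))"]
    by (simp add: kernel_def)
  also have "\<bar>?r * x J - ?r * y J\<bar> = \<bar>?r\<bar> * \<bar>x J - y J\<bar>" by (simp flip: abs_mult right_diff_distrib)
  also have "\<dots> \<le> \<bar>?r\<bar> * (\<Sum>j\<le>J. \<bar>x j - y j\<bar>)"
    by (intro mult_left_mono member_le_sum) auto
  finally have "\<bar>kernel t J g x - kernel t J g y\<bar> \<le> L * ((\<Sum>j\<le>J. \<bar>x j - y j\<bar>) + \<bar>?r\<bar> * (\<Sum>j\<le>J. \<bar>x j - y j\<bar>))"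
    using mult_left_mono[OF _ L] by (simp only: add_left_mono)
  then show "\<bar>kernel t J g x - kernel t J g y\<bar> \<le> L * (1 + \<bar>?r\<bar>) * (\<Sum>j\<le>J. \<bar>x j - y j\<bar>)"
    by (simp only: distrib_left distrib_right mult.assoc mult_1 mult_1_right)
qed

lemma kernel_bounded:
  assumes g: "prefix_lipschitz (Suc J) L g" and B: "\<And>x. \<bar>g x\<bar> \<le> B"
  shows "\<bar>kernel t J g x\<bar> \<le> B"
proof -
  let ?f = "\<lambda>y. g (x(Suc J := ratio (t J) (t (Suc J)) * x J + noise (t J) (t (Suc J)) * y))"
  have "\<bar>kernel t J g x\<bar> \<le> (\<integral>y. \<bar>?f y\<bar> \<partial>gauss)"
    unfolding kernel_def by (rule integral_abs_bound)
  also have "\<dots> \<le> (\<integral>y. B \<partial>gauss)"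
    by (rule integral_mono) (use B integrable_kernel[OF g B] in auto)
  finally show ?thesis using gauss.prob_space by simp
qed

definition sample :: "(nat \<Rightarrow> real) \<Rightarrow> nat \<Rightarrow> nat \<Rightarrow> 'a \<Rightarrow> real" where
  "sample t n j \<omega> = S (nat \<lfloor>real n * t j\<rfloor>) \<omega> / b n"

text \<open>Lindeberg's estimate with the past values as parameters, followed by the passage to the limit in the
coefficients of the conditional normal law.\<close>

lemma sample_step:
  assumes g: "prefix_lipschitz (Suc J) L g" and B: "\<And>x. \<bar>g x\<bar> \<le> B"
    and t0: "t 0 = 0" and tmono: "\<And>j. t j < t (Suc j)"
  shows "(\<lambda>n. expectation (\<lambda>\<omega>. g (\<lambda>j. sample t n j \<omega>)) - expectation (\<lambda>\<omega>. kernel t J g (\<lambda>j. sample t n j \<omega>))) \<longlonglongrightarrow> 0"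
proof -
  have L: "L \<ge> 0" by (rule prefix_lipschitz_const_nonneg[OF g])
  have tnn: "0 \<le> t j" for j
    by (induction j) (use t0 tmono in \<open>auto intro: order.trans less_imp_le\<close>)
  have tle: "t i \<le> t j" if "i \<le> j" for i j
    using that lift_Suc_mono_le[of t i j] tmono less_imp_le by blast
  let ?s = "t J" and ?t = "t (Suc J)"
  let ?n = "\<lambda>n. nat \<lfloor>real n * ?s\<rfloor>" and ?N = "\<lambda>n. nat \<lfloor>real n * ?t\<rfloor>"
  have st: "0 \<le> ?s" "?s \<le> ?t" using tnn tmono[of J] by auto
  have nN: "?n n \<le> ?N n" for n by (rule floor_mono_times[OF st])
  let ?r = "ratio ?s ?t" and ?\<sigma> = "noise ?s ?t"
  define \<phi> where "\<phi> n \<omega> z = g ((\<lambda>j. if j \<le> J then sample t n j \<omega> else 0)(Suc J := z))" for n \<omega> z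
  define G where "G n \<omega> = gauss_average (sqrt (tau2 (?n n) (?N n)) / b n) (\<phi> n \<omega>) (rho (?n n) (?N n) * S (?n n) \<omega> / b n)" for n \<omega>
  have gS: "\<phi> n \<omega> (S (?N n) \<omega> / b n) = g (\<lambda>j. sample t n j \<omega>)" for n \<omega>
    unfolding \<phi>_def by (rule prefix_lipschitz_cong[OF g]) (auto simp: sample_def le_Suc_eq)
  have det: "determined (?n n) (\<phi> n)" for n
  proof -
    have "determined (?n n) (\<lambda>\<omega>. \<lambda>j. if j \<le> J then sample t n j \<omega> else 0)"
    proof (rule determined_fun)
      fix j
      show "determined (?n n) (\<lambda>\<omega>. if j \<le> J then sample t n j \<omega> else 0)"
      proof (cases "j \<le> J")
        case True
        then have "nat \<lfloor>real n * t j\<rfloor> \<le> ?n n" using tle tnn by (intro floor_mono_times) auto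
        then show ?thesis using True determined_comp[OF determined_S, of _ _ "\<lambda>x. x / b n"] by (simp add: sample_def)
      qed simp
    qed
    from determined_comp[OF this, of "\<lambda>v z. g (v(Suc J := z))"] show ?thesis
      unfolding \<phi>_def[abs_def] .
  qed
  have \<phi>B: "\<bar>\<phi> n \<omega> x\<bar> \<le> B" for n \<omega> x unfolding \<phi>_def by (rule B)
  have \<phi>L: "\<bar>\<phi> n \<omega> x - \<phi> n \<omega> y\<bar> \<le> L * \<bar>x - y\<bar>" for n \<omega> x y
    unfolding \<phi>_def using prefix_lipschitz_update[OF g, of _ x _ y] by (rule order_trans) simp
  \<comment> \<open>The error of the Gaussian approximation, up to the Taylor constant.\<close>
  define R where "R n = (8 + gauss_abs3) * (\<Sum>j\<in>{?n n..<?N n}. (rho (Suc j) (?N n) / b n) ^ 3) + err2 (?n n) (?N n) / (b n)\<^sup>2" for n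
  have "(\<lambda>n. err2 (?n n) (?N n) / (b n)\<^sup>2) \<longlonglongrightarrow> 0"
    by (rule tendsto_sandwich[OF _ _ tendsto_const variance_defect[of ?t]])
      (use st err2_nonneg err2_antimono in \<open>auto intro!: always_eventually divide_right_mono\<close>)
  then have "R \<longlonglongrightarrow> (8 + gauss_abs3) * 0 + 0"
    unfolding R_def[abs_def] by (intro tendsto_intros sum_cubes_limit st)
  then have R0: "R \<longlonglongrightarrow> 0" by simp
  have A: "(\<lambda>n. expectation (\<lambda>\<omega>. g (\<lambda>j. sample t n j \<omega>)) - expectation (G n)) \<longlonglongrightarrow> 0"
  proof (rule tendstoI)
    fix e :: real assume e: "e > 0"
    \<comment> \<open>The smoothing scale is fixed first; the Taylor constant it costs is beaten by \<open>R n\<close>.\<close>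
    define \<delta> where "\<delta> = e / (12 * (L + 1))"
    have \<delta>: "\<delta> > 0" using e L by (simp add: \<delta>_def)
    have "6 * L * \<delta> = (e / 2) * (L / (L + 1))" using L by (simp add: \<delta>_def field_simps)
    also have "\<dots> \<le> e / 2 * 1" using e L by (intro mult_left_mono) auto
    finally have \<delta>L: "6 * L * \<delta> \<le> e / 2" by simp
    define K where "K = B * (1 + 2 / \<delta> + 4 / \<delta>\<^sup>2 + 8 / \<delta> ^ 3)"
    have "(\<lambda>n. K * R n) \<longlonglongrightarrow> K * 0" by (intro tendsto_intros R0)
    then have "eventually (\<lambda>n. K * R n < e / 2) sequentially" using e by (intro order_tendstoD) auto
    then show "\<forall>\<^sub>F n in sequentially. dist (expectation (\<lambda>\<omega>. g (\<lambda>j. sample t n j \<omega>)) - expectation (G n)) 0 < e"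
      using b_pos
    proof eventually_elim
      case (elim n)
      have "\<bar>expectation (\<lambda>\<omega>. \<phi> n \<omega> (S (?N n) \<omega> / b n)) - expectation (G n)\<bar> \<le> 6 * L * \<delta> + K * R n"
        unfolding G_def K_def R_def by (rule lindeberg_lipschitz[OF det \<phi>B \<phi>L nN elim(2) \<delta>])
      then show ?case using elim(1) \<delta>L by (simp add: gS dist_real_def)
    qed
  qed
  \<comment> \<open>\<open>\<eta>\<close> bounds the effect of replacing the coefficients of the conditional law by their limits.\<close>
  define \<eta> where "\<eta> n = L * (\<bar>rho (?n n) (?N n) - ?r\<bar> * expectation (\<lambda>\<omega>. \<bar>S (?n n) \<omega> / b n\<bar>)
     + \<bar>sqrt (tau2 (?n n) (?N n)) / b n - ?\<sigma>\<bar> * (\<integral>y. \<bar>y\<bar> \<partial>gauss))" for n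
  have first: "(\<lambda>n. \<bar>rho (?n n) (?N n) - ?r\<bar> * expectation (\<lambda>\<omega>. \<bar>S (?n n) \<omega> / b n\<bar>)) \<longlonglongrightarrow> 0"
  proof (cases "?s = 0")
    case True then show ?thesis by (simp add: S_0)
  next
    case False
    have le: "expectation (\<lambda>\<omega>. \<bar>S (?n n) \<omega> / b n\<bar>) \<le> 1 + m2 (?n n) / (b n)\<^sup>2" for n
    proof -
      have "expectation (\<lambda>\<omega>. \<bar>S (?n n) \<omega> / b n\<bar>) \<le> expectation (\<lambda>\<omega>. 1 + 1 / (b n)\<^sup>2 * (S (?n n) \<omega>) ^ 2)"
      proof (rule integral_mono)
        show "integrable M (\<lambda>\<omega>. \<bar>S (?n n) \<omega> / b n\<bar>)" by (rule integrable_S1)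
        show "integrable M (\<lambda>\<omega>. 1 + 1 / (b n)\<^sup>2 * (S (?n n) \<omega>) ^ 2)" by (rule integrable_S1)
        fix \<omega>
        have "\<bar>x\<bar> \<le> 1 + x\<^sup>2" for x :: real
          using zero_le_power2[of "\<bar>x\<bar> - 1"] zero_le_power2[of x] by (simp add: power2_eq_square algebra_simps)
        from this[of "S (?n n) \<omega> / b n"] show "\<bar>S (?n n) \<omega> / b n\<bar> \<le> 1 + 1 / (b n)\<^sup>2 * (S (?n n) \<omega>) ^ 2"
          by (simp add: power_divide)
      qed
      also have "\<dots> = 1 + m2 (?n n) / (b n)\<^sup>2"
        using integrable_S1[of "\<lambda>x. x ^ 2" "?n n"] by (simp add: m2_def prob_space)
      finally show ?thesis .
    qed
    have "(\<lambda>n. \<bar>rho (?n n) (?N n) - ?r\<bar> * (1 + m2 (?n n) / (b n)\<^sup>2)) \<longlonglongrightarrow> \<bar>?r - ?r\<bar> * (1 + V ?s)"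
      using False st by (intro tendsto_intros rho_limit' variance) auto
    then have lim: "(\<lambda>n. \<bar>rho (?n n) (?N n) - ?r\<bar> * (1 + m2 (?n n) / (b n)\<^sup>2)) \<longlonglongrightarrow> 0" by simp
    show ?thesis
    proof (rule tendsto_sandwich[OF always_eventually always_eventually tendsto_const lim]; intro allI)
      fix n
      show "0 \<le> \<bar>rho (?n n) (?N n) - ?r\<bar> * expectation (\<lambda>\<omega>. \<bar>S (?n n) \<omega> / b n\<bar>)"
        by (intro mult_nonneg_nonneg Bochner_Integration.integral_nonneg abs_ge_zero)
      show "\<bar>rho (?n n) (?N n) - ?r\<bar> * expectation (\<lambda>\<omega>. \<bar>S (?n n) \<omega> / b n\<bar>)
          \<le> \<bar>rho (?n n) (?N n) - ?r\<bar> * (1 + m2 (?n n) / (b n)\<^sup>2)"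
        by (rule mult_left_mono[OF le abs_ge_zero])
    qed
  qed
  have "(\<lambda>n. \<bar>sqrt (tau2 (?n n) (?N n)) / b n - ?\<sigma>\<bar> * (\<integral>y. \<bar>y\<bar> \<partial>gauss)) \<longlonglongrightarrow> \<bar>?\<sigma> - ?\<sigma>\<bar> * (\<integral>y. \<bar>y\<bar> \<partial>gauss)"
    by (intro tendsto_intros noise_limit_sqrt st)
  then have "\<eta> \<longlonglongrightarrow> L * (0 + 0)" unfolding \<eta>_def[abs_def] by (intro tendsto_mult tendsto_add tendsto_const first) simp
  then have \<eta>0: "\<eta> \<longlonglongrightarrow> 0" by simp
  have C: "\<bar>expectation (G n) - expectation (\<lambda>\<omega>. kernel t J g (\<lambda>j. sample t n j \<omega>))\<bar> \<le> \<eta> n" for n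
  proof -
    let ?a = "\<bar>rho (?n n) (?N n) - ?r\<bar>" and ?c = "\<bar>sqrt (tau2 (?n n) (?N n)) / b n - ?\<sigma>\<bar> * (\<integral>y. \<bar>y\<bar> \<partial>gauss)"
    have SdetN: "determined (?N n) (\<lambda>\<omega>. \<lambda>j. if j \<le> J then sample t n j \<omega> else 0)"
    proof (rule determined_fun)
      fix j
      show "determined (?N n) (\<lambda>\<omega>. if j \<le> J then sample t n j \<omega> else 0)"
      proof (cases "j \<le> J")
        case True
        then have "nat \<lfloor>real n * t j\<rfloor> \<le> ?N n" using tle tnn by (intro floor_mono_times) auto
        then show ?thesis using True determined_comp[OF determined_S, of _ _ "\<lambda>x. x / b n"] by (simp add: sample_def)
      qed simp
    qed
    have i1: "integrable M (G n)"
      unfolding G_def[abs_def]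
      by (rule determined_integrable, rule determined_comp2[OF det determined_S[of "?n n" "?n n", OF order_refl],
            of "\<lambda>f s. gauss_average (sqrt (tau2 (?n n) (?N n)) / b n) f (rho (?n n) (?N n) * s / b n)"])
    have keq: "kernel t J g (\<lambda>j. sample t n j \<omega>) = kernel t J g (\<lambda>j. if j \<le> J then sample t n j \<omega> else 0)" for \<omega>
      by (rule prefix_lipschitz_cong[OF kernel_lipschitz[OF g B]]) simp
    have i2: "integrable M (\<lambda>\<omega>. kernel t J g (\<lambda>j. sample t n j \<omega>))"
      unfolding keq by (rule determined_integrable, rule determined_comp[OF SdetN])
    have i3: "integrable M (\<lambda>\<omega>. \<bar>S (?n n) \<omega> / b n\<bar>)" by (rule integrable_S1)
    have "\<bar>expectation (G n) - expectation (\<lambda>\<omega>. kernel t J g (\<lambda>j. sample t n j \<omega>))\<bar>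
      = \<bar>expectation (\<lambda>\<omega>. G n \<omega> - kernel t J g (\<lambda>j. sample t n j \<omega>))\<bar>" using i1 i2 by simp
    also have "\<dots> \<le> expectation (\<lambda>\<omega>. \<bar>G n \<omega> - kernel t J g (\<lambda>j. sample t n j \<omega>)\<bar>)" by (rule integral_abs_bound)
    also have "\<dots> \<le> expectation (\<lambda>\<omega>. L * (?a * \<bar>S (?n n) \<omega> / b n\<bar> + ?c))"
    proof (rule integral_mono)
      show "integrable M (\<lambda>\<omega>. \<bar>G n \<omega> - kernel t J g (\<lambda>j. sample t n j \<omega>)\<bar>)"
        by (intro Bochner_Integration.integrable_abs Bochner_Integration.integrable_diff i1 i2)
      show "integrable M (\<lambda>\<omega>. L * (?a * \<bar>S (?n n) \<omega> / b n\<bar> + ?c))" using i3 by simp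
      fix \<omega>
      let ?v = "\<lambda>j. if j \<le> J then sample t n j \<omega> else 0"
      have vJ: "sample t n J \<omega> = S (?n n) \<omega> / b n" by (simp add: sample_def)
      have "\<bar>G n \<omega> - kernel t J g (\<lambda>j. sample t n j \<omega>)\<bar>
        \<le> L * ((\<Sum>j\<le>J. \<bar>?v j - sample t n j \<omega>\<bar>) + \<bar>rho (?n n) (?N n) * S (?n n) \<omega> / b n - ?r * sample t n J \<omega>\<bar> + ?c)"
        unfolding G_def kernel_def gauss_average_def \<phi>_def by (rule kernel_integral_diff[OF g B])
      also have "(\<Sum>j\<le>J. \<bar>?v j - sample t n j \<omega>\<bar>) = 0" by simp
      also have "rho (?n n) (?N n) * S (?n n) \<omega> / b n - ?r * sample t n J \<omega> = (rho (?n n) (?N n) - ?r) * (S (?n n) \<omega> / b n)"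
        unfolding vJ by (simp add: algebra_simps)
      finally show "\<bar>G n \<omega> - kernel t J g (\<lambda>j. sample t n j \<omega>)\<bar> \<le> L * (?a * \<bar>S (?n n) \<omega> / b n\<bar> + ?c)"
        by (simp only: abs_mult) simp
    qed
    also have "\<dots> = \<eta> n" using i3 by (simp add: \<eta>_def prob_space)
    finally show ?thesis .
  qed
  have "(\<lambda>n. expectation (G n) - expectation (\<lambda>\<omega>. kernel t J g (\<lambda>j. sample t n j \<omega>))) \<longlonglongrightarrow> 0"
    using C by (intro Lim_null_comparison[OF always_eventually \<eta>0]) auto
  from tendsto_add[OF A this] show ?thesis by simp
qed

text \<open>Integrating out the last coordinate by the same kernel on both sides reduces the number of times by
one; at time 0 both sides are constant.\<close>

theorem sample_convergence:
  fixes Q :: "'q measure" and z :: "nat \<Rightarrow> 'q \<Rightarrow> real"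
  assumes t0: "t 0 = 0" and tmono: "\<And>j. t j < t (Suc j)"
    and start: "\<And>L g. prefix_lipschitz 0 L g \<Longrightarrow> (\<integral>\<omega>. g (\<lambda>j. z j \<omega>) \<partial>Q) = g (\<lambda>_. 0)"
    and markov: "\<And>J L g B. prefix_lipschitz (Suc J) L g \<Longrightarrow> (\<And>x. \<bar>g x\<bar> \<le> B) \<Longrightarrow>
      (\<integral>\<omega>. g (\<lambda>j. z j \<omega>) \<partial>Q) = (\<integral>\<omega>. kernel t J g (\<lambda>j. z j \<omega>) \<partial>Q)"
    and g: "prefix_lipschitz J L g" "\<And>x. \<bar>g x\<bar> \<le> B"
  shows "(\<lambda>n. expectation (\<lambda>\<omega>. g (\<lambda>j. sample t n j \<omega>))) \<longlonglongrightarrow> (\<integral>\<omega>. g (\<lambda>j. z j \<omega>) \<partial>Q)"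
  using g
proof (induction J arbitrary: L g)
  case 0
  have "g (\<lambda>j. sample t n j \<omega>) = g (\<lambda>_. 0)" for n \<omega>
    by (rule prefix_lipschitz_cong[OF 0(1)]) (simp add: sample_def t0 S_0)
  then show ?case using start[OF 0(1)] by (simp add: prob_space)
next
  case (Suc J)
  have "(\<lambda>n. expectation (\<lambda>\<omega>. kernel t J g (\<lambda>j. sample t n j \<omega>))) \<longlonglongrightarrow> (\<integral>\<omega>. kernel t J g (\<lambda>j. z j \<omega>) \<partial>Q)"
    by (rule Suc.IH[OF kernel_lipschitz[OF Suc.prems] kernel_bounded[OF Suc.prems]])
  from tendsto_add[OF this sample_step[where t = t, OF Suc.prems t0 tmono]]
  show ?case using markov[OF Suc.prems] by simp
qed

end

section \<open>Convergence of the range\<close>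

text \<open>Turns a small fourth moment into a small first moment, up to an arbitrary threshold.\<close>

lemma le_plus_fourth_power:
  fixes x \<eta> :: real
  assumes "\<eta> > 0" "x \<ge> 0" shows "x \<le> \<eta> + x ^ 4 / \<eta> ^ 3"
proof (cases "x \<le> \<eta>")
  case True
  then show ?thesis using assms by (simp add: add_increasing2)
next
  case False
  then have "x * \<eta> ^ 3 \<le> x * x ^ 3" using assms by (intro mult_left_mono power_mono) auto
  then have "x \<le> x ^ 4 / \<eta> ^ 3" using assms by (simp add: le_divide_eq power4_eq_xxxx power3_eq_cube)
  then show ?thesis using assms by linarith
qed

lemma prob_space_integral_diff_le:
  fixes f g h :: "'a \<Rightarrow> real"
  assumes "prob_space M" and i: "integrable M f" "integrable M g" "integrable M h"
    and le: "\<And>\<omega>. \<omega> \<in> space M \<Longrightarrow> \<bar>f \<omega> - g \<omega>\<bar> \<le> h \<omega>"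
  shows "\<bar>(\<integral>\<omega>. f \<omega> \<partial>M) - (\<integral>\<omega>. g \<omega> \<partial>M)\<bar> \<le> (\<integral>\<omega>. h \<omega> \<partial>M)"
proof -
  have eq: "(\<integral>\<omega>. f \<omega> \<partial>M) - (\<integral>\<omega>. g \<omega> \<partial>M) = (\<integral>\<omega>. f \<omega> - g \<omega> \<partial>M)" using i by simp
  have "\<bar>\<integral>\<omega>. f \<omega> - g \<omega> \<partial>M\<bar> \<le> (\<integral>\<omega>. \<bar>f \<omega> - g \<omega>\<bar> \<partial>M)" by (rule integral_abs_bound)
  also have "\<dots> \<le> (\<integral>\<omega>. h \<omega> \<partial>M)" by (rule integral_mono) (use i le in auto)
  finally show ?thesis unfolding eq .
qed

context erw_scaling
begin

definition grid :: "nat \<Rightarrow> nat \<Rightarrow> real" where "grid m j = real j / real (m ^ 2)"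

text \<open>The sum over the cells dominates the maximum over the cells, and it has an expectation that can be
computed term by term.\<close>

definition grid_max :: "nat \<Rightarrow> nat \<Rightarrow> nat \<Rightarrow> 'a \<Rightarrow> real" where
  "grid_max n m L \<omega> = (\<Sum>j\<le>m ^ 3. max4 (nat \<lfloor>real n * grid m j\<rfloor>) L \<omega>)"

text \<open>In walk time, a cell of the grid has at most \<open>n div m^2 + 2\<close> steps; the 2 covers the rounding at its two
ends.\<close>

lemma grid_cell:
  fixes n m :: nat
  assumes m: "m \<ge> 1" and s: "0 \<le> s"
  defines "k0 \<equiv> nat \<lfloor>real n * grid m (nat \<lfloor>real (m ^ 2) * s\<rfloor>)\<rfloor>" and "k \<equiv> nat \<lfloor>real n * s\<rfloor>"
  shows "k0 \<le> k" "k \<le> k0 + (n div m ^ 2 + 2)"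
proof -
  define j where "j = nat \<lfloor>real (m ^ 2) * s\<rfloor>"
  have m2: "real (m ^ 2) > 0" using m by simp
  have "0 \<le> real (m ^ 2) * s" using s by simp
  then have j: "real j \<le> real (m ^ 2) * s" "real (m ^ 2) * s < real j + 1"
    unfolding j_def by (simp_all only: of_nat_nat zero_le_floor) linarith+
  have g: "grid m j \<le> s" "s < grid m j + 1 / real (m ^ 2)"
    unfolding grid_def add_divide_distrib[symmetric] using j m2 by (simp_all only: divide_le_eq less_divide_eq) (simp_all add: mult.commute)
  have k0: "k0 = nat \<lfloor>real n * grid m j\<rfloor>" by (simp add: k0_def j_def)
  show "k0 \<le> k" unfolding k0 k_def by (intro nat_mono floor_mono mult_left_mono g) simp
  have a: "real n * s \<le> real n * grid m j + real n / real (m ^ 2)"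
    using mult_left_mono[OF less_imp_le[OF g(2)], of "real n"] by (simp add: distrib_left)
  have b: "real n / real (m ^ 2) < real (n div m ^ 2) + 1"
  proof -
    have "n < (n div m ^ 2 + 1) * m ^ 2"
      using m by (metis Suc_eq_plus1 add.commute div_mult_mod_eq mod_less_divisor mult_Suc nat_add_left_cancel_less zero_less_power One_nat_def Suc_le_lessD)
    then have "real n < real ((n div m ^ 2 + 1) * m ^ 2)" by (simp only: of_nat_less_iff)
    then have "real n < (real (n div m ^ 2) + 1) * real (m ^ 2)" by (simp only: of_nat_mult of_nat_add of_nat_1)
    then show ?thesis using m2 by (simp only: divide_less_eq if_True)
  qed
  have g0: "0 \<le> real n * grid m j" by (simp add: grid_def)
  have "real n * grid m j < real k0 + 1" unfolding k0 using g0 by linarith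
  moreover have "real k \<le> real n * s" unfolding k_def using s by simp
  ultimately have "real k < real k0 + 1 + (real (n div m ^ 2) + 1)" using a b by linarith
  then show "k \<le> k0 + (n div m ^ 2 + 2)" by linarith
qed

lemma range_sample_dist:
  assumes m: "m \<ge> 1" and \<eta>: "\<eta> > 0" and b: "b n > 0" and L: "n div m ^ 2 + 2 \<le> L"
  shows "path_dist (\<lambda>t. Osc t (\<lambda>s. S (nat \<lfloor>real n * s\<rfloor>) \<omega> / b n) + 1 / b n) (sampled_osc m (\<lambda>j. sample (grid m) n j \<omega>))
    \<le> 1 / b n + 2 * (\<eta> + grid_max n m L \<omega> / ((b n) ^ 4 * \<eta> ^ 3)) + 1 / (1 + real m)"
proof -
  let ?f = "\<lambda>s. S (nat \<lfloor>real n * s\<rfloor>) \<omega> / b n"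
  let ?W = "\<eta> + grid_max n m L \<omega> / ((b n) ^ 4 * \<eta> ^ 3)"
  have nn: "0 \<le> max4 i L \<omega>" for i using max4_upper[of 0 L i \<omega>] by simp
  have gnn: "0 \<le> grid_max n m L \<omega>" unfolding grid_max_def by (intro sum_nonneg nn)
  have 1: "path_dist (\<lambda>t. Osc t ?f + 1 / b n) (\<lambda>t. Osc t ?f) \<le> 1 / b n"
    by (rule path_dist_least) (use b in auto)
  have 2: "path_dist (\<lambda>t. Osc t ?f) (sampled_osc m (\<lambda>j. sample (grid m) n j \<omega>)) \<le> max (2 * ?W) (1 / (1 + real m))"
  proof (rule sampled_osc_diff_le)
    show "bounded (?f ` {0..t})" for t by (rule bounded_image_step[of "\<lambda>k. S k \<omega> / b n"])
    fix s assume s: "0 \<le> s" "s \<le> real m"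
    define j where "j = nat \<lfloor>real (m ^ 2) * s\<rfloor>"
    define k0 where "k0 = nat \<lfloor>real n * grid m j\<rfloor>"
    define k where "k = nat \<lfloor>real n * s\<rfloor>"
    have k: "k0 \<le> k" "k \<le> k0 + L" using grid_cell[OF m s(1), of n] L by (auto simp: k_def k0_def j_def)
    have "real (m ^ 2) * s \<le> real (m ^ 2) * real m" using s by (intro mult_left_mono) auto
    then have "real (m ^ 2) * s \<le> real (m ^ 3)" by (simp add: power2_eq_square power3_eq_cube)
    then have jm: "j \<le> m ^ 3" unfolding j_def by (simp add: nat_le_iff floor_le_iff)
    have "(S k \<omega> - S k0 \<omega>) ^ 4 \<le> max4 k0 L \<omega>" using max4_upper[of "k - k0" L k0 \<omega>] k by simp
    also have "\<dots> \<le> grid_max n m L \<omega>"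
      unfolding grid_max_def k0_def by (rule member_le_sum[of j]) (use jm nn in auto)
    finally have q: "(S k \<omega> - S k0 \<omega>) ^ 4 \<le> grid_max n m L \<omega>" .
    have "\<bar>(S k \<omega> - S k0 \<omega>) / b n\<bar> \<le> \<eta> + \<bar>(S k \<omega> - S k0 \<omega>) / b n\<bar> ^ 4 / \<eta> ^ 3"
      by (rule le_plus_fourth_power[OF \<eta>]) simp
    also have "\<bar>(S k \<omega> - S k0 \<omega>) / b n\<bar> ^ 4 / \<eta> ^ 3 = (S k \<omega> - S k0 \<omega>) ^ 4 / ((b n) ^ 4 * \<eta> ^ 3)"
      by (simp add: power_even_abs power_divide)
    also have "\<dots> \<le> grid_max n m L \<omega> / ((b n) ^ 4 * \<eta> ^ 3)"
      using q \<eta> b by (intro divide_right_mono) auto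
    finally show "\<bar>?f s - sample (grid m) n (nat \<lfloor>real (m ^ 2) * s\<rfloor>) \<omega>\<bar> \<le> ?W"
      by (simp add: sample_def k_def k0_def j_def diff_divide_distrib)
  qed auto
  have "max (2 * ?W) (1 / (1 + real m)) \<le> 2 * ?W + 1 / (1 + real m)"
    using gnn \<eta> b by (simp add: max_def)
  then show ?thesis using path_dist_triangle[of "\<lambda>t. Osc t ?f + 1 / b n" _ "\<lambda>t. Osc t ?f"] 1 2
    by (smt (verit))
qed

lemma grid_max_integrable: "integrable M (grid_max n m L)"
  unfolding grid_max_def[abs_def] by (intro Bochner_Integration.integrable_sum max4_integrable)

text \<open>There are about \<open>m\<^sup>3\<close> cells of relative length \<open>1 / m\<^sup>2\<close>, and each contributes order \<open>(1 / m\<^sup>2)\<^sup>2\<close>. The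
total is of order \<open>1 / m\<close>.\<close>

lemma grid_max_expectation:
  assumes m: "m \<ge> 1" and n: "n \<ge> m ^ 2"
    and C: "\<And>i k. i + k \<le> (m + 6) * n \<Longrightarrow> expectation (\<lambda>\<omega>. (S (i + k) \<omega> - S i \<omega>) ^ 4) \<le> C * (b n) ^ 4 * (real k / real n)\<^sup>2"
    and C0: "C \<ge> 0"
  shows "\<exists>L. n div m ^ 2 + 2 \<le> L \<and> expectation (grid_max n m L) \<le> 9000 * C * (b n) ^ 4 / real m"
proof -
  define D where "D = n div m ^ 2 + 2"
  have m2: "real (m ^ 2) > 0" "m ^ 2 \<ge> 1" using m by simp_all
  have n0: "real n > 0" using n m2(2) by (metis of_nat_0_less_iff less_le_trans zero_less_one)
  obtain p where p: "2 ^ p \<le> D" "D < 2 ^ (p + 1)"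
    using ex_power_ivl1[of 2 D] by (auto simp: D_def)
  \<comment> \<open>The doubling argument needs a block length that is a power of 2.\<close>
  define l where "l = p + 1"
  have l: "D \<le> 2 ^ l" "2 ^ l \<le> 2 * D" using p by (simp_all add: l_def)
  have "real (n div m ^ 2) \<le> real n / real (m ^ 2)" by (rule of_nat_div_le_of_nat)
  moreover have "1 \<le> real n / real (m ^ 2)" using n m2 by (simp only: le_divide_eq if_True mult_1 of_nat_le_iff)
  ultimately have "real D \<le> 3 * (real n / real (m ^ 2))" unfolding D_def by simp
  then have ll: "real (2 ^ l) \<le> 6 * (real n / real (m ^ 2))"
    using l(2) of_nat_mono[of "2 ^ l" "2 * D", where ?'a = real] by simp
  also have "\<dots> \<le> 6 * (real n / 1)" using m2 by (intro mult_left_mono divide_left_mono) auto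
  finally have "real (2 ^ l) \<le> real (6 * n)" by simp
  then have l6: "2 ^ l \<le> 6 * n" by (simp only: of_nat_le_iff)
  define \<Lambda> where "\<Lambda> = C * (b n) ^ 4 / (real n)\<^sup>2"
  have \<Lambda>0: "\<Lambda> \<ge> 0" using C0 by (simp add: \<Lambda>_def)
  have "(4::real) ^ l = (real (2 ^ l))\<^sup>2" by (simp add: power2_eq_square flip: power_mult_distrib)
  also have "\<dots> \<le> (6 * (real n / real (m ^ 2)))\<^sup>2" using ll by (intro power_mono) auto
  finally have l4: "(4::real) ^ l \<le> 36 * ((real n)\<^sup>2 / real m ^ 4)"
    by (simp add: power_mult_distrib power_divide flip: power_mult)
  have each: "expectation (max4 (nat \<lfloor>real n * grid m j\<rfloor>) (2 ^ l)) \<le> 125 * \<Lambda> * 4 ^ l" if j: "j \<le> m ^ 3" for j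
  proof (rule maximal_inequality)
    fix a k assume ak: "nat \<lfloor>real n * grid m j\<rfloor> \<le> a" "a + k \<le> nat \<lfloor>real n * grid m j\<rfloor> + 2 ^ l"
    have "real n * grid m j \<le> real n * real m"
    proof (rule mult_left_mono)
      have "real j \<le> real (m ^ 3)" using j by (simp only: of_nat_le_iff)
      also have "\<dots> = real m * real (m ^ 2)" by (simp add: power2_eq_square power3_eq_cube)
      finally show "grid m j \<le> real m" unfolding grid_def using m2 by (simp only: divide_le_eq if_True)
    qed simp
    then have "real n * grid m j \<le> real (n * m)" by simp
    then have "nat \<lfloor>real n * grid m j\<rfloor> \<le> n * m" by linarith
    then have "a + k \<le> n * m + 6 * n" using ak l6 by linarith
    then have "a + k \<le> (m + 6) * n" by (simp add: algebra_simps)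
    from C[OF this] show "expectation (\<lambda>\<omega>. (S (a + k) \<omega> - S a \<omega>) ^ 4) \<le> \<Lambda> * real k ^ 2"
      by (simp add: \<Lambda>_def power_divide)
  qed
  have "expectation (grid_max n m (2 ^ l)) = (\<Sum>j\<le>m ^ 3. expectation (max4 (nat \<lfloor>real n * grid m j\<rfloor>) (2 ^ l)))"
    unfolding grid_max_def by (rule Bochner_Integration.integral_sum) (rule max4_integrable)
  also have "\<dots> \<le> (\<Sum>j\<le>m ^ 3. 125 * \<Lambda> * 4 ^ l)" by (intro sum_mono each) auto
  also have "\<dots> = real (m ^ 3 + 1) * (125 * \<Lambda> * 4 ^ l)" by simp
  also have "\<dots> \<le> (2 * real m ^ 3) * (125 * \<Lambda> * (36 * ((real n)\<^sup>2 / real m ^ 4)))"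
    using l4 \<Lambda>0 m by (intro mult_mono mult_left_mono) auto
  also have "\<dots> = 9000 * C * (b n) ^ 4 / real m"
    using m n0 by (simp add: \<Lambda>_def field_simps eval_nat_numeral)
  finally show ?thesis using l(1) unfolding D_def by blast
qed

text \<open>Three comparisons: the walk with its samples (small for large \<open>m\<close>, uniformly in large \<open>n\<close>, by the maximal
inequality), the samples of the walk with those of \<open>Z\<close> (small for fixed \<open>m\<close> and large \<open>n\<close>, by the
convergence at finitely many times), and the samples of \<open>Z\<close> with \<open>Z\<close> (small for large \<open>m\<close>, by continuity).\<close>

theorem range_functional_convergence:
  fixes Q :: "'q measure" and Z :: "real \<Rightarrow> 'q \<Rightarrow> real"
  assumes C: "C \<ge> 0" "\<And>c::nat. eventually (\<lambda>n. \<forall>i k. i + k \<le> c * n \<longrightarrow>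
      expectation (\<lambda>\<omega>. (S (i + k) \<omega> - S i \<omega>) ^ 4) \<le> C * (b n) ^ 4 * (real k / real n)\<^sup>2) sequentially"
    and binf: "(\<lambda>n. 1 / b n) \<longlonglongrightarrow> 0"
    and Q: "prob_space Q"
    and Zm: "\<And>t. t \<ge> 0 \<Longrightarrow> Z t \<in> borel_measurable Q"
    and Zc: "\<And>\<omega>. \<omega> \<in> space Q \<Longrightarrow> continuous_on {0..} (\<lambda>t. Z t \<omega>)"
    and start: "\<And>t L g. t 0 = 0 \<Longrightarrow> (\<And>j. t j < t (Suc j)) \<Longrightarrow> prefix_lipschitz 0 L g \<Longrightarrow>
      (\<integral>\<omega>. g (\<lambda>j. Z (t j) \<omega>) \<partial>Q) = g (\<lambda>_. 0)"
    and markov: "\<And>t J L g B. t 0 = 0 \<Longrightarrow> (\<And>j. t j < t (Suc j)) \<Longrightarrow> prefix_lipschitz (Suc J) L g \<Longrightarrow> (\<And>x. \<bar>g x\<bar> \<le> B) \<Longrightarrow>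
      (\<integral>\<omega>. g (\<lambda>j. Z (t j) \<omega>) \<partial>Q) = (\<integral>\<omega>. kernel t J g (\<lambda>j. Z (t j) \<omega>) \<partial>Q)"
    and F: "path_lipschitz K F"
  shows "(\<lambda>n. expectation (\<lambda>\<omega>. F (\<lambda>t. Osc t (\<lambda>s. S (nat \<lfloor>real n * s\<rfloor>) \<omega> / b n) + 1 / b n))) \<longlonglongrightarrow>
    (\<integral>\<omega>. F (\<lambda>t. Osc t (\<lambda>s. Z s \<omega>)) \<partial>Q)"
proof (rule tendstoI)
  interpret Q: prob_space Q by (rule Q)
  fix e :: real assume e: "e > 0"
  have K: "K \<ge> 0" by (rule path_lipschitz_const_nonneg[OF F])
  define B where "B = K + \<bar>F (\<lambda>_. 0)\<bar>"
  have FB: "\<bar>F x\<bar> \<le> B" for x unfolding B_def by (rule path_lipschitz_bounded[OF F])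
  let ?X = "\<lambda>n \<omega> t. Osc t (\<lambda>s. S (nat \<lfloor>real n * s\<rfloor>) \<omega> / b n) + 1 / b n"
  let ?A = "\<lambda>m n \<omega>. sampled_osc m (\<lambda>j. sample (grid m) n j \<omega>)"
  let ?ZA = "\<lambda>m \<omega>. sampled_osc m (\<lambda>j. Z (grid m j) \<omega>)"
  let ?Y = "\<lambda>\<omega> t. Osc t (\<lambda>s. Z s \<omega>)"
  have G: "prefix_lipschitz (m ^ 3) (2 * K) (\<lambda>v. F (sampled_osc m v))" for m
    using path_lipschitz_step_Osc[OF F, of "m ^ 3" "m ^ 2" 0] by (simp add: sampled_osc_def[abs_def])
  have mX: "(\<lambda>\<omega>. F (?X n \<omega>)) \<in> borel_measurable M" for n
    using step_Osc_measurable[OF F, of "\<lambda>k \<omega>. S k \<omega> / b n" M n "1 / b n"] by simp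
  have mA: "(\<lambda>\<omega>. F (?A m n \<omega>)) \<in> borel_measurable M" for m n
    by (rule prefix_lipschitz_measurable[OF G]) (simp add: sample_def[abs_def])
  have mZA: "(\<lambda>\<omega>. F (?ZA m \<omega>)) \<in> borel_measurable Q" for m
    by (rule prefix_lipschitz_measurable[OF G]) (simp add: Zm grid_def)
  have mY: "(\<lambda>\<omega>. F (?Y \<omega>)) \<in> borel_measurable Q"
    by (rule continuous_Osc_measurable[OF F Zm Zc])
  have iX: "integrable M (\<lambda>\<omega>. F (?X n \<omega>))" and iA: "integrable M (\<lambda>\<omega>. F (?A m n \<omega>))" for m n
    using FB mX mA by (auto intro!: integrable_const_bound[where B = B])
  \<comment> \<open>The threshold for the fluctuations inside a cell; \<open>m\<close> is chosen after it, and \<open>n\<close> after \<open>m\<close>.\<close>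
  define \<eta> where "\<eta> = e / (16 * (K + 1))"
  have \<eta>: "\<eta> > 0" using e K by (simp add: \<eta>_def)
  have "2 * K * \<eta> = (e / 8) * (K / (K + 1))" using K by (simp add: \<eta>_def field_simps)
  also have "\<dots> \<le> e / 8 * 1" using e K by (intro mult_left_mono) auto
  finally have K\<eta>: "2 * K * \<eta> \<le> e / 8" by simp
  have "(\<lambda>m. (\<integral>\<omega>. F (?ZA m \<omega>) \<partial>Q)) \<longlonglongrightarrow> (\<integral>\<omega>. F (?Y \<omega>) \<partial>Q)"
  proof (rule integral_dominated_convergence[where w = "\<lambda>_. B"])
    show "AE \<omega> in Q. (\<lambda>m. F (?ZA m \<omega>)) \<longlonglongrightarrow> F (?Y \<omega>)"
    proof (rule AE_I2)
      fix \<omega> assume "\<omega> \<in> space Q"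
      then show "(\<lambda>m. F (?ZA m \<omega>)) \<longlonglongrightarrow> F (?Y \<omega>)"
        using path_lipschitz_tendsto[OF F sampled_osc_tendsto[OF Zc]] by (simp add: grid_def)
    qed
  qed (use mZA mY FB in auto)
  then have "eventually (\<lambda>m. dist (\<integral>\<omega>. F (?ZA m \<omega>) \<partial>Q) (\<integral>\<omega>. F (?Y \<omega>) \<partial>Q) < e / 4) sequentially"
    using e by (intro tendstoD) auto
  moreover have "eventually (\<lambda>m. K * (18000 * C / \<eta> ^ 3 * (1 / real m) + 1 / (1 + real m)) < e / 8) sequentially"
  proof -
    have "(\<lambda>m. 1 / real m) \<longlonglongrightarrow> 0" "(\<lambda>m. 1 / (1 + real m)) \<longlonglongrightarrow> 0" by real_asymp+
    then have "(\<lambda>m. K * (18000 * C / \<eta> ^ 3 * (1 / real m) + 1 / (1 + real m))) \<longlonglongrightarrow> K * (18000 * C / \<eta> ^ 3 * 0 + 0)"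
      by (intro tendsto_intros)
    then show ?thesis using e by (intro order_tendstoD) auto
  qed
  ultimately have "eventually (\<lambda>m. m \<ge> 1 \<and> dist (\<integral>\<omega>. F (?ZA m \<omega>) \<partial>Q) (\<integral>\<omega>. F (?Y \<omega>) \<partial>Q) < e / 4 \<and>
      K * (18000 * C / \<eta> ^ 3 * (1 / real m) + 1 / (1 + real m)) < e / 8) sequentially"
    using eventually_ge_at_top[of 1] by eventually_elim (intro conjI)
  then obtain m where m: "m \<ge> 1" "dist (\<integral>\<omega>. F (?ZA m \<omega>) \<partial>Q) (\<integral>\<omega>. F (?Y \<omega>) \<partial>Q) < e / 4"
    "K * (18000 * C / \<eta> ^ 3 * (1 / real m) + 1 / (1 + real m)) < e / 8"
    unfolding eventually_sequentially by (meson order_refl)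
  have gr: "grid m 0 = 0" "grid m j < grid m (Suc j)" for j
    using m(1) by (auto simp: grid_def divide_strict_right_mono)
  have "(\<lambda>n. expectation (\<lambda>\<omega>. F (?A m n \<omega>))) \<longlonglongrightarrow> (\<integral>\<omega>. F (?ZA m \<omega>) \<partial>Q)"
    by (rule sample_convergence[where t = "grid m" and z = "\<lambda>j. Z (grid m j)" and g = "\<lambda>v. F (sampled_osc m v)", OF gr _ _ G FB])
      (rule start[of "grid m"], rule gr, rule gr, assumption, rule markov[of "grid m"], rule gr, rule gr, assumption+)
  then have "eventually (\<lambda>n. dist (expectation (\<lambda>\<omega>. F (?A m n \<omega>))) (\<integral>\<omega>. F (?ZA m \<omega>) \<partial>Q) < e / 4) sequentially"
    using e by (intro tendstoD) auto
  moreover have "eventually (\<lambda>n. K * (1 / b n) < e / 8) sequentially"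
    using tendsto_mult_left[OF binf, of K] e by (intro order_tendstoD) auto
  ultimately show "\<forall>\<^sub>F n in sequentially. dist (expectation (\<lambda>\<omega>. F (?X n \<omega>))) (\<integral>\<omega>. F (?Y \<omega>) \<partial>Q) < e"
    using C(2)[of "m + 6"] b_pos eventually_ge_at_top[of "m ^ 2"]
  proof eventually_elim
    case (elim n)
    obtain L where L: "n div m ^ 2 + 2 \<le> L" "expectation (grid_max n m L) \<le> 9000 * C * (b n) ^ 4 / real m"
      using grid_max_expectation[OF m(1) elim(5) _ C(1)] elim(3) by blast
    let ?h = "\<lambda>\<omega>. K * (1 / b n + 2 * (\<eta> + grid_max n m L \<omega> / ((b n) ^ 4 * \<eta> ^ 3)) + 1 / (1 + real m))"
    have "\<bar>expectation (\<lambda>\<omega>. F (?X n \<omega>)) - expectation (\<lambda>\<omega>. F (?A m n \<omega>))\<bar> \<le> expectation ?h"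
    proof (rule prob_space_integral_diff_le[OF prob_space_axioms iX iA])
      show "integrable M ?h" using grid_max_integrable by simp
      fix \<omega>
      have "\<bar>F (?X n \<omega>) - F (?A m n \<omega>)\<bar> \<le> K * path_dist (?X n \<omega>) (?A m n \<omega>)"
        using F by (simp add: path_lipschitz_def)
      also have "\<dots> \<le> ?h \<omega>"
        by (rule mult_left_mono[OF range_sample_dist[OF m(1) \<eta> elim(4) L(1)] K])
      finally show "\<bar>F (?X n \<omega>) - F (?A m n \<omega>)\<bar> \<le> ?h \<omega>" .
    qed
    also have "expectation ?h = K * (1 / b n + 2 * (\<eta> + expectation (grid_max n m L) / ((b n) ^ 4 * \<eta> ^ 3)) + 1 / (1 + real m))"
      using grid_max_integrable by (simp add: prob_space)
    also have "\<dots> \<le> K * (1 / b n + 2 * (\<eta> + (9000 * C * (b n) ^ 4 / real m) / ((b n) ^ 4 * \<eta> ^ 3)) + 1 / (1 + real m))"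
      using L(2) \<eta> elim(4) K by (intro mult_left_mono add_mono divide_right_mono order_refl) auto
    also have "(9000 * C * (b n) ^ 4 / real m) / ((b n) ^ 4 * \<eta> ^ 3) = 9000 * C / \<eta> ^ 3 * (1 / real m)"
      using elim(4) by simp
    also have "K * (1 / b n + 2 * (\<eta> + 9000 * C / \<eta> ^ 3 * (1 / real m)) + 1 / (1 + real m))
      = K * (1 / b n) + 2 * K * \<eta> + K * (18000 * C / \<eta> ^ 3 * (1 / real m) + 1 / (1 + real m))"
      by (simp add: algebra_simps)
    also have "\<dots> < e / 8 + e / 8 + e / 8" using elim(2) K\<eta> m(3) by linarith
    finally show ?case using elim(1) m(2) e unfolding dist_real_def by linarith
  qed
qed

end

section \<open>Asymptotics of the moments\<close>

lemma floor_ratio_limit: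
  assumes "t \<ge> 0"
  shows "(\<lambda>n. real (nat \<lfloor>real n * t\<rfloor>) / real n) \<longlonglongrightarrow> t"
proof (rule tendsto_sandwich)
  show "\<forall>\<^sub>F n in sequentially. t - 1 / real n \<le> real (nat \<lfloor>real n * t\<rfloor>) / real n"
    using eventually_gt_at_top[of 0]
  proof eventually_elim
    case (elim n)
    have "real n * t - 1 \<le> real (nat \<lfloor>real n * t\<rfloor>)" by linarith
    then have "(real n * t - 1) / real n \<le> real (nat \<lfloor>real n * t\<rfloor>) / real n" by (rule divide_right_mono) simp
    then show ?case using elim by (simp add: diff_divide_distrib)
  qed
  show "\<forall>\<^sub>F n in sequentially. real (nat \<lfloor>real n * t\<rfloor>) / real n \<le> t"
    using eventually_gt_at_top[of 0]
  proof eventually_elim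
    case (elim n)
    have "real (nat \<lfloor>real n * t\<rfloor>) \<le> real n * t" using assms by simp
    then show ?case using elim by (simp add: divide_le_eq mult.commute)
  qed
  have "(\<lambda>n. t - 1 / real n) \<longlonglongrightarrow> t - 0" by (intro tendsto_intros lim_const_over_n)
  then show "(\<lambda>n. t - 1 / real n) \<longlonglongrightarrow> t" by simp
qed simp

lemma floor_le_times: "t \<ge> 0 \<Longrightarrow> real (nat \<lfloor>real n * t\<rfloor>) \<le> real n * t"
  by simp

lemma floor_at_top:
  assumes "t > 0" shows "filterlim (\<lambda>n. nat \<lfloor>real n * t\<rfloor>) at_top sequentially"
  unfolding filterlim_at_top
proof
  fix Z :: nat
  show "\<forall>\<^sub>F n in sequentially. Z \<le> nat \<lfloor>real n * t\<rfloor>"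
    using eventually_ge_at_top[of "nat \<lceil>real Z / t\<rceil>"]
  proof eventually_elim
    case (elim n)
    then have "real Z / t \<le> real n" by linarith
    then have "real Z \<le> real n * t" using assms by (simp add: divide_le_eq)
    then show ?case by (simp add: le_nat_iff le_floor_iff)
  qed
qed

lemma ln_growth_comparison:
  assumes a: "\<bar>a\<bar> \<le> 1" and i: "i \<ge> 2"
  shows "\<bar>ln (1 + a / real i) - a * ln (1 + 1 / real i)\<bar> \<le> 4 / (real i)\<^sup>2"
proof -
  have i0: "real i > 0" using i by simp
  have ai: "\<bar>a / real i\<bar> \<le> 1 / 2" using a i by (simp add: abs_divide divide_le_eq)
  have 1: "\<bar>ln (1 + a / real i) - a / real i\<bar> \<le> 2 * (a / real i)\<^sup>2"
    by (rule abs_ln_one_plus_x_minus_x_bound[OF ai])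
  have 2: "\<bar>ln (1 + 1 / real i) - 1 / real i\<bar> \<le> 2 * (1 / real i)\<^sup>2"
    by (rule abs_ln_one_plus_x_minus_x_bound) (use i in simp)
  have "\<bar>a * (ln (1 + 1 / real i) - 1 / real i)\<bar> \<le> 1 * (2 * (1 / real i)\<^sup>2)"
    unfolding abs_mult using a 2 by (intro mult_mono) auto
  then have 3: "\<bar>a * ln (1 + 1 / real i) - a / real i\<bar> \<le> 2 * (1 / real i)\<^sup>2" by (simp add: right_diff_distrib)
  have "a\<^sup>2 \<le> 1" using a abs_square_le_1 by blast
  then have "(a / real i)\<^sup>2 \<le> (1 / real i)\<^sup>2" by (simp add: power_divide divide_right_mono)
  then have "\<bar>ln (1 + a / real i) - a * ln (1 + 1 / real i)\<bar> \<le> 4 * (1 / real i)\<^sup>2"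
    using 1 3 by linarith
  then show ?thesis by (simp add: power_divide)
qed

context elephant_random_walk
begin

text \<open>Each factor \<open>1 + \<alpha> / i\<close> differs from \<open>(1 + 1 / i) powr \<alpha>\<close> by a relative error of order \<open>1 / i\<^sup>2\<close>, and the
errors sum to a telescoping bound. Starting at 2 keeps the factors positive also for \<open>\<alpha> = -1\<close>.\<close>

lemma ln_rho:
  assumes m: "2 \<le> m" "m \<le> N"
  shows "rho m N > 0" "\<bar>ln (rho m N) - \<alpha> * ln (real N / real m)\<bar> \<le> 8 / real m"
proof -
  have \<alpha>1: "\<bar>\<alpha>\<bar> \<le> 1" using alpha_bounds by auto
  have *: "rho m N > 0 \<and> \<bar>ln (rho m N) - \<alpha> * ln (real N / real m)\<bar> \<le> 4 / (real m - 1) - 4 / (real N - 1)"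
    using m(2)
  proof (induction N rule: dec_induct)
    case base then show ?case using m by simp
  next
    case (step N)
    have N: "N \<ge> 2" "real N > 0" using step m by auto
    have "\<bar>\<alpha> / real N\<bar> \<le> 1 / 2" using \<alpha>1 N by (simp add: abs_divide divide_le_eq)
    then have pos: "1 + \<alpha> / real N > 0" by linarith
    have r: "rho m (Suc N) = rho m N * (1 + \<alpha> / real N)" using step by (simp add: rho_Suc)
    have l1: "ln (rho m (Suc N)) = ln (rho m N) + ln (1 + \<alpha> / real N)"
      unfolding r by (rule ln_mult_pos) (use step pos in auto)
    have "real (Suc N) / real m = (real N / real m) * (1 + 1 / real N)" using N m by (simp add: field_simps)
    then have l2: "ln (real (Suc N) / real m) = ln (real N / real m) + ln (1 + 1 / real N)"
      by (simp only:) (rule ln_mult_pos, use N m in \<open>auto intro: add_pos_pos\<close>)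
    have e1: "4 / (real N)\<^sup>2 \<le> 4 / (real N - 1) - 4 / (real (Suc N) - 1)"
      using N by (simp add: field_simps power2_eq_square)
    have e2: "\<bar>ln (1 + \<alpha> / real N) - \<alpha> * ln (1 + 1 / real N)\<bar> \<le> 4 / (real N)\<^sup>2"
      by (rule ln_growth_comparison[OF \<alpha>1 N(1)])
    have "rho m (Suc N) > 0" unfolding r using step.IH pos by (intro mult_pos_pos) auto
    moreover have "\<bar>ln (rho m (Suc N)) - \<alpha> * ln (real (Suc N) / real m)\<bar>
        \<le> 4 / (real m - 1) - 4 / (real (Suc N) - 1)"
      unfolding l1 l2 distrib_left using e1 e2 conjunct2[OF step.IH] by linarith
    ultimately show ?case by blast
  qed
  have "4 / (real m - 1) \<le> 8 / real m" using m by (simp add: field_simps)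
  moreover have "4 / (real N - 1) \<ge> 0" using m by simp
  ultimately show "\<bar>ln (rho m N) - \<alpha> * ln (real N / real m)\<bar> \<le> 8 / real m"
    using conjunct2[OF *] by linarith
  show "rho m N > 0" using * by blast
qed

lemma rho_floor_limit:
  assumes st: "0 < s" "s \<le> t"
  shows "(\<lambda>n. rho (nat \<lfloor>real n * s\<rfloor>) (nat \<lfloor>real n * t\<rfloor>)) \<longlonglongrightarrow> (t / s) powr \<alpha>"
proof -
  let ?m = "\<lambda>n. nat \<lfloor>real n * s\<rfloor>" and ?N = "\<lambda>n. nat \<lfloor>real n * t\<rfloor>"
  have mtop: "filterlim ?m at_top sequentially" by (rule floor_at_top[OF st(1)])
  have ev: "eventually (\<lambda>n. n > 0 \<and> ?m n \<ge> 2 \<and> ?m n \<le> ?N n) sequentially"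
    using filterlim_at_top[THEN iffD1, OF mtop, rule_format, of 2] eventually_gt_at_top[of 0]
    by eventually_elim (use st in \<open>auto intro!: nat_mono floor_mono mult_left_mono\<close>)
  have "(\<lambda>n. (real (?N n) / real n) / (real (?m n) / real n)) \<longlonglongrightarrow> t / s"
    using st by (intro tendsto_divide floor_ratio_limit) auto
  then have q: "(\<lambda>n. real (?N n) / real (?m n)) \<longlonglongrightarrow> t / s"
    by (rule Lim_transform_eventually) (use ev in \<open>auto elim!: eventually_mono\<close>)
  have lnq: "(\<lambda>n. \<alpha> * ln (real (?N n) / real (?m n))) \<longlonglongrightarrow> \<alpha> * ln (t / s)"
    using st by (intro tendsto_intros q) auto
  have "(\<lambda>k. 8 / real k) \<longlonglongrightarrow> 0" by (rule lim_const_over_n)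
  then have small: "(\<lambda>n. 8 / real (?m n)) \<longlonglongrightarrow> 0" by (rule filterlim_compose[OF _ mtop])
  have "(\<lambda>n. ln (rho (?m n) (?N n)) - \<alpha> * ln (real (?N n) / real (?m n))) \<longlonglongrightarrow> 0"
    by (rule Lim_null_comparison[OF _ small]) (use ev ln_rho(2) in \<open>auto elim!: eventually_mono\<close>)
  from tendsto_add[OF this lnq] have "(\<lambda>n. ln (rho (?m n) (?N n))) \<longlonglongrightarrow> \<alpha> * ln (t / s)" by simp
  then have "(\<lambda>n. exp (ln (rho (?m n) (?N n)))) \<longlonglongrightarrow> exp (\<alpha> * ln (t / s))" by (rule tendsto_exp)
  then have "(\<lambda>n. exp (ln (rho (?m n) (?N n)))) \<longlonglongrightarrow> (t / s) powr \<alpha>" using st by (simp add: powr_def)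
  then show ?thesis
    by (rule Lim_transform_eventually) (use ev ln_rho(1) in \<open>auto elim!: eventually_mono\<close>)
qed

text \<open>A bound with a free exponent \<open>\<beta>\<close>, so that negative \<open>\<alpha>\<close> can be treated with a positive exponent. The factor 2
pays for the first factor \<open>1 + \<alpha>\<close>.\<close>

lemma rho_le_powr:
  assumes \<beta>: "\<alpha> \<le> \<beta>" "0 \<le> \<beta>" and j: "j < N"
  shows "rho (Suc j) N \<le> 2 * (real N / max 1 (real j)) powr \<beta>"
proof -
  have *: "rho (Suc j) N \<le> ((real N - 1) / real j) powr \<beta>" if "j \<ge> 1" "Suc j \<le> N" for j N
    using that(2)
  proof (induction N rule: dec_induct)
    case base then show ?case using that by simp
  next
    case (step N)
    have N: "N \<ge> 2" using step that by simp
    have "rho (Suc j) (Suc N) = rho (Suc j) N * (1 + \<alpha> / real N)" using step by (simp add: rho_Suc)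
    also have "\<dots> \<le> ((real N - 1) / real j) powr \<beta> * (1 + \<beta> / real N)"
      using step.IH \<beta> N growth_factor_nonneg by (intro mult_mono add_left_mono divide_right_mono) auto
    also have "\<dots> = (1 + \<beta> / real N) * (real N - 1) powr \<beta> / real j powr \<beta>"
      using N that by (simp add: powr_divide)
    also have "\<dots> \<le> real N powr \<beta> / real j powr \<beta>"
      by (intro divide_right_mono powr_growth \<beta> N) auto
    also have "\<dots> = ((real (Suc N) - 1) / real j) powr \<beta>" by (simp add: powr_divide)
    finally show ?case .
  qed
  show ?thesis
  proof (cases "j = 0")
    case False
    have "rho (Suc j) N \<le> ((real N - 1) / real j) powr \<beta>" using * False j by simp
    also have "\<dots> \<le> (real N / real j) powr \<beta>" using \<beta> j by (intro powr_mono2 divide_right_mono) auto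
    also have "\<dots> \<le> 2 * (real N / real j) powr \<beta>" by simp
    finally show ?thesis using False by (simp add: max_def)
  next
    case True
    show ?thesis
    proof (cases "N = 1")
      case True then show ?thesis using \<open>j = 0\<close> by simp
    next
      case False
      then have N: "1 < N" using j by simp
      have "rho (Suc 0) N = (1 + \<alpha>) * rho (Suc 1) N" using rho_unfold[of 1 N] N by simp
      also have "\<dots> \<le> 2 * ((real N - 1) / real 1) powr \<beta>"
        using alpha_bounds *[of 1 N] N rho_nonneg by (intro mult_mono) auto
      also have "\<dots> \<le> 2 * real N powr \<beta>" using N \<beta> by (simp add: powr_mono2)
      finally show ?thesis using True by simp
    qed
  qed
qed

lemma rho_le_powr_simple:
  assumes "\<alpha> \<le> \<beta>" "0 \<le> \<beta>" "j < N" shows "rho (Suc j) N \<le> 2 * real N powr \<beta>"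
proof -
  have "real N / max 1 (real j) \<le> real N / 1" by (intro divide_left_mono) auto
  then have "(real N / max 1 (real j)) powr \<beta> \<le> real N powr \<beta>" using assms by (intro powr_mono2) auto
  then show ?thesis using rho_le_powr[OF assms] by linarith
qed

text \<open>With squared weights of order \<open>(N / j) powr (2 * \<beta>)\<close> and \<open>m2 j\<close> of order \<open>j powr (1 + \<delta>)\<close>, the terms are
summable in \<open>j\<close> as soon as \<open>\<delta> < 2 * \<beta>\<close>.\<close>

lemma err2_bound:
  assumes \<beta>: "\<alpha> \<le> \<beta>" "0 \<le> \<beta>" and C: "C \<ge> 0" "\<And>j. m2 j \<le> C * real j powr (1 + \<delta>)" and \<delta>: "\<delta> < 2 * \<beta>"
  obtains K where "K \<ge> 0" "\<And>N. err2 0 N \<le> K * real N powr (2 * \<beta>)"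
proof -
  define K where "K = (\<Sum>j. real j powr (\<delta> - 1 - 2 * \<beta>))"
  have s: "summable (\<lambda>j. real j powr (\<delta> - 1 - 2 * \<beta>))" using \<delta> by (simp add: summable_real_powr_iff)
  have K0: "K \<ge> 0" unfolding K_def by (intro suminf_nonneg s) simp
  have "err2 0 N \<le> (4 * C * K) * real N powr (2 * \<beta>)" for N
  proof -
    have "err2 0 N \<le> (\<Sum>j\<in>{0..<N}. 4 * C * real N powr (2 * \<beta>) * real j powr (\<delta> - 1 - 2 * \<beta>))"
      unfolding err2_def
    proof (rule sum_mono)
      fix j assume j: "j \<in> {0..<N}"
      show "(rho (Suc j) N)\<^sup>2 * (m2 j / (real j)\<^sup>2) \<le> 4 * C * real N powr (2 * \<beta>) * real j powr (\<delta> - 1 - 2 * \<beta>)"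
      proof (cases "j = 0")
        case True then show ?thesis by (simp add: m2_0)
      next
        case False
        then have j0: "real j > 0" "real N > 0" using j by auto
        have "rho (Suc j) N \<le> 2 * (real N / real j) powr \<beta>" using rho_le_powr[OF \<beta>, of j N] j False by (simp add: max_def)
        then have "(rho (Suc j) N)\<^sup>2 \<le> (2 * (real N / real j) powr \<beta>)\<^sup>2" by (intro power_mono rho_nonneg)
        also have "\<dots> = 4 * (real N powr (2 * \<beta>) * real j powr (- 2 * \<beta>))"
        proof -
          have "((real N / real j) powr \<beta>)\<^sup>2 = (real N / real j) powr (2 * \<beta>)"
            by (simp add: power2_eq_square flip: powr_add)
          also have "\<dots> = real N powr (2 * \<beta>) * real j powr (- 2 * \<beta>)"
            using j0 by (simp add: powr_divide powr_minus_divide)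
          finally show ?thesis by (simp add: power_mult_distrib)
        qed
        finally have r: "(rho (Suc j) N)\<^sup>2 \<le> 4 * (real N powr (2 * \<beta>) * real j powr (- 2 * \<beta>))" .
        have "m2 j / (real j)\<^sup>2 \<le> C * real j powr (1 + \<delta>) / (real j)\<^sup>2" using C by (intro divide_right_mono) auto
        also have "\<dots> = C * (real j powr (1 + \<delta>) / real j powr 2)" using j0 by simp
        also have "\<dots> = C * real j powr (1 + \<delta> - 2)" by (simp only: powr_diff)
        also have "1 + \<delta> - 2 = \<delta> - 1" by simp
        finally have m: "m2 j / (real j)\<^sup>2 \<le> C * real j powr (\<delta> - 1)" .
        have "(rho (Suc j) N)\<^sup>2 * (m2 j / (real j)\<^sup>2) \<le>
            4 * (real N powr (2 * \<beta>) * real j powr (- 2 * \<beta>)) * (C * real j powr (\<delta> - 1))"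
          using r m m2_nonneg by (intro mult_mono) auto
        also have "\<dots> = 4 * C * real N powr (2 * \<beta>) * (real j powr (- 2 * \<beta>) * real j powr (\<delta> - 1))" by simp
        also have "real j powr (- 2 * \<beta>) * real j powr (\<delta> - 1) = real j powr (\<delta> - 1 - 2 * \<beta>)"
          by (simp add: powr_add[symmetric])
        finally show ?thesis .
      qed
    qed
    also have "\<dots> = 4 * C * real N powr (2 * \<beta>) * (\<Sum>j\<in>{0..<N}. real j powr (\<delta> - 1 - 2 * \<beta>))"
      by (simp add: sum_distrib_left)
    also have "\<dots> \<le> 4 * C * real N powr (2 * \<beta>) * K"
      unfolding K_def using C(1) by (intro mult_left_mono sum_le_suminf s) auto
    finally show ?thesis by (simp add: mult_ac)
  qed
  then show ?thesis using that[of "4 * C * K"] C K0 by simp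
qed

section \<open>The diffusive regime\<close>

lemma m2_diffusive:
  assumes \<beta>: "\<alpha> \<le> \<beta>" "0 \<le> \<beta>" "\<beta> < 1 / 2"
  shows "m2 n \<le> 1 / (1 - 2 * \<beta>) * real n"
proof (induction n)
  case (Suc n)
  have "m2 (Suc n) \<le> m2 n * (1 + 2 * \<beta> / real n) + 1"
    unfolding m2_Suc using \<beta> m2_nonneg by (intro add_right_mono mult_left_mono add_left_mono divide_right_mono) auto
  also have "\<dots> \<le> 1 / (1 - 2 * \<beta>) * real n * (1 + 2 * \<beta> / real n) + 1"
    using Suc \<beta> by (intro add_right_mono mult_right_mono) auto
  also have "\<dots> \<le> 1 / (1 - 2 * \<beta>) * real (Suc n)"
  proof (cases "n = 0")
    case True then show ?thesis using \<beta> by simp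
  next
    case False
    then have "1 / (1 - 2 * \<beta>) * real n * (1 + 2 * \<beta> / real n) + 1 = 1 / (1 - 2 * \<beta>) * real (Suc n)"
      using \<beta> by (simp add: field_simps)
    then show ?thesis by simp
  qed
  finally show ?case .
qed (simp add: m2_0)

text \<open>A quadratic bound \<open>K * n\<^sup>2\<close> grows by \<open>2 * K * n\<close> per step; since \<open>4 * \<beta> < 2\<close>, the drift uses up only a part
of this, and \<open>K\<close> is chosen so that the rest pays for the second moment.\<close>

lemma m4_diffusive:
  assumes \<beta>: "\<alpha> \<le> \<beta>" "0 \<le> \<beta>" "\<beta> < 1 / 2"
  shows "m4 n \<le> (10 * (1 / (1 - 2 * \<beta>)) + 1) / (2 - 4 * \<beta>) * (real n)\<^sup>2"
proof -
  define C where "C = 1 / (1 - 2 * \<beta>)"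
  define K where "K = (10 * C + 1) / (2 - 4 * \<beta>)"
  have C1: "C \<ge> 1" using \<beta> by (simp add: C_def le_divide_eq)
  have Keq: "2 * K = 4 * \<beta> * K + (10 * C + 1)" using \<beta> by (simp add: K_def field_simps)
  have K1: "K \<ge> 1" using \<beta> C1 by (simp add: K_def le_divide_eq)
  have m2C: "m2 n \<le> C * real n" for n unfolding C_def by (rule m2_diffusive[OF \<beta>])
  have "m4 n \<le> K * (real n)\<^sup>2"
  proof (induction n)
    case (Suc n)
    show ?case
    proof (cases "n = 0")
      case True then show ?thesis using K1 by (simp add: m4_Suc m4_0 m2_0)
    next
      case False
      then have n: "real n \<ge> 1" by simp
      have "m4 (Suc n) \<le> m4 n * (1 + 4 * \<beta> / real n) + m2 n * 10 + 1"
      proof -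
        have "4 * \<alpha> / real n \<le> 4 * \<beta> / real n" using \<beta> by (intro divide_right_mono) auto
        then have 1: "m4 n * (1 + 4 * \<alpha> / real n) \<le> m4 n * (1 + 4 * \<beta> / real n)"
          by (intro mult_left_mono m4_nonneg) simp
        have "4 * \<alpha> / real n \<le> 4 / real n" using alpha_bounds by (intro divide_right_mono) auto
        also have "\<dots> \<le> 4 / 1" using n by (intro divide_left_mono) auto
        finally have "m2 n * (6 + 4 * \<alpha> / real n) \<le> m2 n * 10"
          by (intro mult_left_mono m2_nonneg) simp
        with 1 show ?thesis unfolding m4_Suc by linarith
      qed
      also have "\<dots> \<le> K * (real n)\<^sup>2 * (1 + 4 * \<beta> / real n) + C * real n * 10 + 1"
        using Suc m2C[of n] \<beta> by (intro add_right_mono add_mono mult_right_mono) auto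
      also have "\<dots> = K * (real n)\<^sup>2 + (4 * \<beta> * K + 10 * C) * real n + 1"
        using False by (simp add: field_simps power2_eq_square)
      also have "\<dots> \<le> K * (real n)\<^sup>2 + (4 * \<beta> * K + (10 * C + 1)) * real n"
        using n by (simp add: algebra_simps)
      also have "\<dots> \<le> K * (real (Suc n))\<^sup>2"
        unfolding Keq[symmetric] using K1 by (simp add: power2_eq_square algebra_simps)
      finally show ?thesis .
    qed
  qed (simp add: m4_0)
  then show ?thesis by (simp add: K_def C_def)
qed

text \<open>\<open>n / (1 - 2 * \<alpha>)\<close> solves the recursion of the second moments, so the difference solves the homogeneous
recursion and grows like \<open>n powr (2 * \<beta>)\<close>, which is slower than \<open>n\<close>.\<close>

lemma m2_diffusive_limit:
  assumes \<beta>: "\<alpha> \<le> \<beta>" "0 \<le> \<beta>" "\<beta> < 1 / 2"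
  obtains c where "c \<ge> 0" "\<And>k. \<bar>m2 k - real k / (1 - 2 * \<alpha>)\<bar> \<le> c * real k powr (2 * \<beta>)"
proof -
  define y where "y k = m2 k - real k / (1 - 2 * \<alpha>)" for k
  have a: "1 - 2 * \<alpha> > 0" using \<beta> by simp
  have y: "y (Suc k) = y k * (1 + 2 * \<alpha> / real k)" if "k \<ge> 1" for k
  proof -
    have "real k \<noteq> 0" "1 - 2 * \<alpha> \<noteq> 0" using that a by auto
    then have "real (Suc k) / (1 - 2 * \<alpha>) = real k / (1 - 2 * \<alpha>) * (1 + 2 * \<alpha> / real k) + 1"
      by (simp add: field_simps)
    then show ?thesis unfolding y_def m2_Suc by (simp add: algebra_simps)
  qed
  define c where "c = 3 * \<bar>y 1\<bar>"
  have "\<bar>y k\<bar> \<le> c * (real k - 1) powr (2 * \<beta>)" if "k \<ge> 2" for k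
    using that
  proof (induction k rule: dec_induct)
    case base
    have "y 2 = y 1 * (1 + 2 * \<alpha>)" using y[of 1] by (simp add: numeral_2_eq_2)
    moreover have "\<bar>1 + 2 * \<alpha>\<bar> \<le> 3" using alpha_bounds by auto
    ultimately have "\<bar>y 2\<bar> \<le> \<bar>y 1\<bar> * 3" by (simp only: abs_mult mult_left_mono abs_ge_zero)
    then show ?case by (simp add: c_def)
  next
    case (step k)
    have k: "real k \<ge> 2" using step by simp
    have "2 * \<alpha> / real k \<ge> - 2 / real k" using alpha_bounds by (intro divide_right_mono) auto
    moreover have "- 2 / real k \<ge> - 1" using k by (simp add: le_divide_eq)
    ultimately have f: "0 \<le> 1 + 2 * \<alpha> / real k" by linarith
    have "\<bar>y (Suc k)\<bar> = \<bar>y k\<bar> * (1 + 2 * \<alpha> / real k)" using y[of k] step f by (simp add: abs_mult)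
    also have "\<dots> \<le> c * (real k - 1) powr (2 * \<beta>) * (1 + 2 * \<beta> / real k)"
    proof (rule mult_mono[OF step.IH])
      show "1 + 2 * \<alpha> / real k \<le> 1 + 2 * \<beta> / real k"
        using \<beta> by (intro add_left_mono divide_right_mono) auto
    qed (use f in \<open>auto simp: c_def\<close>)
    also have "\<dots> = c * ((1 + 2 * \<beta> / real k) * (real k - 1) powr (2 * \<beta>))" by simp
    also have "\<dots> \<le> c * real k powr (2 * \<beta>)"
      using step \<beta> by (intro mult_left_mono powr_growth) (auto simp: c_def)
    finally show ?case by simp
  qed
  then have "\<bar>y k\<bar> \<le> c * real k powr (2 * \<beta>)" for k
  proof -
    consider "k = 0" | "k = 1" | "k \<ge> 2" by linarith
    then show ?thesis
    proof cases
      case 1 then show ?thesis by (simp add: y_def m2_0)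
    next
      case 2 then show ?thesis by (simp add: c_def)
    next
      case 3
      then have "(real k - 1) powr (2 * \<beta>) \<le> real k powr (2 * \<beta>)" using \<beta> by (intro powr_mono2) auto
      then have "c * (real k - 1) powr (2 * \<beta>) \<le> c * real k powr (2 * \<beta>)" by (intro mult_left_mono) (auto simp: c_def)
      then show ?thesis using 3 \<open>\<And>k. k \<ge> 2 \<Longrightarrow> \<bar>y k\<bar> \<le> c * (real k - 1) powr (2 * \<beta>)\<close>[of k] by linarith
    qed
  qed
  then show ?thesis using that[of c] by (simp add: y_def c_def)
qed

lemma powr_over_n_limit:
  assumes "t \<ge> 0" "\<gamma> < 1" "\<gamma> \<ge> 0"
  shows "(\<lambda>n. (real n * t) powr \<gamma> / real n) \<longlonglongrightarrow> 0"
proof -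
  have "(\<lambda>n. t powr \<gamma> * real n powr (\<gamma> - 1)) \<longlonglongrightarrow> t powr \<gamma> * 0"
    using assms by (intro tendsto_intros tendsto_neg_powr filterlim_real_sequentially) auto
  then have "(\<lambda>n. t powr \<gamma> * real n powr (\<gamma> - 1)) \<longlonglongrightarrow> 0" by simp
  then show ?thesis
    by (rule Lim_transform_eventually)
      (use eventually_gt_at_top[of 0] assms in \<open>auto elim!: eventually_mono simp: powr_mult powr_diff\<close>)
qed

text \<open>The exponent is chosen as \<open>max \<alpha> (1 / 4)\<close>: it must be at least \<open>\<alpha>\<close>, positive for the summability of the
variance defect, and less than \<open>1 / 2\<close>.\<close>

theorem diffusive_scaling:
  assumes "p < 3 / 4"
  shows "erw_scaling M p X u \<epsilon> (\<lambda>n. sqrt (real n)) (\<lambda>t. t / (3 - 4 * p)) (\<lambda>n t. 2 * (real n * t) powr max \<alpha> (1 / 4))"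
    and "\<exists>C\<ge>0. \<forall>c. eventually (\<lambda>n. \<forall>i k. i + k \<le> c * n \<longrightarrow>
      expectation (\<lambda>\<omega>. (S (i + k) \<omega> - S i \<omega>) ^ 4) \<le> C * sqrt (real n) ^ 4 * (real k / real n)\<^sup>2) sequentially"
proof -
  define \<beta> where "\<beta> = max \<alpha> (1 / 4)"
  have \<beta>: "\<alpha> \<le> \<beta>" "0 \<le> \<beta>" "\<beta> < 1 / 2" "0 < 2 * \<beta>" using assms by (auto simp: \<beta>_def \<alpha>_def max_def)
  have a: "3 - 4 * p = 1 - 2 * \<alpha>" by (simp add: \<alpha>_def)
  show "erw_scaling M p X u \<epsilon> (\<lambda>n. sqrt (real n)) (\<lambda>t. t / (3 - 4 * p)) (\<lambda>n t. 2 * (real n * t) powr max \<alpha> (1 / 4))"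
    unfolding \<beta>_def[symmetric]
  proof (unfold_locales)
    fix t :: real assume t: "0 \<le> t"
    let ?N = "\<lambda>n. nat \<lfloor>real n * t\<rfloor>"
    have Npow: "real (?N n) powr \<gamma> \<le> (real n * t) powr \<gamma>" if "\<gamma> \<ge> 0" for n \<gamma>
      using t that by (intro powr_mono2 floor_le_times) auto
    obtain c where c: "c \<ge> 0" "\<And>k. \<bar>m2 k - real k / (1 - 2 * \<alpha>)\<bar> \<le> c * real k powr (2 * \<beta>)"
      using m2_diffusive_limit[OF \<beta>(1-3)] by blast
    have lim0: "(\<lambda>n. (real n * t) powr (2 * \<beta>) / real n) \<longlonglongrightarrow> 0"
      using \<beta> t by (intro powr_over_n_limit) auto
    have "(\<lambda>n. c * ((real n * t) powr (2 * \<beta>) / real n)) \<longlonglongrightarrow> c * 0"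
      by (intro tendsto_intros lim0)
    then have limc: "(\<lambda>n. c * ((real n * t) powr (2 * \<beta>) / real n)) \<longlonglongrightarrow> 0" by simp
    have "(\<lambda>n. (m2 (?N n) - real (?N n) / (1 - 2 * \<alpha>)) / real n) \<longlonglongrightarrow> 0"
    proof (rule Lim_null_comparison[OF always_eventually limc], intro allI)
      fix n
      have "\<bar>m2 (?N n) - real (?N n) / (1 - 2 * \<alpha>)\<bar> \<le> c * (real n * t) powr (2 * \<beta>)"
        using c(2)[of "?N n"] mult_left_mono[OF Npow[of "2 * \<beta>" n] c(1)] \<beta> by linarith
      then show "norm ((m2 (?N n) - real (?N n) / (1 - 2 * \<alpha>)) / real n) \<le> c * ((real n * t) powr (2 * \<beta>) / real n)"
        by (simp add: divide_right_mono)
    qed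
    from tendsto_add[OF this tendsto_divide[OF floor_ratio_limit[OF t] tendsto_const, of "1 - 2 * \<alpha>"]]
    show "(\<lambda>n. m2 (?N n) / (sqrt (real n))\<^sup>2) \<longlonglongrightarrow> t / (3 - 4 * p)"
      using \<beta> unfolding a by (simp add: diff_divide_distrib mult.commute)
    have "(\<lambda>n. sqrt ((real n * t) powr (2 * \<beta>) / real n)) \<longlonglongrightarrow> sqrt 0"
      by (intro tendsto_real_sqrt lim0)
    then have "(\<lambda>n. 2 * sqrt ((real n * t) powr (2 * \<beta>) / real n)) \<longlonglongrightarrow> 2 * sqrt 0"
      by (rule tendsto_mult_left)
    moreover have "sqrt ((real n * t) powr (2 * \<beta>)) = (real n * t) powr \<beta>" for n
    proof -
      have "(real n * t) powr (2 * \<beta>) = ((real n * t) powr \<beta>)\<^sup>2"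
        by (simp add: power2_eq_square flip: powr_add)
      then show ?thesis by simp
    qed
    ultimately show "(\<lambda>n. 2 * (real n * t) powr \<beta> / sqrt (real n)) \<longlonglongrightarrow> 0"
      by (simp add: real_sqrt_divide)
    obtain K where K: "K \<ge> 0" "\<And>N. err2 0 N \<le> K * real N powr (2 * \<beta>)"
      using err2_bound[OF \<beta>(1,2), of "1 / (1 - 2 * \<beta>)" 0] m2_diffusive[OF \<beta>(1-3)] \<beta> by auto
    have "(\<lambda>n. K * ((real n * t) powr (2 * \<beta>) / real n)) \<longlonglongrightarrow> K * 0"
      by (intro tendsto_intros lim0)
    then have limK: "(\<lambda>n. K * ((real n * t) powr (2 * \<beta>) / real n)) \<longlonglongrightarrow> 0" by simp
    show "(\<lambda>n. err2 0 (?N n) / (sqrt (real n))\<^sup>2) \<longlonglongrightarrow> 0"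
    proof (rule Lim_null_comparison[OF always_eventually limK], intro allI)
      fix n
      have "err2 0 (?N n) \<le> K * (real n * t) powr (2 * \<beta>)"
        using K(2)[of "?N n"] mult_left_mono[OF Npow[of "2 * \<beta>" n] K(1)] \<beta> by linarith
      then show "norm (err2 0 (?N n) / (sqrt (real n))\<^sup>2) \<le> K * ((real n * t) powr (2 * \<beta>) / real n)"
        using err2_nonneg by (simp add: divide_right_mono)
    qed
    fix j n assume j: "j < ?N n"
    have "rho (Suc j) (?N n) \<le> 2 * real (?N n) powr \<beta>" by (rule rho_le_powr_simple[OF \<beta>(1,2) j])
    also have "\<dots> \<le> 2 * (real n * t) powr \<beta>" using Npow[OF \<beta>(2), of n] by simp
    finally show "rho (Suc j) (?N n) \<le> 2 * (real n * t) powr \<beta>" .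
  next
    fix s t :: real assume "0 < s" "s \<le> t"
    then show "(\<lambda>n. rho (nat \<lfloor>real n * s\<rfloor>) (nat \<lfloor>real n * t\<rfloor>)) \<longlonglongrightarrow> (t / s) powr \<alpha>"
      by (rule rho_floor_limit)
  next
    show "\<forall>\<^sub>F n in sequentially. 0 < sqrt (real n)"
      using eventually_gt_at_top[of 0] by eventually_elim simp
  qed simp
  define R where "R = (10 * (1 / (1 - 2 * \<beta>)) + 1) / (2 - 4 * \<beta>)"
  have R: "R \<ge> 1"
  proof -
    have "1 / (1 - 2 * \<beta>) \<ge> 1" using \<beta> by (simp add: le_divide_eq)
    then have "2 - 4 * \<beta> \<le> 10 * (1 / (1 - 2 * \<beta>)) + 1" using \<beta> by linarith
    moreover have "0 < 2 - 4 * \<beta>" using \<beta> by simp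
    ultimately show ?thesis unfolding R_def by (simp only: le_divide_eq_1_pos)
  qed
  have "expectation (\<lambda>\<omega>. (S (i + k) \<omega> - S i \<omega>) ^ 4) \<le> 162 * R * sqrt (real n) ^ 4 * (real k / real n)\<^sup>2" if "n > 0" for i k n
  proof -
    have "expectation (\<lambda>\<omega>. (S (i + k) \<omega> - S i \<omega>) ^ 4) \<le> 162 * R * (real k)\<^sup>2"
      by (rule fourth_moment_increment[OF R, of "i + k"]) (use m4_diffusive[OF \<beta>(1-3)] in \<open>auto simp: R_def\<close>)
    also have "\<dots> = 162 * R * sqrt (real n) ^ 4 * (real k / real n)\<^sup>2"
    proof -
      have "sqrt (real n) ^ 4 = (real n)\<^sup>2" using power_mult[of "sqrt (real n)" 2 2] by simp
      then show ?thesis using that by (simp add: power_divide)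
    qed
    finally show ?thesis .
  qed
  then show "\<exists>C\<ge>0. \<forall>c. eventually (\<lambda>n. \<forall>i k. i + k \<le> c * n \<longrightarrow>
      expectation (\<lambda>\<omega>. (S (i + k) \<omega> - S i \<omega>) ^ 4) \<le> C * sqrt (real n) ^ 4 * (real k / real n)\<^sup>2) sequentially"
    using R by (intro exI[of _ "162 * R"]) (auto intro!: eventually_mono[OF eventually_gt_at_top[of 0]])
qed

end

section \<open>The critical regime\<close>

lemma harm_le_ln: "n \<ge> 1 \<Longrightarrow> harm n \<le> 1 + ln (real n)"
proof (induction n rule: dec_induct)
  case base then show ?case by (simp add: harm_expand)
next
  case (step n)
  have n: "real n > 0" using step by simp
  have "ln (real n / real (Suc n)) \<le> real n / real (Suc n) - 1" using n by (intro ln_le_minus_one) auto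
  also have "real n / real (Suc n) - 1 = - inverse (real (Suc n))" by (simp add: field_simps)
  finally have "ln (real n) - ln (real (Suc n)) \<le> - inverse (real (Suc n))"
    using n by (simp add: ln_div)
  then show ?case using step.IH by (simp add: harm_Suc)
qed

context elephant_random_walk
begin

lemma m2_critical: "\<alpha> = 1 / 2 \<Longrightarrow> m2 n = real n * harm n"
proof (induction n)
  case (Suc n)
  show ?case
  proof (cases "n = 0")
    case True then show ?thesis by (simp add: m2_Suc m2_0 harm_expand)
  next
    case False
    then show ?thesis unfolding m2_Suc Suc.IH[OF Suc.prems] using Suc.prems
      by (simp add: harm_Suc field_simps)
  qed
qed (simp add: m2_0)

text \<open>For \<open>\<alpha> = 1 / 2\<close> the homogeneous solution \<open>n * (n + 1)\<close> of the recursion is of the critical order, and the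
second moments \<open>n * harm n\<close> drive it by another harmonic sum. One of the two harmonic factors is frozen
at the final time \<open>N\<close> to keep the induction linear.\<close>

lemma m4_critical:
  assumes \<alpha>: "\<alpha> = 1 / 2" and n: "n \<le> N"
  shows "m4 n \<le> 18 * (harm N)\<^sup>2 * (real n)\<^sup>2"
proof (cases "n = 0")
  case True then show ?thesis by (simp add: m4_0)
next
  case False
  let ?H = "harm N :: real"
  have H1: "?H \<ge> 1" using harm_mono[of 1 N] False n by (simp add: harm_expand)
  have "m4 n \<le> 9 * ?H * harm n * (real n * (real n + 1))" using n
  proof (induction n)
    case (Suc n)
    let ?h = "harm n :: real"
    have h: "?h \<le> ?H" using Suc.prems by (intro harm_mono) simp
    have h0: "?h \<ge> 0" by (rule harm_nonneg)
    show ?case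
    proof (cases "n = 0")
      case True then show ?thesis using H1 by (simp add: m4_Suc m4_0 m2_0 harm_expand)
    next
      case False
      then have n: "real n \<ge> 1" by simp
      have "m4 (Suc n) = m4 n * (1 + 2 / real n) + ?h * (6 * real n + 2) + 1"
        unfolding m4_Suc m2_critical[OF \<alpha>] \<alpha> using n by (simp add: field_simps)
      also have "\<dots> \<le> 9 * ?H * ?h * (real n * (real n + 1)) * (1 + 2 / real n) + ?H * (6 * real n + 2) + ?H * 1"
        using Suc h h0 H1 by (intro add_mono mult_right_mono) auto
      also have "9 * ?H * ?h * (real n * (real n + 1)) * (1 + 2 / real n) = 9 * ?H * ?h * ((real n + 1) * (real n + 2))"
        using n by (simp add: field_simps)
      also have "9 * ?H * ?h * ((real n + 1) * (real n + 2)) + ?H * (6 * real n + 2) + ?H * 1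
          \<le> 9 * ?H * ?h * ((real n + 1) * (real n + 2)) + ?H * (9 * (real n + 2))"
      proof -
        have "?H * (6 * real n + 2) + ?H * 1 = ?H * (6 * real n + 3)" by (simp add: algebra_simps)
        also have "\<dots> \<le> ?H * (9 * (real n + 2))" using H1 by (intro mult_left_mono) auto
        finally show ?thesis by simp
      qed
      also have "\<dots> = 9 * ?H * harm (Suc n) * (real (Suc n) * (real (Suc n) + 1))"
        by (simp add: harm_Suc field_simps)
      finally show ?thesis .
    qed
  qed (simp add: m4_0)
  also have "\<dots> \<le> 9 * ?H * ?H * (real n * (2 * real n))"
    using H1 False n harm_mono[OF n, where ?'a = real] by (intro mult_mono mult_left_mono) (auto simp: harm_nonneg)
  also have "\<dots> = 18 * ?H\<^sup>2 * (real n)\<^sup>2" by (simp add: power2_eq_square)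
  finally show ?thesis .
qed

text \<open>The second moments are exactly \<open>n * harm n\<close>, hence asymptotic to \<open>n * ln n\<close> along all times \<open>n t\<close> alike.
The summability condition of \<open>err2_bound\<close> holds because \<open>harm j\<close> is less than a multiple of \<open>sqrt j\<close>.\<close>

theorem critical_scaling:
  assumes p: "p = 3 / 4"
  shows "erw_scaling M p X u \<epsilon> (\<lambda>n. sqrt (real n * ln (real n))) (\<lambda>t. t) (\<lambda>n t. 2 * (real n * t) powr (1 / 2))"
    and "\<exists>C\<ge>0. \<forall>c. eventually (\<lambda>n. \<forall>i k. i + k \<le> c * n \<longrightarrow>
      expectation (\<lambda>\<omega>. (S (i + k) \<omega> - S i \<omega>) ^ 4) \<le> C * sqrt (real n * ln (real n)) ^ 4 * (real k / real n)\<^sup>2) sequentially"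
proof -
  have \<alpha>: "\<alpha> = 1 / 2" using p by (simp add: \<alpha>_def)
  have nln: "0 \<le> real n * ln (real n)" for n by (cases "n = 0") auto
  show "erw_scaling M p X u \<epsilon> (\<lambda>n. sqrt (real n * ln (real n))) (\<lambda>t. t) (\<lambda>n t. 2 * (real n * t) powr (1 / 2))"
  proof (unfold_locales)
    fix t :: real assume t: "0 \<le> t"
    let ?N = "\<lambda>n. nat \<lfloor>real n * t\<rfloor>"
    have lnlim: "(\<lambda>n. 1 / ln (real n)) \<longlonglongrightarrow> 0" by real_asymp
    show "(\<lambda>n. m2 (?N n) / (sqrt (real n * ln (real n)))\<^sup>2) \<longlonglongrightarrow> t"
    proof (cases "t = 0")
      case True then show ?thesis by (simp add: m2_0)
    next
      case False
      then have t: "t > 0" using t by simp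
      have ev: "eventually (\<lambda>n. n \<ge> 2 \<and> ?N n \<ge> 1) sequentially"
        using filterlim_at_top[THEN iffD1, OF floor_at_top[OF t], rule_format, of 1] eventually_ge_at_top[of 2]
        by eventually_elim auto
      have "(\<lambda>n. harm (?N n) / ln (real n)) \<longlonglongrightarrow> 1"
      proof (rule tendsto_sandwich)
        have "(\<lambda>n. 1 + ln t * (1 / ln (real n))) \<longlonglongrightarrow> 1 + ln t * 0" by (intro tendsto_intros lnlim)
        then show "(\<lambda>n. 1 + ln t * (1 / ln (real n))) \<longlonglongrightarrow> 1" by simp
        have "(\<lambda>n. 1 + (1 + ln t) * (1 / ln (real n))) \<longlonglongrightarrow> 1 + (1 + ln t) * 0" by (intro tendsto_intros lnlim)
        then show "(\<lambda>n. 1 + (1 + ln t) * (1 / ln (real n))) \<longlonglongrightarrow> 1" by simp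
        show "\<forall>\<^sub>F n in sequentially. 1 + ln t * (1 / ln (real n)) \<le> harm (?N n) / ln (real n)"
          using ev
        proof eventually_elim
          case (elim n)
          then have l: "ln (real n) > 0" by simp
          have "ln (real n) + ln t = ln (real n * t)" using elim t by (simp add: ln_mult)
          also have "\<dots> \<le> ln (real (?N n) + 1)"
          proof (rule ln_mono)
            show "real n * t \<le> real (?N n) + 1" by linarith
          qed (use elim t in auto)
          also have "\<dots> \<le> harm (?N n)" by (rule ln_le_harm)
          finally have "(ln (real n) + ln t) / ln (real n) \<le> harm (?N n) / ln (real n)"
            using l by (intro divide_right_mono) auto
          then show ?case using l by (simp add: add_divide_distrib)
        qed
        show "\<forall>\<^sub>F n in sequentially. harm (?N n) / ln (real n) \<le> 1 + (1 + ln t) * (1 / ln (real n))"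
          using ev
        proof eventually_elim
          case (elim n)
          then have l: "ln (real n) > 0" by simp
          have "harm (?N n) \<le> 1 + ln (real (?N n))" using elim by (intro harm_le_ln) auto
          also have "ln (real (?N n)) \<le> ln (real n * t)"
          proof (rule ln_mono)
            show "real (?N n) \<le> real n * t" by (rule floor_le_times) (use t in simp)
            show "0 < real (?N n)" using elim by linarith
          qed
          also have "ln (real n * t) = ln (real n) + ln t" using elim t by (simp add: ln_mult)
          finally have "harm (?N n) / ln (real n) \<le> (1 + (ln (real n) + ln t)) / ln (real n)"
            using l by (intro divide_right_mono) auto
          then show ?case using l by (simp add: add_divide_distrib)
        qed
      qed
      from tendsto_mult[OF floor_ratio_limit[OF less_imp_le[OF t]] this]
      have "(\<lambda>n. real (?N n) / real n * (harm (?N n) / ln (real n))) \<longlonglongrightarrow> t" by simp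
      then show ?thesis using nln by (simp add: m2_critical[OF \<alpha>])
    qed
    have "(\<lambda>n. 2 * sqrt t * sqrt (1 / ln (real n))) \<longlonglongrightarrow> 2 * sqrt t * sqrt 0"
      by (intro tendsto_mult_left tendsto_real_sqrt lnlim)
    then have "(\<lambda>n. 2 * sqrt t * sqrt (1 / ln (real n))) \<longlonglongrightarrow> 0" by simp
    then show "(\<lambda>n. 2 * (real n * t) powr (1 / 2) / sqrt (real n * ln (real n))) \<longlonglongrightarrow> 0"
    proof (rule Lim_transform_eventually)
      show "\<forall>\<^sub>F n in sequentially. 2 * sqrt t * sqrt (1 / ln (real n)) = 2 * (real n * t) powr (1 / 2) / sqrt (real n * ln (real n))"
        using eventually_ge_at_top[of 2]
        by eventually_elim (use t in \<open>simp add: powr_half_sqrt real_sqrt_mult real_sqrt_divide\<close>)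
    qed
    have mle: "m2 j \<le> 2 * real j powr (1 + 1 / 2)" for j
    proof (cases "j = 0")
      case True then show ?thesis by (simp add: m2_0)
    next
      case False
      have "harm j \<le> 1 + ln (real j)" using False by (intro harm_le_ln) simp
      also have "ln (real j) = 2 * ln (sqrt (real j))" using False by (simp add: ln_sqrt)
      also have "ln (sqrt (real j)) \<le> sqrt (real j) - 1" using False by (intro ln_le_minus_one) simp
      finally have "harm j \<le> 2 * sqrt (real j)" by simp
      then have "real j * harm j \<le> real j * (2 * sqrt (real j))" by (intro mult_left_mono) auto
      also have "\<dots> = 2 * real j powr (1 + 1 / 2)" unfolding powr_add using False by (simp add: powr_half_sqrt)
      finally show ?thesis by (simp add: m2_critical[OF \<alpha>])
    qed
    obtain K where K: "K \<ge> 0" "\<And>N. err2 0 N \<le> K * real N powr (2 * (1 / 2))"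
      using err2_bound[of "1 / 2" 2 "1 / 2"] mle \<alpha> by auto
    have "(\<lambda>n. K * t * (1 / ln (real n))) \<longlonglongrightarrow> K * t * 0" by (intro tendsto_intros lnlim)
    then have lim: "(\<lambda>n. K * t * (1 / ln (real n))) \<longlonglongrightarrow> 0" by simp
    show "(\<lambda>n. err2 0 (?N n) / (sqrt (real n * ln (real n)))\<^sup>2) \<longlonglongrightarrow> 0"
    proof (rule Lim_null_comparison[OF _ lim])
      show "\<forall>\<^sub>F n in sequentially. norm (err2 0 (?N n) / (sqrt (real n * ln (real n)))\<^sup>2) \<le> K * t * (1 / ln (real n))"
        using eventually_ge_at_top[of 2]
      proof eventually_elim
        case (elim n)
        have "err2 0 (?N n) \<le> K * (real n * t)"
          using K(2)[of "?N n"] mult_left_mono[OF floor_le_times[OF t, of n] K(1)] by simp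
        then have "err2 0 (?N n) / (real n * ln (real n)) \<le> K * (real n * t) / (real n * ln (real n))"
          using nln by (intro divide_right_mono)
        also have "\<dots> = K * t * (1 / ln (real n))" using elim by (simp add: field_simps)
        finally show ?case using nln[of n] err2_nonneg[of 0 "?N n"] by (simp add: abs_of_nonneg)
      qed
    qed
    fix j n assume j: "j < ?N n"
    have "rho (Suc j) (?N n) \<le> 2 * real (?N n) powr (1 / 2)" by (rule rho_le_powr_simple[OF _ _ j]) (simp_all add: \<alpha>)
    also have "\<dots> \<le> 2 * (real n * t) powr (1 / 2)" using t by (intro mult_left_mono powr_mono2) auto
    finally show "rho (Suc j) (?N n) \<le> 2 * (real n * t) powr (1 / 2)" .
  next
    fix s t :: real assume "0 < s" "s \<le> t"
    then show "(\<lambda>n. rho (nat \<lfloor>real n * s\<rfloor>) (nat \<lfloor>real n * t\<rfloor>)) \<longlonglongrightarrow> (t / s) powr \<alpha>"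
      by (rule rho_floor_limit)
  next
    show "\<forall>\<^sub>F n in sequentially. 0 < sqrt (real n * ln (real n))"
      using eventually_ge_at_top[of 2] by eventually_elim simp
    show "0 \<le> sqrt (real n * ln (real n))" for n using nln by simp
  qed
  have "eventually (\<lambda>n. \<forall>i k. i + k \<le> c * n \<longrightarrow>
      expectation (\<lambda>\<omega>. (S (i + k) \<omega> - S i \<omega>) ^ 4) \<le> 11664 * sqrt (real n * ln (real n)) ^ 4 * (real k / real n)\<^sup>2) sequentially" for c
  proof -
    define c' where "c' = max c 1"
    have "eventually (\<lambda>n. 1 + ln (real c') \<le> ln (real n)) sequentially"
      by (rule filterlim_at_top[THEN iffD1, rule_format]) (rule filterlim_compose[OF ln_at_top filterlim_real_sequentially])
    then show ?thesis using eventually_ge_at_top[of 3]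
    proof eventually_elim
      case (elim n)
      have c': "c' \<ge> 1" "c \<le> c'" by (auto simp: c'_def)
      have "1 \<le> c' * n" using c' elim by (simp add: Suc_le_eq)
      then have "harm (c' * n) \<le> 1 + ln (real (c' * n))" by (rule harm_le_ln)
      also have "\<dots> = 1 + ln (real c') + ln (real n)" using c' elim by (simp add: ln_mult)
      also have "\<dots> \<le> 2 * ln (real n)" using elim by simp
      finally have h: "harm (c' * n) \<le> 2 * ln (real n)" .
      have h1: "1 \<le> (harm (c' * n) :: real)" using harm_mono[of 1 "c' * n", where ?'a = real] \<open>1 \<le> c' * n\<close> by (simp add: harm_expand)
      define R where "R = 18 * (harm (c' * n) :: real)\<^sup>2"
      have R1: "R \<ge> 1" using power_mono[OF h1, of 2] by (simp add: R_def)
      have R2: "R \<le> 72 * (ln (real n))\<^sup>2" using power_mono[OF h, of 2] h1 by (simp add: R_def power_mult_distrib)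
      show ?case
      proof (intro allI impI)
        fix i k assume "i + k \<le> c * n"
        then have ik: "i + k \<le> c' * n" using c' by (meson mult_le_mono1 order_trans)
        have "expectation (\<lambda>\<omega>. (S (i + k) \<omega> - S i \<omega>) ^ 4) \<le> 162 * R * (real k)\<^sup>2"
          by (rule fourth_moment_increment[OF R1 _ ik]) (use m4_critical[OF \<alpha>] in \<open>auto simp: R_def\<close>)
        also have "\<dots> \<le> 162 * (72 * (ln (real n))\<^sup>2) * (real k)\<^sup>2"
          using R2 by (intro mult_right_mono mult_left_mono) auto
        also have "\<dots> = 11664 * sqrt (real n * ln (real n)) ^ 4 * (real k / real n)\<^sup>2"
        proof -
          have "sqrt (real n * ln (real n)) ^ 4 = (real n * ln (real n))\<^sup>2"
            using power_mult[of "sqrt (real n * ln (real n))" 2 2] nln[of n] by simp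
          then show ?thesis using elim by (simp add: power_divide power_mult_distrib)
        qed
        finally show "expectation (\<lambda>\<omega>. (S (i + k) \<omega> - S i \<omega>) ^ 4) \<le> 11664 * sqrt (real n * ln (real n)) ^ 4 * (real k / real n)\<^sup>2" .
      qed
    qed
  qed
  then show "\<exists>C\<ge>0. \<forall>c. eventually (\<lambda>n. \<forall>i k. i + k \<le> c * n \<longrightarrow>
      expectation (\<lambda>\<omega>. (S (i + k) \<omega> - S i \<omega>) ^ 4) \<le> C * sqrt (real n * ln (real n)) ^ 4 * (real k / real n)\<^sup>2) sequentially"
    by (intro exI[of _ 11664]) auto
qed

end

section \<open>The limiting processes\<close>

text \<open>Conditioning on the earlier variables: the last one can be integrated out first, with the earlier ones
frozen.\<close>

lemma (in prob_space) independent_gaussian_step: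
  fixes D :: "nat \<Rightarrow> 'a \<Rightarrow> real" and G :: "(nat \<Rightarrow> real) \<Rightarrow> real \<Rightarrow> real"
  assumes ind: "indep_vars (\<lambda>_. borel) D {..<Suc J}"
    and normal: "distributed M lborel (D J) (normal_density 0 s)" and s: "s > 0"
    and meas: "(\<lambda>z. G (fst z) (snd z)) \<in> borel_measurable (PiM {..<J} (\<lambda>_. borel) \<Otimes>\<^sub>M borel)"
    and B: "\<And>v y. \<bar>G v y\<bar> \<le> B"
  shows "expectation (\<lambda>\<omega>. G (\<lambda>i\<in>{..<J}. D i \<omega>) (D J \<omega>)) =
    expectation (\<lambda>\<omega>. \<integral>y. G (\<lambda>i\<in>{..<J}. D i \<omega>) (s * y) \<partial>gauss)"
proof -
  let ?P = "PiM {..<J} (\<lambda>_. borel :: real measure)"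
  let ?V = "\<lambda>\<omega>. \<lambda>i\<in>{..<J}. D i \<omega>"
  let ?R = "PiM {J} (\<lambda>_. borel :: real measure)"
  let ?W = "\<lambda>\<omega>. \<lambda>i\<in>{J}. D i \<omega>"
  have iv: "indep_var ?P ?V ?R ?W" by (rule indep_var_restrict[OF ind]) auto
  then have rv: "random_variable ?P ?V" "random_variable ?R ?W"
    and eq: "distr M ?P ?V \<Otimes>\<^sub>M distr M ?R ?W = distr M (?P \<Otimes>\<^sub>M ?R) (\<lambda>\<omega>. (?V \<omega>, ?W \<omega>))"
    unfolding indep_var_distribution_eq by auto
  interpret V: prob_space "distr M ?P ?V" by (rule prob_space_distr[OF rv(1)])
  interpret W: prob_space "distr M ?R ?W" by (rule prob_space_distr[OF rv(2)])
  interpret VW: pair_prob_space "distr M ?P ?V" "distr M ?R ?W" ..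
  have mJ: "(\<lambda>w. w J) \<in> borel_measurable ?R" by (rule measurable_component_singleton) simp
  have meas': "(\<lambda>z. G (fst z) (snd z J)) \<in> borel_measurable (?P \<Otimes>\<^sub>M ?R)"
  proof -
    have "(\<lambda>z. (fst z, snd z J)) \<in> measurable (?P \<Otimes>\<^sub>M ?R) (?P \<Otimes>\<^sub>M borel)"
      by (intro measurable_Pair measurable_fst measurable_compose[OF measurable_snd mJ])
    from measurable_compose[OF this meas] show ?thesis by simp
  qed
  have Gv: "(\<lambda>y. G v y) \<in> borel_measurable borel" if "v \<in> space ?P" for v
  proof -
    have "(\<lambda>y. (v, y)) \<in> measurable borel (?P \<Otimes>\<^sub>M borel)" using that by simp
    from measurable_compose[OF this meas] show ?thesis by simp
  qed
  have int: "integrable (distr M ?P ?V \<Otimes>\<^sub>M distr M ?R ?W) (\<lambda>z. G (fst z) (snd z J))"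
    by (rule VW.P.integrable_const_bound[where B = B]) (use B meas' in auto)
  have inner: "(\<integral>w. G v (w J) \<partial>distr M ?R ?W) = (\<integral>y. G v (s * y) \<partial>gauss)" if "v \<in> space ?P" for v
    using expectation_normal[OF normal s Gv[OF that]]
      integral_distr[OF rv(2) measurable_compose[OF mJ Gv[OF that]]] by simp
  have "expectation (\<lambda>\<omega>. G (?V \<omega>) (D J \<omega>)) = (\<integral>z. G (fst z) (snd z J) \<partial>distr M (?P \<Otimes>\<^sub>M ?R) (\<lambda>\<omega>. (?V \<omega>, ?W \<omega>)))"
    by (subst integral_distr[OF measurable_Pair[OF rv] meas']) simp
  also have "\<dots> = (\<integral>z. G (fst z) (snd z J) \<partial>(distr M ?P ?V \<Otimes>\<^sub>M distr M ?R ?W))"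
    by (simp only: eq)
  also have "\<dots> = (\<integral>v. (\<integral>w. G (fst (v, w)) (snd (v, w) J) \<partial>distr M ?R ?W) \<partial>distr M ?P ?V)"
    by (rule VW.integral_fst'[OF int, symmetric])
  also have "\<dots> = (\<integral>v. (\<integral>y. G v (s * y) \<partial>gauss) \<partial>distr M ?P ?V)"
    by (rule Bochner_Integration.integral_cong) (auto simp: inner)
  also have "\<dots> = expectation (\<lambda>\<omega>. \<integral>y. G (?V \<omega>) (s * y) \<partial>gauss)"
  proof (rule integral_distr[OF rv(1)])
    have "(\<lambda>z. G (fst z) (s * snd z)) \<in> borel_measurable (?P \<Otimes>\<^sub>M gauss)"
    proof -
      have "(\<lambda>z. (fst z, s * snd z)) \<in> measurable (?P \<Otimes>\<^sub>M gauss) (?P \<Otimes>\<^sub>M borel)" by measurable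
      from measurable_compose[OF this meas] show ?thesis by simp
    qed
    then show "(\<lambda>v. \<integral>y. G v (s * y) \<partial>gauss) \<in> borel_measurable ?P"
      by (intro gauss.borel_measurable_lebesgue_integral) (simp add: case_prod_beta')
  qed
  finally show ?thesis .
qed

lemma (in standard_brownian_motion) increments_sum:
  assumes "\<omega> \<in> space M" "T 0 = 0"
  shows "(\<Sum>i<j. B (T (Suc i)) \<omega> - B (T i) \<omega>) = B (T j) \<omega>"
  by (induction j) (use assms starts_at_zero in auto)

context erw_scaling
begin

text \<open>At the time \<open>t (Suc J)\<close> the process is its value at \<open>t J\<close> multiplied by the ratio of the two prefactors,
plus an independent increment of the Brownian motion. The variances agree because
\<open>2 * \<alpha> + (3 - 4 * p) = 1\<close>.\<close>

lemma time_changed_bm_markov: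
  assumes bm: "standard_brownian_motion P B" and p: "p < 3 / 4" and V: "V = (\<lambda>t. t / (3 - 4 * p))"
    and t0: "t 0 = 0" and tmono: "\<And>j. t j < t (Suc j)"
    and g: "prefix_lipschitz (Suc J) L g" and gB: "\<And>x. \<bar>g x\<bar> \<le> C"
  shows "(\<integral>\<omega>. g (\<lambda>j. time_changed_bm p B (t j) \<omega>) \<partial>P) = (\<integral>\<omega>. kernel t J g (\<lambda>j. time_changed_bm p B (t j) \<omega>) \<partial>P)"
proof -
  interpret bm: standard_brownian_motion P B by (rule bm)
  define \<gamma> where "\<gamma> = 3 - 4 * p"
  have \<gamma>: "\<gamma> > 0" using p by (simp add: \<gamma>_def)
  have \<alpha>\<gamma>: "2 * \<alpha> + \<gamma> = 1" by (simp add: \<alpha>_def \<gamma>_def)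
  have tnn: "0 \<le> t j" for j
    by (induction j) (use t0 tmono in \<open>auto intro: order.trans less_imp_le\<close>)
  have tpos: "0 < t (Suc j)" for j using tnn[of j] tmono[of j] by simp
  define T where "T j = t j powr \<gamma>" for j
  define a where "a j = t j powr \<alpha> / sqrt \<gamma>" for j
  define D where "D i \<omega> = B (T (Suc i)) \<omega> - B (T i) \<omega>" for i \<omega>
  have T0: "T 0 = 0" by (simp add: T_def t0)
  have Tmono: "T j < T (Suc j)" for j unfolding T_def by (intro powr_less_mono2 \<gamma> tmono tnn)
  have Tnn: "0 \<le> T j" for j by (simp add: T_def)
  define s where "s = sqrt (T (Suc J) - T J)"
  have s: "s > 0" using Tmono[of J] by (simp add: s_def)
  have tc: "time_changed_bm p B (t j) \<omega> = a j * (\<Sum>i<j. D i \<omega>)" if "\<omega> \<in> space P" for j \<omega>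
  proof (cases j)
    case 0 then show ?thesis by (simp add: time_changed_bm_def t0)
  next
    case (Suc j')
    then have "t j \<noteq> 0" using tpos[of j'] by simp
    then show ?thesis
      unfolding D_def bm.increments_sum[of \<omega> T, OF that T0]
      by (simp add: time_changed_bm_def a_def T_def \<gamma>_def \<alpha>_def)
  qed
  let ?r = "ratio (t J) (t (Suc J))"
  have ra: "?r * (a J * x) = a (Suc J) * x" if "J = 0 \<longrightarrow> x = 0" for x
  proof (cases "J = 0")
    case True then show ?thesis using that by simp
  next
    case False
    then have "t J > 0" using tpos[of "J - 1"] by simp
    then show ?thesis using tnn by (simp add: ratio_def a_def powr_divide)
  qed
  have noise: "noise (t J) (t (Suc J)) = a (Suc J) * s"
  proof -
    have "V (t (Suc J)) - ?r\<^sup>2 * V (t J) = (a (Suc J) * s)\<^sup>2"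
    proof -
      have sq: "(x powr \<alpha>)\<^sup>2 = x powr (2 * \<alpha>)" for x :: real by (simp add: power2_eq_square flip: powr_add)
      have 1: "x powr (2 * \<alpha>) * x powr \<gamma> = x" if "x \<ge> 0" for x
        using that by (simp add: \<alpha>\<gamma> flip: powr_add)
      have "(a (Suc J) * s)\<^sup>2 = t (Suc J) powr (2 * \<alpha>) * (T (Suc J) - T J) / \<gamma>"
        using \<gamma> Tmono[of J] by (simp add: a_def s_def power_mult_distrib power_divide sq)
      also have "\<dots> = (t (Suc J) - t (Suc J) powr (2 * \<alpha>) * t J powr \<gamma>) / \<gamma>"
        unfolding T_def right_diff_distrib 1[OF tnn] ..
      also have "t (Suc J) powr (2 * \<alpha>) * t J powr \<gamma> = ?r\<^sup>2 * t J"
      proof (cases "t J = 0")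
        case True then show ?thesis by simp
      next
        case False
        then have tJ: "t J > 0" using tnn[of J] by simp
        have "?r\<^sup>2 * t J = (t (Suc J) / t J) powr (2 * \<alpha>) * (t J powr (2 * \<alpha>) * t J powr \<gamma>)"
          unfolding ratio_def sq 1[OF tnn] ..
        also have "\<dots> = t (Suc J) powr (2 * \<alpha>) * t J powr \<gamma>"
          using tJ tnn by (simp add: powr_divide)
        finally show ?thesis by simp
      qed
      finally show ?thesis unfolding V \<gamma>_def[symmetric] by (simp add: diff_divide_distrib)
    qed
    then show ?thesis using s unfolding noise_def by (simp add: a_def \<gamma> less_imp_le)
  qed
  define G where "G v y = g (\<lambda>j. if j \<le> J then a j * (\<Sum>i<j. v i) else a (Suc J) * (\<Sum>i<J. v i) + a (Suc J) * y)" for v y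
  have vsum: "(\<Sum>i<j. (\<lambda>i\<in>{..<J}. D i \<omega>) i) = (\<Sum>i<j. D i \<omega>)" if "j \<le> J" for j \<omega>
    using that by (intro sum.cong) auto
  have "(\<integral>\<omega>. g (\<lambda>j. time_changed_bm p B (t j) \<omega>) \<partial>P) = (\<integral>\<omega>. G (\<lambda>i\<in>{..<J}. D i \<omega>) (D J \<omega>) \<partial>P)"
  proof (rule Bochner_Integration.integral_cong[OF refl])
    fix \<omega> assume \<omega>: "\<omega> \<in> space P"
    show "g (\<lambda>j. time_changed_bm p B (t j) \<omega>) = G (\<lambda>i\<in>{..<J}. D i \<omega>) (D J \<omega>)"
      unfolding G_def
    proof (rule prefix_lipschitz_cong[OF g])
      fix j assume "j \<le> Suc J"
      then consider "j \<le> J" | "j = Suc J" by linarith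
      then show "time_changed_bm p B (t j) \<omega> = (if j \<le> J then a j * (\<Sum>i<j. (\<lambda>i\<in>{..<J}. D i \<omega>) i)
          else a (Suc J) * (\<Sum>i<J. (\<lambda>i\<in>{..<J}. D i \<omega>) i) + a (Suc J) * D J \<omega>)"
        by cases (simp_all add: tc[OF \<omega>] vsum distrib_left del: restrict_apply)
    qed
  qed
  also have "\<dots> = (\<integral>\<omega>. (\<integral>y. G (\<lambda>i\<in>{..<J}. D i \<omega>) (s * y) \<partial>gauss) \<partial>P)"
  proof (rule bm.independent_gaussian_step[OF _ _ s])
    show "bm.indep_vars (\<lambda>_. borel) D {..<Suc J}"
      unfolding D_def[abs_def] by (rule bm.independent_increments) (use Tnn Tmono less_imp_le in auto)
    show "distributed P lborel (D J) (normal_density 0 s)"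
      unfolding D_def[abs_def] s_def by (rule bm.normal_increments[OF Tnn Tmono])
    show "\<bar>G v y\<bar> \<le> C" for v y unfolding G_def by (rule gB)
    show "(\<lambda>z. G (fst z) (snd z)) \<in> borel_measurable (PiM {..<J} (\<lambda>_. borel) \<Otimes>\<^sub>M borel)"
      unfolding G_def
    proof (rule prefix_lipschitz_measurable[OF g])
      fix j assume "j \<le> Suc J"
      have [measurable]: "(\<lambda>z. fst z i) \<in> borel_measurable (PiM {..<J} (\<lambda>_. borel :: real measure) \<Otimes>\<^sub>M (borel :: real measure))" if "i < J" for i
        by (rule measurable_compose[OF measurable_fst measurable_component_singleton]) (use that in simp)
      have sm: "(\<lambda>z. \<Sum>i<k. fst z i) \<in> borel_measurable (PiM {..<J} (\<lambda>_. borel :: real measure) \<Otimes>\<^sub>M (borel :: real measure))" if "k \<le> J" for k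
        using that by (intro borel_measurable_sum) auto
      show "(\<lambda>z. if j \<le> J then a j * (\<Sum>i<j. fst z i) else a (Suc J) * (\<Sum>i<J. fst z i) + a (Suc J) * snd z)
        \<in> borel_measurable (PiM {..<J} (\<lambda>_. borel) \<Otimes>\<^sub>M borel)"
        using sm[of j] sm[of J] by (cases "j \<le> J") auto
    qed
  qed
  also have "\<dots> = (\<integral>\<omega>. kernel t J g (\<lambda>j. time_changed_bm p B (t j) \<omega>) \<partial>P)"
  proof (rule Bochner_Integration.integral_cong[OF refl])
    fix \<omega> assume \<omega>: "\<omega> \<in> space P"
    have "G (\<lambda>i\<in>{..<J}. D i \<omega>) (s * y) =
      g ((\<lambda>j. time_changed_bm p B (t j) \<omega>)(Suc J := ?r * time_changed_bm p B (t J) \<omega> + noise (t J) (t (Suc J)) * y))" for y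
      unfolding G_def
    proof (rule prefix_lipschitz_cong[OF g])
      fix j assume "j \<le> Suc J"
      then consider "j \<le> J" | "j = Suc J" by linarith
      then show "(if j \<le> J then a j * (\<Sum>i<j. (\<lambda>i\<in>{..<J}. D i \<omega>) i)
          else a (Suc J) * (\<Sum>i<J. (\<lambda>i\<in>{..<J}. D i \<omega>) i) + a (Suc J) * (s * y)) =
        ((\<lambda>j. time_changed_bm p B (t j) \<omega>)(Suc J := ?r * time_changed_bm p B (t J) \<omega> + noise (t J) (t (Suc J)) * y)) j"
        by cases (simp_all add: tc[OF \<omega>] vsum ra noise mult.assoc del: restrict_apply)
    qed
    then show "(\<integral>y. G (\<lambda>i\<in>{..<J}. D i \<omega>) (s * y) \<partial>gauss) = kernel t J g (\<lambda>j. time_changed_bm p B (t j) \<omega>)"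
      by (simp add: kernel_def)
  qed
  finally show ?thesis .
qed

text \<open>All the randomness enters in the step away from time 0; afterwards the noise vanishes and the ratios
\<open>sqrt (t (Suc J) / t J)\<close> move the value along deterministically.\<close>

lemma sqrt_markov:
  assumes bm: "standard_brownian_motion P B" and p: "p = 3 / 4" and V: "V = (\<lambda>t. t)"
    and t0: "t 0 = 0" and tmono: "\<And>j. t j < t (Suc j)"
    and g: "prefix_lipschitz (Suc J) L g" and gB: "\<And>x. \<bar>g x\<bar> \<le> C"
  shows "(\<integral>\<omega>. g (\<lambda>j. sqrt (t j) * B 1 \<omega>) \<partial>P) = (\<integral>\<omega>. kernel t J g (\<lambda>j. sqrt (t j) * B 1 \<omega>) \<partial>P)"
proof -
  interpret bm: standard_brownian_motion P B by (rule bm)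
  have \<alpha>: "\<alpha> = 1 / 2" using p by (simp add: \<alpha>_def)
  have tnn: "0 \<le> t j" for j
    by (induction j) (use t0 tmono in \<open>auto intro: order.trans less_imp_le\<close>)
  have r: "ratio (t J) (t (Suc J)) = sqrt (t (Suc J) / t J)"
    unfolding ratio_def \<alpha> using tnn by (intro powr_half_sqrt) simp
  show ?thesis
  proof (cases "J = 0")
    case True
    have r0: "ratio (t J) (t (Suc J)) = 0" using r True t0 by simp
    have n0: "noise (t J) (t (Suc J)) = sqrt (t 1)" unfolding noise_def r0 using True t0 by (simp add: V)
    let ?h = "\<lambda>y. g (\<lambda>j. if j = 0 then 0 else sqrt (t 1) * y)"
    have h: "?h \<in> borel_measurable borel"
    proof (rule prefix_lipschitz_measurable[OF g])
      fix j show "(\<lambda>y. if j = 0 then 0 else sqrt (t 1) * y) \<in> borel_measurable borel" by (cases "j = 0") auto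
    qed
    have "distributed P lborel (\<lambda>\<omega>. B 1 \<omega> - B 0 \<omega>) (normal_density 0 1)"
      using bm.normal_increments[of 0 1] by simp
    from bm.expectation_normal[OF this _ h]
    have E: "bm.expectation (\<lambda>\<omega>. ?h (B 1 \<omega> - B 0 \<omega>)) = (\<integral>y. ?h y \<partial>gauss)"
      unfolding mult_1 by simp
    have "(\<integral>\<omega>. g (\<lambda>j. sqrt (t j) * B 1 \<omega>) \<partial>P) = bm.expectation (\<lambda>\<omega>. ?h (B 1 \<omega> - B 0 \<omega>))"
    proof (rule Bochner_Integration.integral_cong[OF refl])
      fix \<omega> assume \<omega>: "\<omega> \<in> space P"
      show "g (\<lambda>j. sqrt (t j) * B 1 \<omega>) = ?h (B 1 \<omega> - B 0 \<omega>)"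
        by (rule prefix_lipschitz_cong[OF g]) (use True t0 bm.starts_at_zero[OF \<omega>] in \<open>auto simp: le_Suc_eq\<close>)
    qed
    also have "\<dots> = bm.expectation (\<lambda>\<omega>. (\<integral>y. ?h y \<partial>gauss))" using E bm.prob_space by simp
    also have "\<dots> = (\<integral>\<omega>. kernel t J g (\<lambda>j. sqrt (t j) * B 1 \<omega>) \<partial>P)"
    proof (rule Bochner_Integration.integral_cong[OF refl])
      fix \<omega>
      have "?h y = g ((\<lambda>j. sqrt (t j) * B 1 \<omega>)(Suc J := ratio (t J) (t (Suc J)) * (sqrt (t J) * B 1 \<omega>) + noise (t J) (t (Suc J)) * y))" for y
        unfolding r0 n0 by (rule prefix_lipschitz_cong[OF g]) (use True t0 in \<open>auto simp: le_Suc_eq\<close>)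
      then show "(\<integral>y. ?h y \<partial>gauss) = kernel t J g (\<lambda>j. sqrt (t j) * B 1 \<omega>)" by (simp add: kernel_def)
    qed
    finally show ?thesis .
  next
    case False
    then have tJ: "t J > 0" using tmono[of "J - 1"] tnn[of "J - 1"] by simp
    have n0: "noise (t J) (t (Suc J)) = 0" unfolding noise_def r using tJ tnn by (simp add: V)
    have "g (\<lambda>j. sqrt (t j) * B 1 \<omega>) = kernel t J g (\<lambda>j. sqrt (t j) * B 1 \<omega>)" for \<omega>
    proof -
      have "sqrt (t (Suc J) / t J) * (sqrt (t J) * B 1 \<omega>) = sqrt (t (Suc J)) * B 1 \<omega>"
        using tJ by (simp add: real_sqrt_divide)
      then have "(\<lambda>j. sqrt (t j) * B 1 \<omega>)(Suc J := sqrt (t (Suc J) / t J) * (sqrt (t J) * B 1 \<omega>)) = (\<lambda>j. sqrt (t j) * B 1 \<omega>)"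
        by (simp only:) (rule fun_upd_triv)
      then show ?thesis using gauss.prob_space by (simp add: kernel_def n0 r)
    qed
    then show ?thesis by simp
  qed
qed

end

section \<open>The two limit theorems\<close>

text \<open>The path is monotone and starts at 0.\<close>

lemma Osc_sqrt:
  assumes t: "t \<ge> 0" shows "Osc t (\<lambda>s. sqrt s * c) = sqrt t * \<bar>c\<bar>"
proof (cases "c \<ge> 0")
  case True
  have "Sup ((\<lambda>s. sqrt s * c) ` {0..t}) = sqrt t * c"
    by (rule cSup_eq_maximum) (use t True in \<open>auto intro: mult_right_mono\<close>)
  moreover have "Inf ((\<lambda>s. sqrt s * c) ` {0..t}) = 0"
  proof (rule cInf_eq_minimum)
    show "0 \<in> (\<lambda>s. sqrt s * c) ` {0..t}" using t by (intro image_eqI[of _ _ 0]) auto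
  qed (use True in auto)
  ultimately show ?thesis using True by (simp add: Osc_def)
next
  case False
  have "Inf ((\<lambda>s. sqrt s * c) ` {0..t}) = sqrt t * c"
    by (rule cInf_eq_minimum) (use t False in \<open>auto intro: mult_right_mono_neg\<close>)
  moreover have "Sup ((\<lambda>s. sqrt s * c) ` {0..t}) = 0"
  proof (rule cSup_eq_maximum)
    show "0 \<in> (\<lambda>s. sqrt s * c) ` {0..t}" using t by (intro image_eqI[of _ _ 0]) auto
  qed (use False in \<open>auto intro: mult_nonneg_nonpos\<close>)
  ultimately show ?thesis using False by (simp add: Osc_def)
qed

context noise_reinforced_brownian_motion
begin

lemma same_marginals:
  assumes g: "prefix_lipschitz J L g" and t: "\<And>j. t j \<ge> 0"
  shows "(\<integral>\<omega>. g (\<lambda>j. Z (t j) \<omega>) \<partial>N) = (\<integral>\<omega>. g (\<lambda>j. time_changed_bm p B (t j) \<omega>) \<partial>M)"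
proof -
  let ?P = "\<Pi>\<^sub>M t\<in>{0..}. (borel :: real measure)"
  let ?G = "\<lambda>f. g (\<lambda>j. f (t j))"
  have G: "?G \<in> borel_measurable ?P"
    by (rule prefix_lipschitz_measurable[OF g, of "\<lambda>j f. f (t j)"]) (use t in simp)
  have mZ: "(\<lambda>\<omega>. \<lambda>t\<in>{0..}. Z t \<omega>) \<in> measurable N ?P"
    by (rule measurable_restrict) (use random_variable in auto)
  have mB: "(\<lambda>\<omega>. \<lambda>t\<in>{0..}. time_changed_bm p B t \<omega>) \<in> measurable M ?P"
  proof (rule measurable_restrict)
    fix s :: real assume "s \<in> {0..}"
    show "time_changed_bm p B s \<in> borel_measurable M"
      using bm.random_variable[of "s powr (3 - 4 * p)"]
      by (cases "s = 0") (simp_all add: time_changed_bm_def[abs_def])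
  qed
  have "(\<integral>\<omega>. g (\<lambda>j. Z (t j) \<omega>) \<partial>N) = (\<integral>\<omega>. ?G (\<lambda>t\<in>{0..}. Z t \<omega>) \<partial>N)" using t by simp
  also have "\<dots> = (\<integral>f. ?G f \<partial>distr N ?P (\<lambda>\<omega>. \<lambda>t\<in>{0..}. Z t \<omega>))" by (rule integral_distr[OF mZ G, symmetric])
  also have "\<dots> = (\<integral>f. ?G f \<partial>distr M ?P (\<lambda>\<omega>. \<lambda>t\<in>{0..}. time_changed_bm p B t \<omega>))" by (simp only: same_law)
  also have "\<dots> = (\<integral>\<omega>. ?G (\<lambda>t\<in>{0..}. time_changed_bm p B t \<omega>) \<partial>M)" by (rule integral_distr[OF mB G])
  also have "\<dots> = (\<integral>\<omega>. g (\<lambda>j. time_changed_bm p B (t j) \<omega>) \<partial>M)" using t by simp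
  finally show ?thesis .
qed

end

lemma increasing_times_nonneg:
  fixes t :: "nat \<Rightarrow> real"
  assumes "t 0 = 0" "\<And>j. t j < t (Suc j)" shows "0 \<le> t j"
  by (induction j) (use assms in \<open>auto intro: order.trans less_imp_le\<close>)

text \<open>The values of a Lipschitz functional at the range process and at the oscillation of the rescaled walk
(plus \<open>1 / b n\<close>) coincide, so the functional limit theorem for the walk applies.\<close>

theorem (in erw_scaling) range_convergence:
  fixes Q :: "'q measure" and Z :: "real \<Rightarrow> 'q \<Rightarrow> real"
  assumes C: "\<exists>C\<ge>0. \<forall>c. eventually (\<lambda>n. \<forall>i k. i + k \<le> c * n \<longrightarrow>
      expectation (\<lambda>\<omega>. (S (i + k) \<omega> - S i \<omega>) ^ 4) \<le> C * (b n) ^ 4 * (real k / real n)\<^sup>2) sequentially"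
    and binf: "(\<lambda>n. 1 / b n) \<longlonglongrightarrow> 0"
    and Q: "prob_space Q"
    and Zm: "\<And>t. t \<ge> 0 \<Longrightarrow> Z t \<in> borel_measurable Q"
    and Zc: "\<And>\<omega>. \<omega> \<in> space Q \<Longrightarrow> continuous_on {0..} (\<lambda>t. Z t \<omega>)"
    and start: "\<And>t L g. t 0 = 0 \<Longrightarrow> (\<And>j. t j < t (Suc j)) \<Longrightarrow> prefix_lipschitz 0 L g \<Longrightarrow>
      (\<integral>\<omega>. g (\<lambda>j. Z (t j) \<omega>) \<partial>Q) = g (\<lambda>_. 0)"
    and markov: "\<And>t J L g B. t 0 = 0 \<Longrightarrow> (\<And>j. t j < t (Suc j)) \<Longrightarrow> prefix_lipschitz (Suc J) L g \<Longrightarrow> (\<And>x. \<bar>g x\<bar> \<le> B) \<Longrightarrow>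
      (\<integral>\<omega>. g (\<lambda>j. Z (t j) \<omega>) \<partial>Q) = (\<integral>\<omega>. kernel t J g (\<lambda>j. Z (t j) \<omega>) \<partial>Q)"
  shows "converges_in_distribution skorokhod_topology
    M (\<lambda>n \<omega>. \<lambda>t\<in>{0..}. real (card (walk_range X (nat \<lfloor>real n * t\<rfloor>) \<omega>)) / b n)
    Q (\<lambda>\<omega>. \<lambda>t\<in>{0..}. Osc t (\<lambda>s. Z s \<omega>))"
proof (rule converges_in_distribution_skorokhodI[OF prob_space_axioms Q])
  fix n \<omega> 
  show "(\<lambda>t\<in>{0..}. real (card (walk_range X (nat \<lfloor>real n * t\<rfloor>) \<omega>)) / b n) \<in> cadlag_paths"
    by (rule step_function_cadlag)
next
  fix \<omega> assume "\<omega> \<in> space Q"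
  then show "(\<lambda>t\<in>{0..}. Osc t (\<lambda>s. Z s \<omega>)) \<in> cadlag_paths"
    by (intro continuous_restrict_cadlag continuous_on_Osc Zc)
next
  fix F K assume F: "path_lipschitz K F"
  have eqX: "F (\<lambda>t\<in>{0..}. real (card (walk_range X (nat \<lfloor>real n * t\<rfloor>) \<omega>)) / b n) =
    F (\<lambda>t. Osc t (\<lambda>s. S (nat \<lfloor>real n * s\<rfloor>) \<omega> / b n) + 1 / b n)" if \<omega>: "\<omega> \<in> space M" for n \<omega>
  proof (rule path_lipschitz_cong[OF F])
    fix t :: real assume t: "t \<ge> 0"
    have "\<bar>walk X (Suc k) \<omega> - walk X k \<omega>\<bar> \<le> 1" for k
      using X_range[of "Suc k" \<omega>] \<omega> by (auto simp: walk_def)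
    from card_range_eq_Osc[of "\<lambda>k. walk X k \<omega>" t "b n" n, OF this t b_nonneg]
    show "(\<lambda>t\<in>{0..}. real (card (walk_range X (nat \<lfloor>real n * t\<rfloor>) \<omega>)) / b n) t =
      Osc t (\<lambda>s. S (nat \<lfloor>real n * s\<rfloor>) \<omega> / b n) + 1 / b n"
      using t by (simp add: walk_range_def)
  qed
  have eqY: "F (\<lambda>t\<in>{0..}. Osc t (\<lambda>s. Z s \<omega>)) = F (\<lambda>t. Osc t (\<lambda>s. Z s \<omega>))" for \<omega>
    by (rule path_lipschitz_cong[OF F]) simp
  show "(\<lambda>\<omega>. F (\<lambda>t\<in>{0..}. Osc t (\<lambda>s. Z s \<omega>))) \<in> borel_measurable Q"
    unfolding eqY by (rule continuous_Osc_measurable[OF F Zm Zc])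
  show "(\<lambda>\<omega>. F (\<lambda>t\<in>{0..}. real (card (walk_range X (nat \<lfloor>real n * t\<rfloor>) \<omega>)) / b n)) \<in> borel_measurable M" for n
  proof -
    have "(\<lambda>\<omega>. F (\<lambda>t. Osc t (\<lambda>s. S (nat \<lfloor>real n * s\<rfloor>) \<omega> / b n) + 1 / b n)) \<in> borel_measurable M"
      using step_Osc_measurable[OF F, of "\<lambda>k \<omega>. S k \<omega> / b n" M n "1 / b n"] by simp
    then show ?thesis using eqX by (simp cong: measurable_cong)
  qed
  obtain C where C': "C \<ge> 0" "\<And>c. eventually (\<lambda>n. \<forall>i k. i + k \<le> c * n \<longrightarrow>
      expectation (\<lambda>\<omega>. (S (i + k) \<omega> - S i \<omega>) ^ 4) \<le> C * (b n) ^ 4 * (real k / real n)\<^sup>2) sequentially"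
    using C by blast
  have "(\<lambda>n. expectation (\<lambda>\<omega>. F (\<lambda>t. Osc t (\<lambda>s. S (nat \<lfloor>real n * s\<rfloor>) \<omega> / b n) + 1 / b n))) \<longlonglongrightarrow>
    (\<integral>\<omega>. F (\<lambda>t. Osc t (\<lambda>s. Z s \<omega>)) \<partial>Q)"
    by (rule range_functional_convergence[OF C' binf Q Zm Zc start markov F])
  also have "(\<lambda>n. expectation (\<lambda>\<omega>. F (\<lambda>t. Osc t (\<lambda>s. S (nat \<lfloor>real n * s\<rfloor>) \<omega> / b n) + 1 / b n))) =
    (\<lambda>n. expectation (\<lambda>\<omega>. F (\<lambda>t\<in>{0..}. real (card (walk_range X (nat \<lfloor>real n * t\<rfloor>) \<omega>)) / b n)))"
    by (intro ext Bochner_Integration.integral_cong refl) (simp add: eqX)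
  finally show "(\<lambda>n. expectation (\<lambda>\<omega>. F (\<lambda>t\<in>{0..}. real (card (walk_range X (nat \<lfloor>real n * t\<rfloor>) \<omega>)) / b n))) \<longlonglongrightarrow>
    (\<integral>\<omega>. F (\<lambda>t\<in>{0..}. Osc t (\<lambda>s. Z s \<omega>)) \<partial>Q)"
    unfolding eqY .
qed

theorem corollary3p11:
  fixes M :: "'a measure" and p :: real
    and X :: "nat \<Rightarrow> 'a \<Rightarrow> int" and u :: "nat \<Rightarrow> 'a \<Rightarrow> nat" and \<epsilon> :: "nat \<Rightarrow> 'a \<Rightarrow> int"
    and P :: "'b measure" and B :: "real \<Rightarrow> 'b \<Rightarrow> real"
  assumes "elephant_random_walk M p X u \<epsilon>"
    and "standard_brownian_motion P B"
  shows "(p < 3 / 4 \<longrightarrow>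
      (\<forall>(N :: 'c measure) Bhat. noise_reinforced_brownian_motion P B N p Bhat \<longrightarrow>
        converges_in_distribution skorokhod_topology
          M (\<lambda>n \<omega>. \<lambda>t\<in>{0..}. real (card (walk_range X (nat \<lfloor>real n * t\<rfloor>) \<omega>)) / sqrt (real n))
          N (\<lambda>\<omega>. \<lambda>t\<in>{0..}. Osc t (\<lambda>s. Bhat s \<omega>)))) \<and>
    (p = 3 / 4 \<longrightarrow>
        converges_in_distribution skorokhod_topology
          M (\<lambda>n \<omega>. \<lambda>t\<in>{0..}. real (card (walk_range X (nat \<lfloor>real n * t\<rfloor>) \<omega>)) / sqrt (real n * ln (real n)))
          P (\<lambda>\<omega>. \<lambda>t\<in>{0..}. sqrt t * \<bar>B 1 \<omega>\<bar>))"
proof (intro conjI impI allI)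
  fix N :: "'c measure" and Bhat
  assume p: "p < 3 / 4" and nr: "noise_reinforced_brownian_motion P B N p Bhat"
  interpret erw: elephant_random_walk M p X u \<epsilon> by (rule assms(1))
  interpret nr: noise_reinforced_brownian_motion P B N p Bhat by (rule nr)
  interpret sc: erw_scaling M p X u \<epsilon> "\<lambda>n. sqrt (real n)" "\<lambda>t. t / (3 - 4 * p)"
    "\<lambda>n t. 2 * (real n * t) powr max erw.\<alpha> (1 / 4)"
    by (rule erw.diffusive_scaling(1)[OF p])
  have same: "(\<integral>\<omega>. g (\<lambda>j. Bhat (t j) \<omega>) \<partial>N) = (\<integral>\<omega>. g (\<lambda>j. time_changed_bm p B (t j) \<omega>) \<partial>P)"
    if "prefix_lipschitz J L g" "t 0 = 0" "\<And>j. t j < t (Suc j)" for J L g t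
    by (rule nr.same_marginals[OF that(1) increasing_times_nonneg[OF that(2,3)]])
  show "converges_in_distribution skorokhod_topology
      M (\<lambda>n \<omega>. \<lambda>t\<in>{0..}. real (card (walk_range X (nat \<lfloor>real n * t\<rfloor>) \<omega>)) / sqrt (real n))
      N (\<lambda>\<omega>. \<lambda>t\<in>{0..}. Osc t (\<lambda>s. Bhat s \<omega>))"
  proof (rule sc.range_convergence[OF erw.diffusive_scaling(2)[OF p]])
    show "(\<lambda>n. 1 / sqrt (real n)) \<longlonglongrightarrow> 0" by real_asymp
    show "prob_space N" by (rule nr.prob_space_axioms)
    show "Bhat t \<in> borel_measurable N" if "t \<ge> 0" for t by (rule nr.random_variable[OF that])
    show "continuous_on {0..} (\<lambda>t. Bhat t \<omega>)" if "\<omega> \<in> space N" for \<omega> by (rule nr.continuous_paths[OF that])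
  next
    fix t :: "nat \<Rightarrow> real" and L and g :: "(nat \<Rightarrow> real) \<Rightarrow> real"
    assume t: "t 0 = 0" "\<And>j. t j < t (Suc j)" and g: "prefix_lipschitz 0 L g"
    have "g (\<lambda>j. time_changed_bm p B (t j) \<omega>) = g (\<lambda>_. 0)" for \<omega>
      by (rule prefix_lipschitz_cong[OF g]) (simp add: t time_changed_bm_def)
    then show "(\<integral>\<omega>. g (\<lambda>j. Bhat (t j) \<omega>) \<partial>N) = g (\<lambda>_. 0)"
      using same[OF g t] nr.bm.prob_space by simp
  next
    fix t :: "nat \<Rightarrow> real" and J L C and g :: "(nat \<Rightarrow> real) \<Rightarrow> real"
    assume t: "t 0 = 0" "\<And>j. t j < t (Suc j)" and g: "prefix_lipschitz (Suc J) L g" "\<And>x. \<bar>g x\<bar> \<le> C"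
    have "(\<integral>\<omega>. g (\<lambda>j. Bhat (t j) \<omega>) \<partial>N) = (\<integral>\<omega>. g (\<lambda>j. time_changed_bm p B (t j) \<omega>) \<partial>P)"
      by (rule same[OF g(1) t])
    also have "\<dots> = (\<integral>\<omega>. sc.kernel t J g (\<lambda>j. time_changed_bm p B (t j) \<omega>) \<partial>P)"
      by (rule sc.time_changed_bm_markov[OF assms(2) p refl t g])
    also have "\<dots> = (\<integral>\<omega>. sc.kernel t J g (\<lambda>j. Bhat (t j) \<omega>) \<partial>N)"
      by (rule same[OF sc.kernel_lipschitz[OF g] t, symmetric])
    finally show "(\<integral>\<omega>. g (\<lambda>j. Bhat (t j) \<omega>) \<partial>N) = (\<integral>\<omega>. sc.kernel t J g (\<lambda>j. Bhat (t j) \<omega>) \<partial>N)" .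
  qed
next
  assume p: "p = 3 / 4"
  interpret erw: elephant_random_walk M p X u \<epsilon> by (rule assms(1))
  interpret bm: standard_brownian_motion P B by (rule assms(2))
  interpret sc: erw_scaling M p X u \<epsilon> "\<lambda>n. sqrt (real n * ln (real n))" "\<lambda>t. t" "\<lambda>n t. 2 * (real n * t) powr (1 / 2)"
    by (rule erw.critical_scaling(1)[OF p])
  have "converges_in_distribution skorokhod_topology
      M (\<lambda>n \<omega>. \<lambda>t\<in>{0..}. real (card (walk_range X (nat \<lfloor>real n * t\<rfloor>) \<omega>)) / sqrt (real n * ln (real n)))
      P (\<lambda>\<omega>. \<lambda>t\<in>{0..}. Osc t (\<lambda>s. sqrt s * B 1 \<omega>))"
  proof (rule sc.range_convergence[OF erw.critical_scaling(2)[OF p]])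
    show "(\<lambda>n. 1 / sqrt (real n * ln (real n))) \<longlonglongrightarrow> 0" by real_asymp
    show "prob_space P" by (rule bm.prob_space_axioms)
    show "(\<lambda>\<omega>. sqrt t * B 1 \<omega>) \<in> borel_measurable P" if "t \<ge> 0" for t
      using bm.random_variable[of 1] by simp
    show "continuous_on {0..} (\<lambda>t. sqrt t * B 1 \<omega>)" if "\<omega> \<in> space P" for \<omega>
      by (intro continuous_intros)
  next
    fix t :: "nat \<Rightarrow> real" and L and g :: "(nat \<Rightarrow> real) \<Rightarrow> real"
    assume t: "t 0 = 0" and g: "prefix_lipschitz 0 L g"
    have "g (\<lambda>j. sqrt (t j) * B 1 \<omega>) = g (\<lambda>_. 0)" for \<omega>
      by (rule prefix_lipschitz_cong[OF g]) (simp add: t)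
    then show "(\<integral>\<omega>. g (\<lambda>j. sqrt (t j) * B 1 \<omega>) \<partial>P) = g (\<lambda>_. 0)" using bm.prob_space by simp
  next
    fix t :: "nat \<Rightarrow> real" and J L C and g :: "(nat \<Rightarrow> real) \<Rightarrow> real"
    assume t: "t 0 = 0" "\<And>j. t j < t (Suc j)" and g: "prefix_lipschitz (Suc J) L g" "\<And>x. \<bar>g x\<bar> \<le> C"
    show "(\<integral>\<omega>. g (\<lambda>j. sqrt (t j) * B 1 \<omega>) \<partial>P) = (\<integral>\<omega>. sc.kernel t J g (\<lambda>j. sqrt (t j) * B 1 \<omega>) \<partial>P)"
      by (rule sc.sqrt_markov[OF assms(2) p refl t g])
  qed
  also have "(\<lambda>\<omega>. \<lambda>t\<in>{0..}. Osc t (\<lambda>s. sqrt s * B 1 \<omega>)) = (\<lambda>\<omega>. \<lambda>t\<in>{0..}. sqrt t * \<bar>B 1 \<omega>\<bar>)"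
    by (intro ext restrict_ext) (simp add: Osc_sqrt)
  finally show "converges_in_distribution skorokhod_topology
      M (\<lambda>n \<omega>. \<lambda>t\<in>{0..}. real (card (walk_range X (nat \<lfloor>real n * t\<rfloor>) \<omega>)) / sqrt (real n * ln (real n)))
      P (\<lambda>\<omega>. \<lambda>t\<in>{0..}. sqrt t * \<bar>B 1 \<omega>\<bar>)" .
qed

end
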